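(* Let $k$ be an integer with $k\le-2$. Then the Ramond extremal irreducible highest weight Ramond twisted module $L^W\big(0,-\tfrac{k+1}4\big)$ over the $N=4$ superconformal algebra $W^k_{\min}(psl(2|2))$ is unitary.
   Context: $\mathfrak g=psl(2|2)$, $\mathfrak g_{\bar0}=\mathfrak s\oplus\mathfrak g^\natural$ with $\mathfrak s=\mathrm{span}(e,x,f)\cong sl_2$ ($[x,e]=e,[x,f]=-f,[e,f]=x$) and $\mathfrak g^\natural\cong sl_2$ the centralizer of $\mathfrak s$, with positive root $\theta_1$. $(\cdot|\cdot)$ is the invariant form with $(x|x)=\frac12$, so $(\theta_1|\theta_1)=-2$; $h^\vee=0$; $\mathrm{ad}\,x$-grading $\mathfrak g=\mathbb Cf\oplus\mathfrak g_{-1/2}\oplus(\mathbb Cx\oplus\mathfrak g^\natural)\oplus\mathfrak g_{1/2}\oplus\mathbb Ce$; $\mathfrak g_{-1/2}$ is odd, 4-dimensional, with $\mathfrak h^\natural$-weights $\pm\frac12\theta_1$, each of multiplicity 2 ($\mathfrak h^\natural$ a Cartan subalgebra of $\mathfrak g^\natural$). $p(k)=k(k+1)$. $W^k_{\min}(\mathfrak g)$ ($k\ne0$) is the universal minimal quantum affine $W$-algebra, strongly and freely generated by a Virasoro vector $L$ of central charge $-6(k+1)$, even primary $J^{\{a\}}$ ($a\in\mathfrak g^\natural$) of weight 1, odd primary $G^{\{u\}}$ ($u\in\mathfrak g_{-1/2}$) of weight $\frac32$, with $[J^{\{a\}}{}_\lambda J^{\{b\}}]=J^{\{[a,b]\}}+\lambda(k+1)(a|b)$,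 $[J^{\{a\}}{}_\lambda G^{\{u\}}]=G^{\{[a,u]\}}$, and $[G^{\{u\}}{}_\lambda G^{\{v\}}]=-2k\langle u,v\rangle L+\langle u,v\rangle\sum_\alpha:J^{\{a^\alpha\}}J^{\{a_\alpha\}}:+2\sum_{\alpha,\beta}\langle[a_\alpha,u],[v,a^\beta]\rangle:J^{\{a^\alpha\}}J^{\{a_\beta\}}:+2(k+1)(\partial+2\lambda)J^{\{[[e,u],v]^\natural\}}+2\lambda\sum_{\alpha,\beta}\langle[a_\alpha,u],[v,a^\beta]\rangle J^{\{[a^\alpha,a_\beta]\}}+2\lambda^2\langle u,v\rangle p(k)|0\rangle$, where $\{a_\alpha\},\{a^\alpha\}$ are dual bases of $\mathfrak g^\natural$, $\langle u,v\rangle=(e|[u,v])$, $b^\natural$ is the projection of $b\in\mathfrak g_0$ to $\mathfrak g^\natural$. Ramond twisted modules are modules twisted by the parity automorphism: $G^{\{u\}}(z)=\sum_{n\in\mathbb Z}G^{\{u\}}_nz^{-n-3/2}$, and $J_n^{\{a\}},L_n$ have $n\in\mathbb Z$. $L^W(\nu,\ell_0)$ is the irreducible one generated by a vector $v$ with $L_0v=\ell_0v$, $J_0^{\{h\}}v=\nu(h)v$ ($h\in\mathfrak h^\natural$), $J_n^{\{a\}}v=G_n^{\{u\}}v=L_nv=0$ for $n>0$, $J_0^{\{a\}}v=0$ for $a$ in the root space of $\theta_1$, and $G_0^{\{u\}}v=0$ for $u\in\mathfrak g_{-1/2}$ of weight $\frac12\theta_1$. Let $\phi$ be an almost compact conjugate-linear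 involution of $\mathfrak g$ (fixing $e,x,f$ and restricting to a compact involution of $\mathfrak g^\natural$). $L^W(\nu,\ell_0)$ is unitary if it carries a positive definite Hermitian form with $L_n^*=L_{-n}$, $(J_n^{\{a\}})^*=-J_{-n}^{\{\phi(a)\}}$, $(G_n^{\{u\}})^*=G_{-n}^{\{\phi(u)\}}$. The only Ramond extremal weight is $\nu=0$.
   Formalization: The almost compact involution φ is additionally required to satisfy ⟨φ(u),u⟩>0 for nonzero u in g_{-1/2}; composing φ with parity flips this sign, and with the negative sign the norm of G_{-1}^u v would be negative, so unitarity fails. *)

theory Defs
  imports "HOL-Analysis.Analysis"
begin

section \<open>The Lie superalgebra psl(2|2)\<close>

text \<open>
  Indices 1, 2 are even and 3, 4 are odd. Each class of sl(2|2) modulo scalar matrices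
  contains exactly one matrix whose two diagonal blocks are traceless; psl(2|2) is carried by these
  representatives, and \<open>psl_rep\<close> is the quotient map (lemmas \<open>psl_rep_range\<close> to \<open>psl_rep_br\<close>).
\<close>

type_synonym mat4 = "complex^4^4"

definition cmul :: "complex \<Rightarrow> mat4 \<Rightarrow> mat4" where
  "cmul c A = (\<chi> i j. c * A $ i $ j)"

definition munit :: "4 \<Rightarrow> 4 \<Rightarrow> mat4" where
  "munit p q = (\<chi> i j. if i = p \<and> j = q then 1 else 0)"

definition odd_index :: "4 \<Rightarrow> bool" where
  "odd_index i \<longleftrightarrow> i = 3 \<or> i = 4"

definition even_comp :: "mat4 \<Rightarrow> mat4" where
  "even_comp A = (\<chi> i j. if odd_index i = odd_index j then A $ i $ j else 0)"

definition odd_comp :: "mat4 \<Rightarrow> mat4" where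
  "odd_comp A = (\<chi> i j. if odd_index i = odd_index j then 0 else A $ i $ j)"

definition supertrace :: "mat4 \<Rightarrow> complex" where
  "supertrace A = A $ 1 $ 1 + A $ 2 $ 2 - A $ 3 $ 3 - A $ 4 $ 4"

definition supercomm :: "mat4 \<Rightarrow> mat4 \<Rightarrow> mat4" where
  "supercomm A B = A ** B - (even_comp B ** even_comp A + even_comp B ** odd_comp A
      + odd_comp B ** even_comp A - odd_comp B ** odd_comp A)"

definition sl22 :: "mat4 set" where
  "sl22 = {A. supertrace A = 0}"

definition psl22 :: "mat4 set" where
  "psl22 = {A. A $ 1 $ 1 + A $ 2 $ 2 = 0 \<and> A $ 3 $ 3 + A $ 4 $ 4 = 0}"

definition psl_rep :: "mat4 \<Rightarrow> mat4" where
  "psl_rep A = A - cmul ((A $ 1 $ 1 + A $ 2 $ 2) / 2) (mat 1)"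

definition br :: "mat4 \<Rightarrow> mat4 \<Rightarrow> mat4" where
  "br A B = psl_rep (supercomm A B)"

definition psl_part :: "bool \<Rightarrow> mat4 set" where
  "psl_part p = {A \<in> psl22. (if p then even_comp A else odd_comp A) = 0}"

definition form :: "mat4 \<Rightarrow> mat4 \<Rightarrow> complex" where
  "form A B = supertrace (A ** B)"

definition e_s :: mat4 where "e_s = munit 1 2"
definition x_s :: mat4 where "x_s = cmul (1/2) (munit 1 1 - munit 2 2)"
definition f_s :: mat4 where "f_s = cmul (1/2) (munit 2 1)"

definition ad_x_space :: "complex \<Rightarrow> mat4 set" where
  "ad_x_space j = {a \<in> psl22. br x_s a = cmul j a}"

abbreviation g_mhalf :: "mat4 set" where
  "g_mhalf \<equiv> ad_x_space (- (1/2))"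

definition g_nat :: "mat4 set" where
  "g_nat = {a \<in> psl22. br e_s a = 0 \<and> br x_s a = 0 \<and> br f_s a = 0}"

text \<open>
  On the zero space of ad x, the sum of the line of x and \<open>g_nat\<close>, this is the projection to
  \<open>g_nat\<close>: the sum is orthogonal and (x|x) = 1/2.
\<close>

definition nat_proj :: "mat4 \<Rightarrow> mat4" where
  "nat_proj b = b - cmul (2 * form x_s b) x_s"

definition h_nat :: "mat4 set" where
  "h_nat = {h \<in> g_nat. \<forall>i j. i \<noteq> j \<longrightarrow> h $ i $ j = 0}"

definition theta1 :: "mat4 \<Rightarrow> complex" where
  "theta1 h = h $ 3 $ 3 - h $ 4 $ 4"

definition root_space_theta1 :: "mat4 set" where
  "root_space_theta1 = {a \<in> g_nat. \<forall>h\<in>h_nat. br h a = cmul (theta1 h) a}"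

definition weight_space_half_theta1 :: "mat4 set" where
  "weight_space_half_theta1 = {u \<in> g_mhalf. \<forall>h\<in>h_nat. br h u = cmul (theta1 h / 2) u}"

definition ang :: "mat4 \<Rightarrow> mat4 \<Rightarrow> complex" where
  "ang u v = form e_s (br u v)"

definition nat_basis :: "nat \<Rightarrow> mat4" where
  "nat_basis \<alpha> = [munit 3 4, munit 3 3 - munit 4 4, munit 4 3] ! \<alpha>"

definition nat_dual :: "nat \<Rightarrow> mat4" where
  "nat_dual \<alpha> = [- munit 4 3, cmul (-(1/2)) (munit 3 3 - munit 4 4), - munit 3 4] ! \<alpha>"

definition killing_nat :: "mat4 \<Rightarrow> mat4 \<Rightarrow> complex" where
  "killing_nat a b = (\<Sum>\<alpha><3. form (nat_dual \<alpha>) (br a (br b (nat_basis \<alpha>))))"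

definition conj_linear_involution :: "(mat4 \<Rightarrow> mat4) \<Rightarrow> bool" where
  "conj_linear_involution \<phi> \<longleftrightarrow>
     (\<forall>p. \<forall>a\<in>psl_part p. \<phi> a \<in> psl_part p) \<and>
     (\<forall>a\<in>psl22. \<forall>b\<in>psl22. \<phi> (a + b) = \<phi> a + \<phi> b) \<and>
     (\<forall>c. \<forall>a\<in>psl22. \<phi> (cmul c a) = cmul (cnj c) (\<phi> a)) \<and>
     (\<forall>a\<in>psl22. \<forall>b\<in>psl22. \<phi> (br a b) = br (\<phi> a) (\<phi> b)) \<and>
     (\<forall>a\<in>psl22. \<phi> (\<phi> a) = a)"

text \<open>
  Compactness of the restriction to \<open>g_nat\<close>: the Killing form of \<open>g_nat\<close>, which is real on the
  real form of fixed points, is negative definite there.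
\<close>

definition almost_compact :: "(mat4 \<Rightarrow> mat4) \<Rightarrow> bool" where
  "almost_compact \<phi> \<longleftrightarrow> conj_linear_involution \<phi> \<and>
     \<phi> e_s = e_s \<and> \<phi> x_s = x_s \<and> \<phi> f_s = f_s \<and>
     (\<forall>a\<in>g_nat. \<phi> a = a \<and> a \<noteq> 0 \<longrightarrow> Re (killing_nat a a) < 0)"

text \<open>
  For almost compact \<open>\<phi>\<close> the Hermitian form \<open>ang (\<phi> u) v\<close> on \<open>g_mhalf\<close> is definite, and composing
  \<open>\<phi>\<close> with the parity automorphism gives another almost compact involution for which it has the
  opposite sign. Only one of the two is compatible with unitarity: the squared norm of
  \<open>G\<^sup>u\<^sub>-\<^sub>1 v\<close> (v a Ramond highest weight vector as in the theorem) is a positive multiple of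
  \<open>ang (\<phi> u) u\<close>. The following predicate fixes that sign.
\<close>

definition positive_on_g_mhalf :: "(mat4 \<Rightarrow> mat4) \<Rightarrow> bool" where
  "positive_on_g_mhalf \<phi> \<longleftrightarrow> (\<forall>u\<in>g_mhalf. u \<noteq> 0 \<longrightarrow> 0 < Re (ang (\<phi> u) u))"

lemmas mat4_simps =
  cmul_def munit_def odd_index_def even_comp_def odd_comp_def supertrace_def
  matrix_matrix_mult_def mat_def sum_4 vec_eq_iff forall_4

lemma psl_rep_range: "psl_rep ` sl22 = psl22"
proof
  show "psl_rep ` sl22 \<subseteq> psl22"
    by (auto simp: psl_rep_def sl22_def psl22_def mat4_simps field_simps) algebra
  have "A = psl_rep A \<and> A \<in> sl22" if "A \<in> psl22" for A
    using that by (auto simp: psl_rep_def sl22_def psl22_def mat4_simps algebra_simps)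
  then show "psl22 \<subseteq> psl_rep ` sl22" by blast
qed

lemma psl_rep_kernel: "A \<in> sl22 \<Longrightarrow> psl_rep A = 0 \<longleftrightarrow> (\<exists>c. A = cmul c (mat 1))"
  by (auto simp: psl_rep_def mat4_simps)

lemma psl_rep_br:
  assumes "A \<in> sl22" "B \<in> sl22"
  shows "supercomm A B \<in> sl22" and "br (psl_rep A) (psl_rep B) = psl_rep (supercomm A B)"
proof -
  show "supercomm A B \<in> sl22"
    by (simp add: supercomm_def sl22_def mat4_simps algebra_simps)
  have "supercomm (A - cmul s (mat 1)) (B - cmul t (mat 1)) = supercomm A B" for s t
    by (simp add: supercomm_def mat4_simps algebra_simps)
  then have "supercomm (psl_rep A) (psl_rep B) = supercomm A B"
    by (simp add: psl_rep_def)
  then show "br (psl_rep A) (psl_rep B) = psl_rep (supercomm A B)"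
    by (simp add: br_def)
qed

lemma sl2_triple:
  "br x_s e_s = e_s" "br x_s f_s = - f_s" "br e_s f_s = x_s" "form x_s x_s = 1/2"
  by (simp_all add: br_def psl_rep_def supercomm_def form_def e_s_def x_s_def f_s_def mat4_simps)

lemma nat_dual_bases:
  "\<alpha> < 3 \<Longrightarrow> \<beta> < 3 \<Longrightarrow> form (nat_basis \<alpha>) (nat_dual \<beta>) = (if \<alpha> = \<beta> then 1 else 0)"
  by (auto simp: less_Suc_eq numeral_3_eq_3 nat_basis_def nat_dual_def form_def mat4_simps)

section \<open>Vertex superalgebras\<close>

locale superspace = vector_space scl
  for scl :: "complex \<Rightarrow> 'v::ab_group_add \<Rightarrow> 'v" +
  fixes part :: "bool \<Rightarrow> 'v set"  \<comment> \<open>\<open>True\<close> indexes the odd subspace\<close>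
  assumes subspace_part: "subspace (part p)"
    and part_inter: "part False \<inter> part True = {0}"
    and part_sum: "\<exists>y\<in>part False. \<exists>z\<in>part True. w = y + z"

definition finsupp_sum :: "(nat \<Rightarrow> 'v::ab_group_add) \<Rightarrow> 'v" where
  "finsupp_sum t = (\<Sum>j | t j \<noteq> 0. t j)"

definition koszul :: "bool \<Rightarrow> bool \<Rightarrow> complex" where
  "koszul p q = (if p \<and> q then -1 else 1)"

definition int_sign :: "int \<Rightarrow> complex" where
  "int_sign n = (if even n then 1 else -1)"

text \<open>
  \<open>nprod n a b\<close> is the n-th product of a and b; the sums in the Borcherds identity have finite
  support by truncation.
\<close>

locale vertex_superalgebra = superspace scl part
  for scl :: "complex \<Rightarrow> 'v::ab_group_add \<Rightarrow> 'v" and part +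
  fixes vac :: 'v and nprod :: "int \<Rightarrow> 'v \<Rightarrow> 'v \<Rightarrow> 'v"
  assumes nprod_add_left: "nprod n (a + b) c = nprod n a c + nprod n b c"
    and nprod_add_right: "nprod n a (b + c) = nprod n a b + nprod n a c"
    and nprod_scl_left: "nprod n (scl t a) b = scl t (nprod n a b)"
    and nprod_scl_right: "nprod n a (scl t b) = scl t (nprod n a b)"
    and nprod_part: "a \<in> part p \<Longrightarrow> b \<in> part q \<Longrightarrow> nprod n a b \<in> part (p \<noteq> q)"
    and truncation: "\<exists>N. \<forall>n\<ge>N. nprod n a b = 0"
    and vac_even: "vac \<in> part False"
    and vac_left: "nprod n vac a = (if n = -1 then a else 0)"
    and vac_right: "nprod (-1) a vac = a" "0 \<le> n \<Longrightarrow> nprod n a vac = 0"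
    and borcherds: "a \<in> part p \<Longrightarrow> b \<in> part q \<Longrightarrow>
      finsupp_sum (\<lambda>j. scl (of_int m gchoose j) (nprod (m + l - int j) (nprod (n + int j) a b) c))
      = finsupp_sum (\<lambda>j. scl ((-1) ^ j * (of_int n gchoose j))
          (nprod (m + n - int j) a (nprod (l + int j) b c)
           - scl (koszul p q * int_sign n) (nprod (n + l - int j) b (nprod (m + int j) a c))))"
begin

definition deriv_T :: "'v \<Rightarrow> 'v" where
  "deriv_T a = nprod (-2) a vac"

definition normal_prod :: "'v \<Rightarrow> 'v \<Rightarrow> 'v" where
  "normal_prod a b = nprod (-1) a b"

text \<open>
  \<open>lambda_bracket a b cs\<close>: the bracket of a and b is the polynomial in \<open>\<lambda>\<close> with coefficient list cs
  (constant term first). By definition its n-th coefficient is the n-th product divided by n!.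
\<close>

definition lambda_bracket :: "'v \<Rightarrow> 'v \<Rightarrow> 'v list \<Rightarrow> bool" where
  "lambda_bracket a b cs \<longleftrightarrow>
     (\<forall>n. scl (1 / fact n) (nprod (int n) a b) = (if n < length cs then cs ! n else 0))"

primrec word_vec :: "'v list \<Rightarrow> (nat \<times> nat) list \<Rightarrow> 'v" where
  "word_vec gs [] = vac"
| "word_vec gs (x # w) = nprod (- int (snd x)) (gs ! fst x) (word_vec gs w)"

text \<open>Ordered monomials; a factor (i, n) may be repeated only if the i-th generator is even.\<close>

definition ordered_words :: "'v list \<Rightarrow> (nat \<times> nat) list set" where
  "ordered_words gs = {w. (\<forall>(i, n) \<in> set w. i < length gs \<and> 1 \<le> n) \<and>
     sorted_wrt (\<lambda>(i, n) (j, m). i < j \<or> i = j \<and> (m < n \<or> m = n \<and> gs ! i \<in> part False)) w}"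

definition strongly_freely_generated :: "'v list \<Rightarrow> bool" where
  "strongly_freely_generated gs \<longleftrightarrow>
     inj_on (word_vec gs) (ordered_words gs) \<and>
     independent (word_vec gs ` ordered_words gs) \<and>
     span (word_vec gs ` ordered_words gs) = UNIV"

end

section \<open>The minimal W-algebra of psl(2|2) at level k\<close>

text \<open>\<open>J a\<close> and \<open>G u\<close> are relevant only for a in \<open>g_nat\<close> and u in \<open>g_mhalf\<close>.\<close>

locale minimal_W_psl22 = vertex_superalgebra scl part vac nprod
  for scl :: "complex \<Rightarrow> 'v::ab_group_add \<Rightarrow> 'v" and part vac nprod +
  fixes k :: complex and L :: 'v and J :: "mat4 \<Rightarrow> 'v" and G :: "mat4 \<Rightarrow> 'v"
  assumes level_nonzero: "k \<noteq> 0"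
    and L_even: "L \<in> part False"
    and J_even: "a \<in> g_nat \<Longrightarrow> J a \<in> part False"
    and G_odd: "u \<in> g_mhalf \<Longrightarrow> G u \<in> part True"
    and J_linear: "a \<in> g_nat \<Longrightarrow> b \<in> g_nat \<Longrightarrow> J (a + b) = J a + J b"
      "a \<in> g_nat \<Longrightarrow> J (cmul t a) = scl t (J a)"
    and G_linear: "u \<in> g_mhalf \<Longrightarrow> v \<in> g_mhalf \<Longrightarrow> G (u + v) = G u + G v"
      "u \<in> g_mhalf \<Longrightarrow> G (cmul t u) = scl t (G u)"
    and generated: "strongly_freely_generated
      (L # map J [munit 3 4, munit 3 3 - munit 4 4, munit 4 3]
         @ map G [munit 2 3, munit 2 4, munit 3 1, munit 4 1])"
    and LL: "lambda_bracket L L [deriv_T L, scl 2 L, 0, scl (- 6 * (k + 1) / 12) vac]"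
    and LJ: "a \<in> g_nat \<Longrightarrow> lambda_bracket L (J a) [deriv_T (J a), J a]"
    and LG: "u \<in> g_mhalf \<Longrightarrow> lambda_bracket L (G u) [deriv_T (G u), scl (3/2) (G u)]"
    and JJ: "a \<in> g_nat \<Longrightarrow> b \<in> g_nat \<Longrightarrow>
      lambda_bracket (J a) (J b) [J (br a b), scl ((k + 1) * form a b) vac]"
    and JG: "a \<in> g_nat \<Longrightarrow> u \<in> g_mhalf \<Longrightarrow> lambda_bracket (J a) (G u) [G (br a u)]"
    and GG: "u \<in> g_mhalf \<Longrightarrow> v \<in> g_mhalf \<Longrightarrow> lambda_bracket (G u) (G v)
      [scl (- 2 * k * ang u v) L
         + scl (ang u v) (\<Sum>\<alpha><3. normal_prod (J (nat_dual \<alpha>)) (J (nat_basis \<alpha>)))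
         + scl 2 (\<Sum>\<alpha><3. \<Sum>\<beta><3. scl (ang (br (nat_basis \<alpha>) u) (br v (nat_dual \<beta>)))
             (normal_prod (J (nat_dual \<alpha>)) (J (nat_basis \<beta>))))
         + scl (2 * (k + 1)) (deriv_T (J (nat_proj (br (br e_s u) v)))),
       scl (4 * (k + 1)) (J (nat_proj (br (br e_s u) v)))
         + scl 2 (\<Sum>\<alpha><3. \<Sum>\<beta><3. scl (ang (br (nat_basis \<alpha>) u) (br v (nat_dual \<beta>)))
             (J (br (nat_dual \<alpha>) (nat_basis \<beta>)))),
       scl (2 * ang u v * (k * (k + 1))) vac]"

section \<open>Ramond twisted modules\<close>

text \<open>
  \<open>md r a\<close> is the coefficient of \<open>z\<close> to the power \<open>-r-1\<close> in the twisted field of a. The twist by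
  parity means that r runs over the integers if a is even and over 1/2 plus the integers if a is odd.
\<close>

definition twist :: "bool \<Rightarrow> rat" where
  "twist p = (if p then 1/2 else 0)"

locale ramond_module = V: vertex_superalgebra scl part vac nprod + M: superspace mscl mpart
  for scl :: "complex \<Rightarrow> 'v::ab_group_add \<Rightarrow> 'v" and part vac nprod
    and mscl :: "complex \<Rightarrow> 'm::ab_group_add \<Rightarrow> 'm" and mpart +
  fixes md :: "rat \<Rightarrow> 'v \<Rightarrow> 'm \<Rightarrow> 'm"
  assumes md_twisted: "a \<in> part p \<Longrightarrow> r - twist p \<notin> \<int> \<Longrightarrow> md r a w = 0"
    and md_add_left: "md r (a + b) w = md r a w + md r b w"
    and md_add_right: "md r a (w + w') = md r a w + md r a w'"
    and md_scl_left: "md r (scl t a) w = mscl t (md r a w)"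
    and md_scl_right: "md r a (mscl t w) = mscl t (md r a w)"
    and md_part: "a \<in> part p \<Longrightarrow> w \<in> mpart q \<Longrightarrow> md r a w \<in> mpart (p \<noteq> q)"
    and md_truncation: "\<exists>N. \<forall>r\<ge>N. md r a w = 0"
    and md_vac: "md r vac w = (if r = -1 then w else 0)"
    and md_borcherds: "a \<in> part p \<Longrightarrow> b \<in> part q \<Longrightarrow>
      r - twist p \<in> \<int> \<Longrightarrow> s - twist q \<in> \<int> \<Longrightarrow>
      finsupp_sum (\<lambda>j. mscl (of_rat (r gchoose j)) (md (r + s - of_nat j) (nprod (n + int j) a b) w))
      = finsupp_sum (\<lambda>j. mscl ((-1) ^ j * (of_int n gchoose j))
          (md (r + of_int n - of_nat j) a (md (s + of_nat j) b w)
           - mscl (koszul p q * int_sign n)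
               (md (of_int n + s - of_nat j) b (md (r + of_nat j) a w))))"
begin

definition submodule :: "'m set \<Rightarrow> bool" where
  "submodule W \<longleftrightarrow> M.subspace W \<and>
     (\<forall>w\<in>W. \<exists>y\<in>W \<inter> mpart False. \<exists>z\<in>W \<inter> mpart True. w = y + z) \<and>
     (\<forall>r a. \<forall>w\<in>W. md r a w \<in> W)"

definition irreducible_module :: bool where
  "irreducible_module \<longleftrightarrow> (UNIV :: 'm set) \<noteq> {0} \<and> (\<forall>W. submodule W \<longrightarrow> W = {0} \<or> W = UNIV)"

definition generated_by :: "'m \<Rightarrow> bool" where
  "generated_by v \<longleftrightarrow> (\<forall>W. submodule W \<and> v \<in> W \<longrightarrow> W = UNIV)"

end

text \<open>
  Modes are shifted by the conformal weight minus 1: an element a of conformal weight \<open>\<Delta>\<close> has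
  field with coefficient \<open>a\<^sub>n\<close> at \<open>z\<close> to the power \<open>-n-\<Delta>\<close>.
\<close>

locale ramond_W_module =
  minimal_W_psl22 scl part vac nprod k L J G +
  ramond_module scl part vac nprod mscl mpart md
  for scl :: "complex \<Rightarrow> 'v::ab_group_add \<Rightarrow> 'v" and part vac nprod k L J G
    and mscl :: "complex \<Rightarrow> 'm::ab_group_add \<Rightarrow> 'm" and mpart md
begin

definition L_mode :: "int \<Rightarrow> 'm \<Rightarrow> 'm" where
  "L_mode n = md (of_int n + 1) L"

definition J_mode :: "mat4 \<Rightarrow> int \<Rightarrow> 'm \<Rightarrow> 'm" where
  "J_mode a n = md (of_int n) (J a)"

definition G_mode :: "mat4 \<Rightarrow> int \<Rightarrow> 'm \<Rightarrow> 'm" where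
  "G_mode u n = md (of_int n + 1/2) (G u)"

definition highest_weight_vector :: "(mat4 \<Rightarrow> complex) \<Rightarrow> complex \<Rightarrow> 'm \<Rightarrow> bool" where
  "highest_weight_vector \<nu> l0 v \<longleftrightarrow> v \<noteq> 0 \<and>
     L_mode 0 v = mscl l0 v \<and>
     (\<forall>h\<in>h_nat. J_mode h 0 v = mscl (\<nu> h) v) \<and>
     (\<forall>n>0. L_mode n v = 0 \<and> (\<forall>a\<in>g_nat. J_mode a n v = 0) \<and> (\<forall>u\<in>g_mhalf. G_mode u n v = 0)) \<and>
     (\<forall>a\<in>root_space_theta1. J_mode a 0 v = 0) \<and>
     (\<forall>u\<in>weight_space_half_theta1. G_mode u 0 v = 0)"

text \<open>The module is (a copy of) the irreducible highest weight module with data \<open>\<nu>\<close>, \<open>l0\<close>.\<close>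

definition is_LW :: "(mat4 \<Rightarrow> complex) \<Rightarrow> complex \<Rightarrow> bool" where
  "is_LW \<nu> l0 \<longleftrightarrow> irreducible_module \<and> (\<exists>v. highest_weight_vector \<nu> l0 v \<and> generated_by v)"

definition adjoint_wrt :: "('m \<Rightarrow> 'm \<Rightarrow> complex) \<Rightarrow> ('m \<Rightarrow> 'm) \<Rightarrow> ('m \<Rightarrow> 'm) \<Rightarrow> bool" where
  "adjoint_wrt H A B \<longleftrightarrow> (\<forall>x y. H (A x) y = H x (B y))"

definition positive_definite_hermitian :: "('m \<Rightarrow> 'm \<Rightarrow> complex) \<Rightarrow> bool" where
  "positive_definite_hermitian H \<longleftrightarrow>
     (\<forall>x y z. H x (y + z) = H x y + H x z) \<and>
     (\<forall>t x y. H x (mscl t y) = t * H x y) \<and>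
     (\<forall>x y. H y x = cnj (H x y)) \<and>
     (\<forall>x. x \<noteq> 0 \<longrightarrow> 0 < Re (H x x))"

definition unitary_module :: "(mat4 \<Rightarrow> mat4) \<Rightarrow> bool" where
  "unitary_module \<phi> \<longleftrightarrow> (\<exists>H. positive_definite_hermitian H \<and>
     (\<forall>n. adjoint_wrt H (L_mode n) (L_mode (- n))) \<and>
     (\<forall>n. \<forall>a\<in>g_nat. adjoint_wrt H (J_mode a n) (\<lambda>w. - J_mode (\<phi> a) (- n) w)) \<and>
     (\<forall>n. \<forall>u\<in>g_mhalf. adjoint_wrt H (G_mode u n) (G_mode (\<phi> u) (- n))))"

end

end

theory Submission
  imports Defs "HOL-Library.Poly_Mapping" "HOL-Library.FSet" "HOL-Library.Multiset"
    "HOL-Library.Nat_Bijection"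
begin

text \<open>
  For psl(2|2) the quadratic terms in the bracket of two supercurrents cancel up to a derivative, so
  that the modes of the fields J, L, G span a linear Lie superalgebra, which is generated by the
  modes of G. With N = -(k+1) > 0, this superalgebra acts on the Fock space of N copies of four
  free bosons and four free fermions in the Ramond sector, by supercharges bilinear in a boson and a
  fermion with the signed permutation matrices of the quaternion units as coefficients. The Fock space
  has a positive definite contravariant form, and its vacuum, a singlet of the zero modes, has the
  eigenvalues (0, N/4) of the highest weight vector of the module M.

  The span of all pairs (w v, w |0>), for w a word in the modes of G, is the graph of an embedding of
  M into the Fock space. It is a span of words in modes of positive degree, for a grading which combines
  the conformal weight with the weight of sl(2), so that a pair is determined modulo positive degree by
  the vacuum coefficient of its second component. Hence the vectors m of the pairs (m, 0) have
  positive degree and vanish by irreducibility, and the pairs (0, f) are zero because f is orthogonal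
  to all second components. The form of the Fock space is pulled back along this embedding.
\<close>

section \<open>Fock space\<close>

text \<open>Modes of L and J are never built on the Fock space. An anticommutator of two
  supercharges enters only through its commutators with supercharges and its value on the vacuum.
  Both agree with the module M, and words in the modes of G see nothing else. The pairs replace a
  homomorphism whose existence is not known beforehand, so that neither a PBW basis of the mode
  algebra nor a Verma module is constructed.

  The constants come from free field theory. Four bosons and four real fermions have c = 6 and carry
  sl(2) currents of level 1, so that N copies match the central charge -6(k+1). Four Ramond fermions
  have ground energy 4/16, whence the eigenvalue N/4. Equal supercharges anticommute to 2 L, whereas
  the bracket of G has -2k L; the supercharges are therefore rescaled by sqrt(-k), which is real for
  negative k and so respects adjoints.\<close>

type_synonym fock_state = "nat multiset \<times> nat fset"
type_synonym fock = "fock_state \<Rightarrow>\<^sub>0 complex"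

abbreviation amp :: "fock \<Rightarrow> fock_state \<Rightarrow> complex" where
  "amp \<equiv> Poly_Mapping.lookup"

abbreviation supp :: "fock \<Rightarrow> fock_state set" where
  "supp \<equiv> Poly_Mapping.keys"

definition fsc :: "complex \<Rightarrow> fock \<Rightarrow> fock" where
  "fsc c = Poly_Mapping.map ((*) c)"

lemma amp_fsc [simp]: "amp (fsc c f) s = c * amp f s"
  by (simp add: fsc_def map.rep_eq when_def)

lemma vector_space_fsc: "vector_space fsc"
  by unfold_locales (auto intro!: poly_mapping_eqI simp: lookup_add algebra_simps)

definition fip :: "fock \<Rightarrow> fock \<Rightarrow> complex" where
  "fip f g = (\<Sum>s\<in>supp f. cnj (amp f s) * amp g s)"

lemma fip_superset:
  assumes "finite A" "supp f \<subseteq> A"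
  shows "fip f g = (\<Sum>s\<in>A. cnj (amp f s) * amp g s)"
  unfolding fip_def by (rule sum.mono_neutral_left) (use assms in \<open>auto simp: in_keys_iff\<close>)

lemma fip_add_right: "fip f (g + h) = fip f g + fip f h"
  by (simp add: fip_def lookup_add algebra_simps sum.distrib)

lemma fip_scale_right: "fip f (fsc c g) = c * fip f g"
  by (simp add: fip_def sum_distrib_left algebra_simps)

lemma fip_cnj: "fip g f = cnj (fip f g)"
  using fip_superset[of "supp f \<union> supp g" f g] fip_superset[of "supp f \<union> supp g" g f]
  by (simp add: mult.commute)

lemma fip_pos:
  assumes "f \<noteq> 0" shows "0 < Re (fip f f)"
proof -
  have "fip f f = of_real (\<Sum>s\<in>supp f. (cmod (amp f s))\<^sup>2)"
    unfolding fip_def of_real_sum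
    by (intro sum.cong) (simp_all add: complex_norm_square mult.commute del: of_real_power)
  moreover have "0 < (\<Sum>s\<in>supp f. (cmod (amp f s))\<^sup>2)"
    using assms by (intro sum_pos) (auto simp: in_keys_iff)
  ultimately show ?thesis by simp
qed

text \<open>Matrix entries: row \<open>s\<close> has its only entry \<open>w s\<close> in column \<open>t
  s\<close>.\<close>

definition shift_op :: "(fock_state \<Rightarrow> fock_state) \<Rightarrow>
  (fock_state \<Rightarrow> complex) \<Rightarrow> fock \<Rightarrow> fock" where
  "shift_op t w f = Abs_poly_mapping (\<lambda>s. w s * amp f (t s))"

text \<open>Where the weight is nonzero, \<open>t\<close> is inverted by \<open>t'\<close>, so the
  support of the result lies in the image of \<open>supp f\<close> under \<open>t'\<close>.
  Finiteness of this support is what makes \<open>Abs_poly_mapping\<close> return the intended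
  function.\<close>

lemma lookup_shift_op:
  assumes "\<And>s. w s \<noteq> 0 \<Longrightarrow> t' (t s) = s"
  shows "amp (shift_op t w f) s = w s * amp f (t s)"
proof -
  have "{s. w s * amp f (t s) \<noteq> 0} \<subseteq> t' ` supp f"
  proof
    fix s assume s: "s \<in> {s. w s * amp f (t s) \<noteq> 0}"
    then have "t s \<in> supp f" "s = t' (t s)" using assms[of s] by (auto simp: in_keys_iff)
    then show "s \<in> t' ` supp f" by blast
  qed
  then have "finite {s. w s * amp f (t s) \<noteq> 0}"
    by (rule finite_subset) simp
  then show ?thesis
    by (simp add: shift_op_def)
qed

text \<open>The matrices are conjugate transposes of each other: \<open>t\<close> and
  \<open>t'\<close> are mutually inverse between the rows of nonzero weight, and reindexing along
  them turns one sum into the other.\<close>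

lemma shift_op_adjoint:
  assumes "\<And>s. w s \<noteq> 0 \<Longrightarrow> t' (t s) = s \<and> w' (t s) = cnj (w s)"
    and "\<And>s. w' s \<noteq> 0 \<Longrightarrow> t (t' s) = s \<and> w (t' s) = cnj (w' s)"
  shows "fip (shift_op t w f) g = fip f (shift_op t' w' g)"
proof -
  have l: "amp (shift_op t w f) s = w s * amp f (t s)" for s
    by (rule lookup_shift_op[of w t' t]) (use assms in blast)
  have l': "amp (shift_op t' w' g) s = w' s * amp g (t' s)" for s
    by (rule lookup_shift_op[of w' t t']) (use assms in blast)
  have fin: "finite {s. w s \<noteq> 0 \<and> amp f (t s) \<noteq> 0 \<and> amp g s = 0}"
    by (rule finite_subset[OF _ finite_keys[of "shift_op t w f"]]) (auto simp: in_keys_iff l)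
  show ?thesis
    unfolding fip_def l l'
    by (rule sum.reindex_bij_witness_not_neutral
        [where S' = "{s \<in> supp (shift_op t w f). amp g s = 0}"
          and T' = "{s \<in> supp f. w' s * amp g (t' s) = 0}" and i = t' and j = t])
      (use assms fin in \<open>auto simp: in_keys_iff l\<close>)
qed

text \<open>The Jordan-Wigner sign, which makes ladder operators of different fermionic modes
  anticommute.\<close>

definition sgn_before :: "nat \<Rightarrow> nat fset \<Rightarrow> complex" where
  "sgn_before x S = (-1) ^ card {y \<in> fset S. y < x}"

lemma sgn_before_finsert:
  assumes "y |\<notin>| S"
  shows "sgn_before x (finsert y S) = (if y < x then - sgn_before x S else sgn_before x S)"
proof -
  have "{z \<in> fset (finsert y S). z < x} =
      (if y < x then insert y {z \<in> fset S. z < x} else {z \<in> fset S. z < x})"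
    by auto
  moreover have "finite {z \<in> fset S. z < x}" by simp
  ultimately show ?thesis using assms by (simp add: sgn_before_def)
qed

lemma sgn_before_fminus:
  assumes "y |\<in>| S"
  shows "sgn_before x (S |-| {|y|}) = (if y < x then - sgn_before x S else sgn_before x S)"
proof -
  obtain S' where S: "S = finsert y S'" "y |\<notin>| S'" using assms
    by (metis set_finsert)
  then show ?thesis
    using sgn_before_finsert[OF S(2), of x] by (auto simp: fminus_finsert_absorb)
qed

lemma sgn_before_square [simp]: "sgn_before x S * sgn_before x S = 1"
  by (simp add: sgn_before_def flip: power_add mult_2)

lemma cnj_sgn_before [simp]: "cnj (sgn_before x S) = sgn_before x S"
  by (simp add: sgn_before_def)

definition fann :: "nat \<Rightarrow> fock \<Rightarrow> fock" where
  "fann x = shift_op (\<lambda>(m, S). (m, finsert x S)) (\<lambda>(m, S).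
    if x |\<in>| S then 0 else sgn_before x S)"

definition fcre :: "nat \<Rightarrow> fock \<Rightarrow> fock" where
  "fcre x = shift_op (\<lambda>(m, S). (m, S |-| {|x|})) (\<lambda>(m, S).
    if x |\<in>| S then sgn_before x S else 0)"

text \<open>The square roots refer to an orthonormal basis of occupation states; with them
  annihilation and creation are adjoint for \<open>fip\<close>.\<close>

definition bann :: "nat \<Rightarrow> fock \<Rightarrow> fock" where
  "bann x = shift_op (\<lambda>(m, S). (add_mset x m, S)) (\<lambda>(m, S). of_real (sqrt (real (count m x) + 1)))"

definition bcre :: "nat \<Rightarrow> fock \<Rightarrow> fock" where
  "bcre x = shift_op (\<lambda>(m, S). (m - {#x#}, S)) (\<lambda>(m, S). of_real (sqrt (real (count m x))))"

lemma finsert_fminus_id: "x |\<in>| S \<Longrightarrow> finsert x (S |-| {|x|}) = S"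
  by auto

lemma fminus_finsert_id: "x |\<notin>| S \<Longrightarrow> finsert x S |-| {|x|} = S"
  by auto

lemma finsert_fminus_ne: "x \<noteq> y \<Longrightarrow> finsert x S |-| {|y|} = finsert x (S |-| {|y|})"
  by auto

lemma lookup_fann:
  "amp (fann x f) (m, S) = (if x |\<in>| S then 0 else sgn_before x S * amp f (m, finsert x S))"
  unfolding fann_def
  by (subst lookup_shift_op[where t' = "\<lambda>(m, S). (m, S |-| {|x|})"])
    (auto simp: fminus_finsert_id split: if_splits)

lemma lookup_fcre:
  "amp (fcre x f) (m, S) = (if x |\<in>| S then sgn_before x S * amp f (m, S |-| {|x|}) else 0)"
  unfolding fcre_def
  by (subst lookup_shift_op[where t' = "\<lambda>(m, S). (m, finsert x S)"])
    (auto simp: finsert_fminus_id split: if_splits)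

lemma lookup_bann:
  "amp (bann x f) (m, S) = of_real (sqrt (real (count m x) + 1)) * amp f (add_mset x m, S)"
  unfolding bann_def
  by (subst lookup_shift_op[where t' = "\<lambda>(m, S). (m - {#x#}, S)"]) auto

lemma lookup_bcre:
  "amp (bcre x f) (m, S) = of_real (sqrt (real (count m x))) * amp f (m - {#x#}, S)"
  unfolding bcre_def
  by (subst lookup_shift_op[where t' = "\<lambda>(m, S). (add_mset x m, S)"])
    (auto simp: count_greater_zero_iff[symmetric] simp del: count_greater_zero_iff)

lemma fann_adjoint: "fip (fann x f) g = fip f (fcre x g)"
  unfolding fann_def fcre_def
  by (rule shift_op_adjoint)
    (auto simp: fminus_finsert_id finsert_fminus_id sgn_before_finsert sgn_before_fminus split: if_splits)

lemma fcre_adjoint: "fip (fcre x f) g = fip f (fann x g)"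
  by (metis fann_adjoint fip_cnj)

lemma bann_adjoint: "fip (bann x f) g = fip f (bcre x g)"
  unfolding bann_def bcre_def
  by (rule shift_op_adjoint)
    (auto simp: count_greater_zero_iff[symmetric] simp del: count_greater_zero_iff)

lemma bcre_adjoint: "fip (bcre x f) g = fip f (bann x g)"
  by (metis bann_adjoint fip_cnj)

section \<open>Canonical commutation and anticommutation relations of the oscillators\<close>

lemmas lookup_ops = lookup_fann lookup_fcre lookup_bann lookup_bcre

lemma fock_eqI: "(\<And>m S. amp f (m, S) = amp g (m, S)) \<Longrightarrow> f = (g :: fock)"
  by (rule poly_mapping_eqI) auto

lemma ops_add:
  "fann x (f + g) = fann x f + fann x g" "fcre x (f + g) = fcre x f + fcre x g"
  "bann x (f + g) = bann x f + bann x g" "bcre x (f + g) = bcre x f + bcre x g"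
  by (auto intro!: fock_eqI simp: lookup_ops lookup_add algebra_simps)

lemma ops_fsc:
  "fann x (fsc c f) = fsc c (fann x f)" "fcre x (fsc c f) = fsc c (fcre x f)"
  "bann x (fsc c f) = fsc c (bann x f)" "bcre x (fsc c f) = fsc c (bcre x f)"
  by (auto intro!: fock_eqI simp: lookup_ops)

lemma fann_fcre: "fann x (fcre y f) + fcre y (fann x f) = (if x = y then f else 0)"
  by (auto intro!: fock_eqI simp: lookup_ops lookup_add fminus_finsert_id finsert_fminus_id
      sgn_before_finsert sgn_before_fminus mult.assoc[symmetric])
    (auto simp: finsert_absorb finsert_fminus_ne)

lemma fann_fann: "fann x (fann y f) + fann y (fann x f) = 0"
  by (rule fock_eqI) (auto simp: lookup_ops lookup_add sgn_before_finsert finsert_commute)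

lemma fminus_commute: "S |-| {|x|} |-| {|y|} = S |-| {|y|} |-| {|x|}" by auto

lemma fcre_fcre: "fcre x (fcre y f) + fcre y (fcre x f) = 0"
  by (rule fock_eqI) (auto simp: lookup_ops lookup_add sgn_before_fminus fminus_commute)

text \<open>On the diagonal this is (n + 1) - n = 1 for the occupation number n. The case n = 0 is
  separate because removing \<open>x\<close> from a multiset without \<open>x\<close> leaves it
  unchanged, and only the weight is 0 there.\<close>

lemma bann_bcre: "bann x (bcre y f) - bcre y (bann x f) = (if x = y then f else 0)"
proof (rule fock_eqI)
  fix m S
  show "amp (bann x (bcre y f) - bcre y (bann x f)) (m, S) = amp (if x = y then f else 0) (m, S)"
  proof (cases "x = y")
    case True
    have s: "of_real (sqrt (real (Suc n))) * (of_real (sqrt (real (Suc n))) * z)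
      = of_nat (Suc n) * (z :: complex)" for n z
      by (simp only: mult.assoc[symmetric] of_real_mult[symmetric] real_sqrt_mult_self) simp
    show ?thesis
    proof (cases "count m x")
      case 0
      then show ?thesis using True s[of 0] by (simp add: lookup_ops lookup_minus)
    next
      case (Suc n)
      then have "x \<in># m" by (metis count_eq_zero_iff nat.distinct(1))
      with Suc True s[of n] s[of "Suc n"] show ?thesis
        by (simp add: lookup_ops lookup_minus algebra_simps)
    qed
  next
    case False
    then show ?thesis
      by (cases "count m y = 0") (auto simp: lookup_ops lookup_minus)
  qed
qed

lemma bann_bann: "bann x (bann y f) = bann y (bann x f)"
  by (rule fock_eqI) (auto simp: lookup_ops add_mset_commute)

lemma bcre_bcre: "bcre x (bcre y f) = bcre y (bcre x f)"
  by (rule fock_eqI) (auto simp: lookup_ops add_mset_commute not_in_iff)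

lemma bose_fermi:
  "bann x (fann y f) = fann y (bann x f)" "bann x (fcre y f) = fcre y (bann x f)"
  "bcre x (fann y f) = fann y (bcre x f)" "bcre x (fcre y f) = fcre y (bcre x f)"
  by (auto intro!: fock_eqI simp: lookup_ops)

text \<open>Finitely many oscillators are excited in a vector of finite support. Infinite mode sums
  are finite on each vector for this reason.\<close>

lemma eventually_annihilated: "\<exists>K. \<forall>x\<ge>K. fann x f = 0 \<and> bann x f = 0"
proof -
  define A where "A = (\<Union>(m, S)\<in>supp f. set_mset m \<union> fset S)"
  have "finite A" unfolding A_def by (auto intro!: finite_UN_I)
  then obtain K where K: "\<forall>x\<in>A. x < K"
    using finite_nat_set_iff_bounded by blast
  have "fann x f = 0 \<and> bann x f = 0" if "x \<ge> K" for x
  proof -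
    have "x \<notin> A" using K that by auto
    then have "(m, finsert x S) \<notin> supp f" "(add_mset x m, S) \<notin> supp f" for m S
      unfolding A_def by force+
    then show ?thesis
      by (auto intro!: fock_eqI simp: lookup_ops in_keys_iff)
  qed
  then show ?thesis by blast
qed

definition fvac :: fock where
  "fvac = Poly_Mapping.single ({#}, {||}) 1"

lemma ann_fvac: "fann x fvac = 0" "bann x fvac = 0"
  by (auto intro!: fock_eqI simp: lookup_ops fvac_def lookup_single when_def)

lemma fip_fvac: "fip fvac fvac = 1"
  by (simp add: fip_def fvac_def)

section \<open>Free fields\<close>

interpretation fock: vector_space fsc
  by (rule vector_space_fsc)

lemma fip_add_left: "fip (f + g) h = fip f h + fip g h"
  by (metis fip_cnj fip_add_right complex_cnj_add)

lemma fip_scale_left: "fip (fsc c f) g = cnj c * fip f g"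
  by (metis fip_cnj fip_scale_right complex_cnj_mult)

lemma fip_zero [simp]: "fip f 0 = 0" "fip 0 f = 0"
  using fip_scale_right[of f 0 f] fip_scale_left[of 0 f f] by simp_all

lemma fip_sum_left: "fip (\<Sum>s\<in>A. f s) g = (\<Sum>s\<in>A. fip (f s) g)"
  by (induction A rule: infinite_finite_induct) (simp_all add: fip_add_left)

lemma fip_sum_right: "fip f (\<Sum>s\<in>A. g s) = (\<Sum>s\<in>A. fip f (g s))"
  by (induction A rule: infinite_finite_induct) (simp_all add: fip_add_right)

text \<open>Modes \<open>n\<close> and \<open>- n\<close> of a field share one oscillator, hence the
  absolute value. The pair \<open>c\<close> consists of the copy and the quaternion index.\<close>

definition mode_label :: "nat \<times> nat \<Rightarrow> int \<Rightarrow> nat" where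
  "mode_label c n = prod_encode (prod_encode c, nat \<bar>n\<bar>)"

lemma mode_label_eq_iff: "mode_label c m = mode_label d n \<longleftrightarrow> c = d \<and> \<bar>m\<bar>
  = \<bar>n\<bar>"
  by (auto simp: mode_label_def)

lemma mode_label_ge: "n \<le> int (mode_label c n)"
  using le_prod_encode_2[of "nat \<bar>n\<bar>" "prod_encode c"] by (simp add: mode_label_def)

text \<open>
  The fields are real: \<open>bos c n\<close> and \<open>fer c n\<close> are adjoint to \<open>bos c
    (-n)\<close> and \<open>fer c (-n)\<close>.
  The zero modes of two real fermions, of indices 2s and 2s+1, share one oscillator.
\<close>

definition bos_ann :: "int \<Rightarrow> complex" where
  "bos_ann n = (if n > 0 then of_real (sqrt (of_int n)) else 0)"

definition bos :: "nat \<times> nat \<Rightarrow> int \<Rightarrow> fock \<Rightarrow> fock" where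
  "bos c n f = fsc (bos_ann n) (bann (mode_label c n) f) + fsc (bos_ann (- n)) (bcre (mode_label c n) f)"

definition fer_mode_label :: "nat \<times> nat \<Rightarrow> int \<Rightarrow> nat" where
  "fer_mode_label c n = (if n = 0 then mode_label (fst c, 2 * (snd c div 2)) 0 else mode_label c n)"

definition fer_ann :: "nat \<times> nat \<Rightarrow> int \<Rightarrow> complex" where
  "fer_ann c n = (if n > 0 then 1 else if n < 0 then 0
     else if even (snd c) then of_real (1 / sqrt 2) else - \<i> * of_real (1 / sqrt 2))"

text \<open>With annihilator a and creator c of the shared oscillator, the zero mode is (a + c)/sqrt
  2 at an even index and i(c - a)/sqrt 2 at an odd one: two anticommuting operators of square
  1/2.\<close>

definition fer :: "nat \<times> nat \<Rightarrow> int \<Rightarrow> fock \<Rightarrow> fock" where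
  "fer c n f = fsc (fer_ann c n) (fann (fer_mode_label c n) f)
     + fsc (cnj (fer_ann c (- n))) (fcre (fer_mode_label c n) f)"

lemma fields_add:
  "bos c n (f + g) = bos c n f + bos c n g" "fer c n (f + g) = fer c n f + fer c n g"
  by (simp_all add: bos_def fer_def ops_add fock.scale_right_distrib algebra_simps)

lemma fields_fsc:
  "bos c n (fsc t f) = fsc t (bos c n f)" "fer c n (fsc t f) = fsc t (fer c n f)"
  by (simp_all add: bos_def fer_def ops_fsc fock.scale_right_distrib mult.commute)

lemma fields_zero [simp]: "bos c n 0 = 0" "fer c n 0 = 0"
  using fields_fsc[of c n 0 0] by simp_all

lemma fields_sum:
  "bos c n (\<Sum>s\<in>A. f s) = (\<Sum>s\<in>A. bos c n (f s))"
  "fer c n (\<Sum>s\<in>A. f s) = (\<Sum>s\<in>A. fer c n (f s))"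
  by (induction A rule: infinite_finite_induct, simp_all add: fields_add)

lemma fields_minus:
  "bos c n (- f) = - bos c n f" "fer c n (- f) = - fer c n f"
  using fields_add[of c n f "- f"] by (simp_all add: eq_neg_iff_add_eq_0 add.commute)

lemma fields_diff:
  "bos c n (f - g) = bos c n f - bos c n g" "fer c n (f - g) = fer c n f - fer c n g"
  using fields_add[of c n f "- g"] by (simp_all add: fields_minus)

lemma bos_bos:
  "bos c m (bos d n f) - bos d n (bos c m f) = (if c = d \<and> m + n = 0 then fsc (of_int m) f else 0)"
proof -
  let ?x = "mode_label c m" and ?y = "mode_label d n"
  let ?a = "bos_ann m" and ?b = "bos_ann (- m)" and ?a' = "bos_ann n" and ?b' = "bos_ann (- n)"
  have "bos c m (bos d n f) - bos d n (bos c m f)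
    = fsc (?a * ?a') (bann ?x (bann ?y f) - bann ?y (bann ?x f))
    + fsc (?a * ?b') (bann ?x (bcre ?y f) - bcre ?y (bann ?x f))
    - fsc (?b * ?a') (bann ?y (bcre ?x f) - bcre ?x (bann ?y f))
    + fsc (?b * ?b') (bcre ?x (bcre ?y f) - bcre ?y (bcre ?x f))"
    by (simp add: bos_def ops_add ops_fsc fock.scale_right_distrib fock.scale_right_diff_distrib algebra_simps)
  also have "\<dots> = fsc (if ?x = ?y then ?a * ?b' - ?b * ?a' else 0) f"
    by (simp add: bann_bcre bann_bann[of ?x ?y] bcre_bcre[of ?x ?y] fock.scale_left_diff_distrib)
  also have "\<dots> = (if c = d \<and> m + n = 0 then fsc (of_int m) f else 0)"
  proof -
    have "of_real (sqrt (of_int j)) * of_real (sqrt (of_int j)) = (of_int j :: complex)" if "j \<ge> 0" for j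
      using that by (simp flip: of_real_mult)
    from this[of m] this[of "- m"] show ?thesis
      by (auto simp: mode_label_eq_iff bos_ann_def)
  qed
  finally show ?thesis .
qed

lemma fer_ann_norm: "fer_ann c 0 * cnj (fer_ann c 0) = 1/2"
  by (simp add: fer_ann_def power2_eq_square field_simps flip: of_real_mult)

lemma fer_fer:
  "fer c m (fer d n f) + fer d n (fer c m f) = (if c = d \<and> m + n = 0 then f else 0)"
proof -
  let ?x = "fer_mode_label c m" and ?y = "fer_mode_label d n"
  let ?a = "fer_ann c m" and ?b = "cnj (fer_ann c (- m))"
  let ?a' = "fer_ann d n" and ?b' = "cnj (fer_ann d (- n))"
  have "fer c m (fer d n f) + fer d n (fer c m f)
    = fsc (?a * ?a') (fann ?x (fann ?y f) + fann ?y (fann ?x f))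
    + fsc (?a * ?b') (fann ?x (fcre ?y f) + fcre ?y (fann ?x f))
    + fsc (?b * ?a') (fann ?y (fcre ?x f) + fcre ?x (fann ?y f))
    + fsc (?b * ?b') (fcre ?x (fcre ?y f) + fcre ?y (fcre ?x f))"
    by (simp add: fer_def ops_add ops_fsc fock.scale_right_distrib algebra_simps)
  also have "\<dots> = fsc (if ?x = ?y then ?a * ?b' + ?b * ?a' else 0) f"
    by (simp add: fann_fcre fann_fann[of ?x ?y] fcre_fcre[of ?x ?y] fock.scale_left_distrib)
  also have "(if ?x = ?y then ?a * ?b' + ?b * ?a' else 0) = (if c = d \<and> m + n = 0 then 1 else 0)"
  proof (cases "m = 0 \<and> n = 0")
    case True
    show ?thesis
    proof (cases "c = d")
      case True
      then show ?thesis using \<open>m = 0 \<and> n = 0\<close> fer_ann_norm[of c] by (simp add: mult.commute)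
    next
      case False
      \<comment> \<open>Distinct fermions on one oscillator have indices of opposite parity; their
        mixed terms are i/2 and -i/2 and cancel.\<close>
      have "snd c = snd d" if "snd c div 2 = snd d div 2" "even (snd c) = even (snd d)"
        using that by (metis dvd_mult_div_cancel odd_two_times_div_two_succ)
      then show ?thesis using False \<open>m = 0 \<and> n = 0\<close>
        by (auto simp: fer_mode_label_def mode_label_eq_iff fer_ann_def prod_eq_iff)
    qed
  next
    case False
    then show ?thesis by (auto simp: fer_mode_label_def mode_label_eq_iff fer_ann_def)
  qed
  finally show ?thesis by simp
qed

lemma bos_fer: "bos c m (fer d n f) = fer d n (bos c m f)"
  by (simp add: bos_def fer_def ops_add ops_fsc bose_fermi fock.scale_right_distrib algebra_simps)

lemma bos_adjoint: "fip (bos c n f) g = fip f (bos c (- n) g)"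
proof -
  have "cnj (bos_ann n) = bos_ann n" for n by (simp add: bos_ann_def)
  then show ?thesis
    by (simp add: bos_def fip_add_left fip_add_right fip_scale_left fip_scale_right bann_adjoint
        bcre_adjoint mode_label_def)
qed

lemma fer_adjoint: "fip (fer c n f) g = fip f (fer c (- n) g)"
  by (simp add: fer_def fip_add_left fip_add_right fip_scale_left fip_scale_right fann_adjoint
        fcre_adjoint mode_label_def fer_mode_label_def)

lemma bos_fvac: "n \<ge> 0 \<Longrightarrow> bos c n fvac = 0"
  by (simp add: bos_def ann_fvac bos_ann_def)

lemma fer_fvac: "n > 0 \<Longrightarrow> fer c n fvac = 0"
  by (simp add: fer_def ann_fvac fer_ann_def)

text \<open>This fixes the complex structure on the four zero modes of a copy; it is the one for
  which the vacuum is a singlet in \<open>zero_mode_bilinear\<close>.\<close>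

lemma fer_zero_fvac: "even j \<Longrightarrow> fer (s, Suc j) 0 fvac = fsc \<i> (fer (s, j) 0 fvac)"
  by (simp add: fer_def ann_fvac fer_ann_def fer_mode_label_def)

definition killed_above :: "int \<Rightarrow> fock \<Rightarrow> bool" where
  "killed_above K f \<longleftrightarrow> (\<forall>n>K. \<forall>c. bos c n f = 0 \<and> fer c n f = 0)"

lemma ex_killed_above: "\<exists>K\<ge>0. killed_above K f"
proof -
  obtain K where K: "\<forall>x\<ge>K. fann x f = 0 \<and> bann x f = 0"
    using eventually_annihilated by blast
  have "killed_above (int K) f"
    unfolding killed_above_def
  proof (intro allI impI)
    fix n c assume n: "int K < n"
    then have "K \<le> mode_label c n" "0 < n" using mode_label_ge[of n c] by linarith+
    with K show "bos c n f = 0 \<and> fer c n f = 0"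
      by (simp add: bos_def fer_def bos_ann_def fer_ann_def fer_mode_label_def)
  qed
  moreover have "0 \<le> int K" by simp
  ultimately show ?thesis by blast
qed

lemma killed_above_mono: "killed_above K f \<Longrightarrow> K \<le> K' \<Longrightarrow> killed_above K' f"
  by (auto simp: killed_above_def)

section \<open>Four supercharges built from N quadruples of free fields\<close>

text \<open>
  \<open>qperm i\<close> and \<open>qsign i\<close> encode the i-th quaternion unit acting on R^4 as a
    signed permutation
  matrix; the index i is added in (Z/2)^2.
\<close>

definition qadd :: "nat \<Rightarrow> nat \<Rightarrow> nat" where
  "qadd i j = [[0,1,2,3],[1,0,3,2],[2,3,0,1],[3,2,1,0]] ! i ! j"

definition qperm :: "nat \<Rightarrow> nat \<times> nat \<Rightarrow> nat \<times> nat" where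
  "qperm i c = (fst c, qadd i (snd c))"

definition qsgn :: "nat \<Rightarrow> nat \<Rightarrow> int" where
  "qsgn i j = [[1,1,1,1],[1,-1,-1,1],[1,1,-1,-1],[1,-1,1,-1]] ! i ! j"

definition qsign :: "nat \<Rightarrow> nat \<times> nat \<Rightarrow> complex" where
  "qsign i c = of_int (qsgn i (snd c))"

text \<open>For i and j distinct, \<open>qtriple i j l\<close> is the coefficient of the unit \<open>qadd
  (qadd i j) l\<close> in the
  product of the unit j, the conjugate of the unit i and the unit l.\<close>

definition qtriple :: "nat \<Rightarrow> nat \<Rightarrow> nat \<Rightarrow> int" where
  "qtriple i j l = (if l = j then -1 else if l = i then 1
     else if (i, j, l) \<in> {(0,1,2), (1,2,0), (2,0,1), (0,2,3), (2,3,0), (3,0,2),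
       (0,3,1), (3,1,0), (1,0,3), (1,3,2), (3,2,1), (2,1,3)} then 1 else -1)"

lemma ball_4: "(\<forall>i<4. P i) \<longleftrightarrow> list_all P [0, 1, 2, 3 :: nat]"
  by (auto simp: numeral_eq_Suc less_Suc_eq)

lemma quaternion_perm:
  "\<forall>i<4. \<forall>j<4. qadd i j < 4 \<and> qadd i (qadd i j) = j"
  "\<forall>i<4. \<forall>j<4. \<forall>l<4. qadd i (qadd j l) = qadd j (qadd i l) \<and> (qadd i l
    = qadd j l \<longleftrightarrow> i = j)"
  "\<forall>i<4. \<forall>j<4. \<forall>l<4. \<forall>c<4. qadd l (qadd i (qadd j c)) = qadd (qadd (qadd i j) l) c"
  unfolding ball_4 by code_simp+

text \<open>Let M_i have the entry \<open>qsgn i c\<close> in row c and column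
  \<open>qadd i c\<close>. The identities say that M_i is orthogonal, that M_j M_i^T and M_j^T M_i
  are antisymmetric in i and j (Clifford relations on the fermionic and on the bosonic side), and
  that M_j M_i^T M_l is \<open>qtriple i j l\<close> times the matrix of index
  \<open>qadd (qadd i j) l\<close>.\<close>

lemma quaternion_sign:
  "\<forall>i<4. \<forall>j<4. qsgn i j * qsgn i j = 1"
  "\<forall>i<4. \<forall>j<4. \<forall>c<4. i \<noteq> j \<longrightarrow>
     qsgn j c * qsgn i (qadd i (qadd j c)) = - (qsgn i c * qsgn j (qadd i (qadd j c)))
   \<and> qsgn j (qadd j c) * qsgn i (qadd j c) = - (qsgn j (qadd i c) * qsgn i (qadd i c))"
  "\<forall>i<4. \<forall>j<4. \<forall>l<4. \<forall>c<4. i \<noteq> j \<longrightarrow>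
     qsgn l (qadd i (qadd j c)) * (qsgn i (qadd i (qadd j c)) * qsgn j c)
       = qtriple i j l * qsgn (qadd (qadd i j) l) c"
  unfolding ball_4 by code_simp+

locale supercharges =
  fixes N :: nat
begin

definition idx :: "(nat \<times> nat) set" where
  "idx = {..<N} \<times> {..<4}"

lemma finite_idx [simp]: "finite idx" by (simp add: idx_def)

lemma qperm_idx: "i < 4 \<Longrightarrow> c \<in> idx \<Longrightarrow> qperm i c \<in> idx"
  using quaternion_perm(1) by (auto simp: idx_def qperm_def)

lemma qperm_qperm: "i < 4 \<Longrightarrow> c \<in> idx \<Longrightarrow> qperm i (qperm i c) = c"
  using quaternion_perm(1) by (auto simp: idx_def qperm_def)

lemma qperm_commute: "i < 4 \<Longrightarrow> j < 4 \<Longrightarrow> c \<in> idx \<Longrightarrow> qperm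
  i (qperm j c) = qperm j (qperm i c)"
  using quaternion_perm(2) by (auto simp: idx_def qperm_def)

lemma qperm_inj: "i < 4 \<Longrightarrow> j < 4 \<Longrightarrow> c \<in> idx \<Longrightarrow> qperm i c
  = qperm j c \<longleftrightarrow> i = j"
  using quaternion_perm(2) by (auto simp: idx_def qperm_def)

lemma qsign_square: "i < 4 \<Longrightarrow> c \<in> idx \<Longrightarrow> qsign i c * qsign i c = 1"
  using quaternion_sign(1) by (auto simp: idx_def qsign_def simp flip: of_int_mult)

lemma cnj_qsign: "cnj (qsign i c) = qsign i c"
  by (simp add: qsign_def)

lemma qsign_anti:
  "i < 4 \<Longrightarrow> j < 4 \<Longrightarrow> i \<noteq> j \<Longrightarrow> c \<in> idx \<Longrightarrow>
    qsign j c * qsign i (qperm i (qperm j c)) = - (qsign i c * qsign j (qperm i (qperm j c)))"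
  using quaternion_sign(2)
  by (auto simp: idx_def qsign_def qperm_def simp flip: of_int_mult of_int_minus)

lemma qsign_anti':
  "i < 4 \<Longrightarrow> j < 4 \<Longrightarrow> i \<noteq> j \<Longrightarrow> c \<in> idx \<Longrightarrow>
    qsign j (qperm j c) * qsign i (qperm j c) = - (qsign j (qperm i c) * qsign i (qperm i c))"
  using quaternion_sign(2)
  by (auto simp: idx_def qsign_def qperm_def simp flip: of_int_mult of_int_minus)

lemma qsign_triple:
  "i < 4 \<Longrightarrow> j < 4 \<Longrightarrow> l < 4 \<Longrightarrow> i \<noteq> j \<Longrightarrow>
    c \<in> idx \<Longrightarrow>
    qsign l (qperm i (qperm j c)) * (qsign i (qperm i (qperm j c)) * qsign j c)
      = of_int (qtriple i j l) * qsign (qadd (qadd i j) l) c"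
  using quaternion_sign(3)
  by (auto simp: idx_def qsign_def qperm_def simp flip: of_int_mult)

lemma qperm_triple:
  "i < 4 \<Longrightarrow> j < 4 \<Longrightarrow> l < 4 \<Longrightarrow> c \<in> idx \<Longrightarrow>
    qperm l (qperm i (qperm j c)) = qperm (qadd (qadd i j) l) c"
  using quaternion_perm(3) by (auto simp: idx_def qperm_def)

section \<open>The supercharges and their brackets with the free fields\<close>

definition mode_sum :: "nat \<Rightarrow> int \<Rightarrow> int \<Rightarrow> fock \<Rightarrow> fock" where
  "mode_sum i n m f = (\<Sum>c\<in>idx. fsc (qsign i c) (fer c (n - m) (bos (qperm i c) m f)))"

text \<open>By \<open>mode_sum_outside\<close> only finitely many terms are nonzero on a given
  vector, so this is the full mode sum. Boson and fermion factors commute, so no normal ordering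
  enters.\<close>

definition charge :: "nat \<Rightarrow> int \<Rightarrow> fock \<Rightarrow> fock" where
  "charge i n f = (\<Sum>m | mode_sum i n m f \<noteq> 0. mode_sum i n m f)"

lemma mode_sum_outside:
  assumes "killed_above K f" "m \<notin> {n - K..K}" shows "mode_sum i n m f = 0"
proof -
  have "fer c (n - m) (bos (qperm i c) m f) = 0" for c
  proof (cases "m > K")
    case True
    then have "bos (qperm i c) m f = 0" using assms(1) unfolding killed_above_def by blast
    then show ?thesis by simp
  next
    case False
    then have "n - m > K" using assms(2) by auto
    then have "fer c (n - m) f = 0" using assms(1) unfolding killed_above_def by blast
    then show ?thesis by (simp flip: bos_fer)
  qed
  then show ?thesis by (simp add: mode_sum_def)
qed

lemma charge_eq:
  assumes "killed_above K f" "finite A" "{n - K..K} \<subseteq> A"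
  shows "charge i n f = (\<Sum>m\<in>A. mode_sum i n m f)"
  unfolding charge_def
proof (rule sum.mono_neutral_left)
  show "finite A" by fact
  show "{m. mode_sum i n m f \<noteq> 0} \<subseteq> A"
    using mode_sum_outside[OF assms(1)] assms(3) by blast
qed auto

lemma mode_sum_add: "mode_sum i n m (f + g) = mode_sum i n m f + mode_sum i n m g"
  by (simp add: mode_sum_def fields_add fock.scale_right_distrib sum.distrib)

lemma mode_sum_fsc: "mode_sum i n m (fsc t f) = fsc t (mode_sum i n m f)"
  by (simp add: mode_sum_def fields_fsc fock.scale_sum_right mult.commute)

lemma common_bound:
  obtains K where "K \<ge> 0" "\<And>f. f \<in> set fs \<Longrightarrow> killed_above K f"
proof -
  have "\<exists>K\<ge>0. \<forall>f\<in>set fs. killed_above K f"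
  proof (induction fs)
    case Nil then show ?case by auto
  next
    case (Cons f fs)
    then obtain K where "K \<ge> 0" "\<forall>f\<in>set fs. killed_above K f" by blast
    moreover obtain K' where "K' \<ge> 0" "killed_above K' f" using ex_killed_above by blast
    ultimately have "max K K' \<ge> 0" "\<forall>f\<in>set (f # fs). killed_above (max K K') f"
      by (auto intro: killed_above_mono)
    then show ?case by blast
  qed
  with that show thesis by blast
qed

lemma charge_add: "charge i n (f + g) = charge i n f + charge i n g"
proof -
  obtain K where "K \<ge> 0" "\<And>h. h \<in> set [f, g, f + g] \<Longrightarrow> killed_above K h"
    by (rule common_bound[of "[f, g, f + g]"]) blast
  then show ?thesis
    using charge_eq[of K f "{n - K..K}" n i] charge_eq[of K g "{n - K..K}" n i]
      charge_eq[of K "f + g" "{n - K..K}" n i]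
    by (simp add: mode_sum_add sum.distrib)
qed

lemma charge_fsc: "charge i n (fsc t f) = fsc t (charge i n f)"
proof -
  obtain K where "K \<ge> 0" "\<And>h. h \<in> set [f, fsc t f] \<Longrightarrow> killed_above K h"
    by (rule common_bound[of "[f, fsc t f]"]) blast
  then show ?thesis
    using charge_eq[of K f "{n - K..K}" n i] charge_eq[of K "fsc t f" "{n - K..K}" n i]
    by (simp add: mode_sum_fsc fock.scale_sum_right)
qed

lemma charge_zero [simp]: "charge i n 0 = 0"
  using charge_fsc[of i n 0 0] by simp

lemma charge_minus: "charge i n (- f) = - charge i n f"
  using charge_add[of i n f "- f"] by (simp add: eq_neg_iff_add_eq_0 add.commute)

lemma charge_sum: "charge i n (\<Sum>s\<in>A. f s) = (\<Sum>s\<in>A. charge i n (f s))"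
  by (induction A rule: infinite_finite_induct) (simp_all add: charge_add)

lemma charge_fer:
  assumes "i < 4" "c \<in> idx"
  shows "charge i p (fer c n f) + fer c n (charge i p f) = fsc (qsign i c) (bos (qperm i c) (p + n) f)"
proof -
  obtain K where K: "K \<ge> 0" "\<And>h. h \<in> set [f, fer c n f] \<Longrightarrow> killed_above K h"
    by (rule common_bound[of "[f, fer c n f]"]) blast
  \<comment> \<open>The single index that contributes to the bracket may lie outside the window of
    the charge, so it is added to the range.\<close>
  let ?A = "insert (p + n) {p - K..K}"
  have *: "mode_sum i p m (fer c n f) + fer c n (mode_sum i p m f)
    = (if m = p + n then fsc (qsign i c) (bos (qperm i c) (p + n) f) else 0)" for m
  proof -
    have "mode_sum i p m (fer c n f) + fer c n (mode_sum i p m f)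
      = (\<Sum>d\<in>idx. fsc (qsign i d) (fer d (p - m) (fer c n (bos (qperm i d) m f))
            + fer c n (fer d (p - m) (bos (qperm i d) m f))))"
      by (simp add: mode_sum_def fields_sum fields_fsc bos_fer fock.scale_right_distrib sum.distrib)
    also have "\<dots> = (\<Sum>d\<in>idx. if d = c then
        (if m = p + n then fsc (qsign i c) (bos (qperm i c) m f) else 0) else 0)"
      by (intro sum.cong refl) (auto simp: fer_fer)
    also have "\<dots> = (if m = p + n then fsc (qsign i c) (bos (qperm i c) (p + n) f) else 0)"
      using assms(2) by simp
    finally show ?thesis .
  qed
  have "charge i p (fer c n f) + fer c n (charge i p f)
    = (\<Sum>m\<in>?A. mode_sum i p m (fer c n f) + fer c n (mode_sum i p m f))"
    using K charge_eq[of K f ?A p i] charge_eq[of K "fer c n f" ?A p i]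
    by (simp add: fields_sum sum.distrib subset_insertI del: sum.insert_if sum.insert)
  also have "\<dots> = fsc (qsign i c) (bos (qperm i c) (p + n) f)"
    unfolding * by (subst sum.delta) auto
  finally show ?thesis .
qed

lemma charge_bos:
  assumes "i < 4" "d \<in> idx"
  shows "charge i p (bos d n f) - bos d n (charge i p f)
    = fsc (- of_int n * qsign i (qperm i d)) (fer (qperm i d) (p + n) f)" (is "_ = ?rhs")
proof -
  obtain K where K: "K \<ge> 0" "\<And>h. h \<in> set [f, bos d n f] \<Longrightarrow> killed_above K h"
    by (rule common_bound[of "[f, bos d n f]"]) blast
  let ?A = "insert (- n) {p - K..K}"
  have *: "mode_sum i p m (bos d n f) - bos d n (mode_sum i p m f)
    = (if m = - n then ?rhs else 0)" for m
  proof -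
    have "mode_sum i p m (bos d n f) - bos d n (mode_sum i p m f)
      = (\<Sum>c\<in>idx. fsc (qsign i c) (fer c (p - m) (bos (qperm i c) m (bos d n f)
            - bos d n (bos (qperm i c) m f))))"
      by (simp add: mode_sum_def fields_sum fields_fsc bos_fer fock.scale_right_diff_distrib
          sum_subtractf fields_diff)
    also have "\<dots> = (\<Sum>c\<in>idx. if c = qperm i d then
        (if m = - n then ?rhs else 0) else 0)"
    proof (intro sum.cong refl)
      fix c assume c: "c \<in> idx"
      have "qperm i c = d \<longleftrightarrow> c = qperm i d" using qperm_qperm assms c by metis
      moreover have "m + n = 0 \<longleftrightarrow> m = - n" by auto
      ultimately show "fsc (qsign i c) (fer c (p - m) (bos (qperm i c) m (bos d n f)
            - bos d n (bos (qperm i c) m f))) = (if c = qperm i d then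
        (if m = - n then ?rhs else 0) else 0)"
        by (auto simp: bos_bos fields_fsc fields_minus mult.commute)
    qed
    also have "\<dots> = (if m = - n then ?rhs else 0)"
      using qperm_idx[OF assms] by simp
    finally show ?thesis .
  qed
  have "charge i p (bos d n f) - bos d n (charge i p f)
    = (\<Sum>m\<in>?A. mode_sum i p m (bos d n f) - bos d n (mode_sum i p m f))"
    using K charge_eq[of K f ?A p i] charge_eq[of K "bos d n f" ?A p i]
    by (simp add: fields_sum sum_subtractf subset_insertI del: sum.insert_if sum.insert)
  also have "\<dots> = ?rhs"
    unfolding * by (subst sum.delta) auto
  finally show ?thesis .
qed

section \<open>Anticommutators of supercharges as derivations of the free fields\<close>

definition anti :: "nat \<Rightarrow> int \<Rightarrow> nat \<Rightarrow> int \<Rightarrow> fock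
  \<Rightarrow> fock" where
  "anti i p j q f = charge i p (charge j q f) + charge j q (charge i p f)"

lemma anti_fsc: "anti i p j q (fsc t f) = fsc t (anti i p j q f)"
  by (simp add: anti_def charge_fsc fock.scale_right_distrib)

lemma anti_sum: "anti i p j q (\<Sum>s\<in>A. f s) = (\<Sum>s\<in>A. anti i p j q (f s))"
  by (simp add: anti_def charge_sum sum.distrib)

text \<open>For i = j this is the commutator of twice a Virasoro mode of index p + q with a field of
  weight 1/2. For distinct i and j it is a rotation of the fermion index scaled by p - q, like the
  J-term in the anticommutator of two modes of G.\<close>

lemma anti_fer:
  assumes "i < 4" "j < 4" "c \<in> idx"
  shows "anti i p j q (fer c n f) = fer c n (anti i p j q f) +
    (if i = j then fsc (- of_int (p + q + 2 * n)) (fer c (p + q + n) f)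
     else fsc (- of_int (p - q) * (qsign i c * qsign j (qperm i (qperm j c))))
       (fer (qperm i (qperm j c)) (p + q + n) f))"
proof -
  note fer1 = charge_fer[THEN eq_diff_eq[THEN iffD2]]
  note bos1 = charge_bos[THEN diff_eq_eq[THEN iffD1]]
  have half: "charge i p (charge j q (fer c n f)) = - charge i p (fer c n (charge j q f))
     + fsc (qsign j c) (bos (qperm j c) (q + n) (charge i p f))
     + fsc (- of_int (q + n) * (qsign j c * qsign i (qperm i (qperm j c))))
       (fer (qperm i (qperm j c)) (p + q + n) f)"
    if "i < 4" "j < 4" for i j p q
  proof -
    have "charge i p (charge j q (fer c n f))
      = charge i p (fsc (qsign j c) (bos (qperm j c) (q + n) f) + - fer c n (charge j q f))"
      using fer1[OF that(2) assms(3), of q n f] by simp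
    also have "\<dots> = fsc (qsign j c) (charge i p (bos (qperm j c) (q + n) f))
      - charge i p (fer c n (charge j q f))"
      unfolding charge_add charge_fsc charge_minus by simp
    also have "charge i p (bos (qperm j c) (q + n) f) = fsc (- of_int (q + n) * qsign i (qperm i (qperm j c)))
        (fer (qperm i (qperm j c)) (p + (q + n)) f) + bos (qperm j c) (q + n) (charge i p f)"
      by (rule bos1) (use that assms qperm_idx in auto)
    finally show ?thesis
      by (simp add: fock.scale_right_distrib algebra_simps)
  qed
  have "anti i p j q (fer c n f) = fer c n (anti i p j q f)
     + fsc (- of_int (q + n) * (qsign j c * qsign i (qperm i (qperm j c))))
       (fer (qperm i (qperm j c)) (p + q + n) f)
     + fsc (- of_int (p + n) * (qsign i c * qsign j (qperm j (qperm i c))))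
       (fer (qperm j (qperm i c)) (p + q + n) f)"
    unfolding anti_def half[OF assms(1,2)] half[OF assms(2,1)]
      fer1[OF assms(2,3), of q n "charge i p f"] fer1[OF assms(1,3), of p n "charge j q f"]
    by (simp add: fields_add algebra_simps)
  also have "\<dots> = fer c n (anti i p j q f) +
    (if i = j then fsc (- of_int (p + q + 2 * n)) (fer c (p + q + n) f)
     else fsc (- of_int (p - q) * (qsign i c * qsign j (qperm i (qperm j c))))
       (fer (qperm i (qperm j c)) (p + q + n) f))"
  proof (cases "i = j")
    case True
    then show ?thesis using assms
      by (simp add: qperm_qperm qsign_square add.assoc flip: fock.scale_left_distrib)
  next
    case False
    have "- of_int (q + n) * (qsign j c * qsign i (qperm i (qperm j c)))
        + - of_int (p + n) * (qsign i c * qsign j (qperm i (qperm j c)))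
        = - of_int (p - q) * (qsign i c * qsign j (qperm i (qperm j c)))"
      using qsign_anti[OF assms(1,2) False assms(3)] by (simp add: algebra_simps)
    then show ?thesis using False qperm_commute[OF assms(2,1,3)]
      by (simp only: add.assoc if_False flip: fock.scale_left_distrib)
  qed
  finally show ?thesis .
qed

text \<open>For i = j this is twice a Virasoro mode acting on a current of weight 1. For distinct i
  and j the two orders cancel: the sl(2) currents consist of fermions only.\<close>

lemma anti_bos:
  assumes "i < 4" "j < 4" "d \<in> idx"
  shows "anti i p j q (bos d n f) = bos d n (anti i p j q f) +
    (if i = j then fsc (- 2 * of_int n) (bos d (p + q + n) f) else 0)"
proof -
  note fer1 = charge_fer[THEN eq_diff_eq[THEN iffD2]]
  note bos1 = charge_bos[THEN diff_eq_eq[THEN iffD1]]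
  have half: "charge i p (charge j q (bos d n f)) = charge i p (bos d n (charge j q f))
     - fsc (- of_int n * qsign j (qperm j d)) (fer (qperm j d) (q + n) (charge i p f))
     + fsc (- of_int n * (qsign j (qperm j d) * qsign i (qperm j d))) (bos (qperm i (qperm j d)) (p + q + n) f)"
    if "i < 4" "j < 4" for i j p q
  proof -
    have "charge i p (charge j q (bos d n f))
      = charge i p (fsc (- of_int n * qsign j (qperm j d)) (fer (qperm j d) (q + n) f) + bos d n (charge j q f))"
      using bos1[OF that(2) assms(3), of q n f] by simp
    also have "\<dots> = fsc (- of_int n * qsign j (qperm j d)) (charge i p (fer (qperm j d) (q + n) f)) +
      charge i p (bos d n (charge j q f))"
      unfolding charge_add charge_fsc by simp
    also have "charge i p (fer (qperm j d) (q + n) f)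
       = fsc (qsign i (qperm j d)) (bos (qperm i (qperm j d)) (p + (q + n)) f)
         - fer (qperm j d) (q + n) (charge i p f)"
      by (rule fer1) (use that assms qperm_idx in auto)
    finally show ?thesis
      by (simp add: fock.scale_right_diff_distrib algebra_simps)
  qed
  have "anti i p j q (bos d n f) = bos d n (anti i p j q f)
     + (fsc (- of_int n * (qsign j (qperm j d) * qsign i (qperm j d))) (bos (qperm i (qperm j d)) (p + q + n) f)
     + fsc (- of_int n * (qsign i (qperm i d) * qsign j (qperm i d))) (bos (qperm j (qperm i d)) (p + q + n) f))"
    unfolding anti_def half[OF assms(1,2)] half[OF assms(2,1)]
      bos1[OF assms(2,3), of q n "charge i p f"] bos1[OF assms(1,3), of p n "charge j q f"]
    by (simp add: fields_add algebra_simps)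
  also have "\<dots> = bos d n (anti i p j q f) +
    (if i = j then fsc (- 2 * of_int n) (bos d (p + q + n) f) else 0)"
  proof (cases "i = j")
    case True
    then have "- of_int n * (qsign j (qperm j d) * qsign i (qperm j d))
        + - of_int n * (qsign i (qperm i d) * qsign j (qperm i d)) = - 2 * of_int n"
      using assms by (simp add: qperm_idx qsign_square)
    then show ?thesis using True assms
      by (simp only: simp_thms if_True qperm_qperm flip: fock.scale_left_distrib)
  next
    case False
    have "- of_int n * (qsign j (qperm j d) * qsign i (qperm j d))
        + - of_int n * (qsign i (qperm i d) * qsign j (qperm i d)) = 0"
      using qsign_anti'[OF assms(1,2) False assms(3)] by (simp add: algebra_simps)
    then show ?thesis using False qperm_commute[OF assms(2,1,3)]
      by (simp only: if_False flip: fock.scale_left_distrib) simp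
  qed
  finally show ?thesis .
qed

lemma charge_adjoint:
  assumes "i < 4"
  shows "fip (charge i n f) g = fip f (charge i (- n) g)"
proof -
  obtain K where K: "K \<ge> 0" "\<And>h. h \<in> set [f, g] \<Longrightarrow> killed_above K h"
    by (rule common_bound[of "[f, g]"]) blast
  let ?A = "{- K - \<bar>n\<bar>..K + \<bar>n\<bar>}"
  have "fip (charge i n f) g = (\<Sum>m\<in>?A. fip (mode_sum i n m f) g)"
    by (subst charge_eq[of K f ?A]) (use K in \<open>auto simp: fip_sum_left\<close>)
  also have "\<dots> = (\<Sum>m\<in>?A. fip f (mode_sum i (- n) (- m) g))"
    by (simp add: mode_sum_def fip_sum_left fip_sum_right fip_scale_left fip_scale_right
        fer_adjoint bos_adjoint bos_fer cnj_qsign add.commute)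
  also have "\<dots> = (\<Sum>m\<in>?A. fip f (mode_sum i (- n) m g))"
    by (rule sum.reindex_bij_witness[of _ uminus uminus]) auto
  also have "\<dots> = fip f (charge i (- n) g)"
    by (subst charge_eq[of K g ?A]) (use K in \<open>auto simp: fip_sum_right\<close>)
  finally show ?thesis .
qed

text \<open>Substituting \<open>m - s\<close> for \<open>m\<close> moves the shift of the boson mode
  into the weight. The range and its translate by \<open>s\<close> both contain the window
  \<open>{n - K..K}\<close>, so the terms gained or lost at the ends vanish.\<close>

lemma weighted_shift:
  assumes "killed_above K f"
  shows "(\<Sum>m = n - s - K - \<bar>s\<bar>..K + \<bar>s\<bar>. \<Sum>c\<in>idx. fsc (w m * qsign i c)
    (fer c (n - s - m) (bos (qperm i c) (m + s) f)))
    = (\<Sum>m = n - s - K - \<bar>s\<bar>..K + \<bar>s\<bar>. fsc (w (m - s)) (mode_sum i n m f))"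
proof -
  let ?A = "{n - s - K - \<bar>s\<bar>..K + \<bar>s\<bar>}"
  have "(\<Sum>m\<in>?A. \<Sum>c\<in>idx. fsc (w m * qsign i c) (fer c (n - s - m) (bos (qperm i c) (m + s) f)))
     = (\<Sum>m\<in>?A. fsc (w (m + s - s)) (mode_sum i n (m + s) f))"
    by (simp add: mode_sum_def fock.scale_sum_right algebra_simps)
  also have "\<dots> = (\<Sum>m\<in>(\<lambda>m. m + s) ` ?A. fsc (w (m - s)) (mode_sum i n m f))"
    by (subst sum.reindex) (auto simp: inj_on_def)
  also have "\<dots> = (\<Sum>m\<in>?A. fsc (w (m - s)) (mode_sum i n m f))"
  proof (rule sum.mono_neutral_cong)
    fix m assume "m \<in> ?A - (\<lambda>m. m + s) ` ?A"
    then have "m - s \<notin> ?A" by force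
    then have "m \<notin> {n - K..K}" by auto
    then show "fsc (w (m - s)) (mode_sum i n m f) = 0"
      using mode_sum_outside[OF assms] by simp
  next
    fix m assume "m \<in> (\<lambda>m. m + s) ` ?A - ?A"
    then have "m \<notin> {n - K..K}" by auto
    then show "fsc (w (m - s)) (mode_sum i n m f) = 0"
      using mode_sum_outside[OF assms] by simp
  qed auto
  finally show ?thesis .
qed

text \<open>The anticommutator acts as a derivation on each product of a fermion mode and a boson
  mode, and the outcome regroups into modes of a single charge. No formula for the anticommutator
  itself is involved, hence no central term either.\<close>

lemma anti_charge:
  assumes "i < 4" "j < 4" "l < 4"
  shows "anti i p j q (charge l r f) = charge l r (anti i p j q f) +
    (if i = j then fsc (of_int (p + q - 2 * r)) (charge l (p + q + r) f)
     else fsc (- of_int (p - q) * of_int (qtriple i j l)) (charge (qadd (qadd i j) l) (p + q + r) f))"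
proof -
  let ?s = "p + q" and ?h = "qadd (qadd i j) l"
  obtain K where K: "K \<ge> 0" "\<And>h. h \<in> set [f, anti i p j q f] \<Longrightarrow> killed_above K h"
    by (rule common_bound[of "[f, anti i p j q f]"]) blast
  let ?A = "{r - K - \<bar>?s\<bar>..K + \<bar>?s\<bar>}"
  have sub: "{r - K..K} \<subseteq> ?A" "{?s + r - K..K} \<subseteq> ?A" by auto
  have "anti i p j q (charge l r f) = (\<Sum>m\<in>?A. anti i p j q (mode_sum l r m f))"
    by (subst charge_eq[of K f ?A]) (use K sub in \<open>auto simp: anti_sum\<close>)
  moreover have "charge l r (anti i p j q f) = (\<Sum>m\<in>?A. mode_sum l r m (anti i p j q f))"
    by (subst charge_eq[of K "anti i p j q f" ?A]) (use K sub in auto)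
  moreover have "charge h (?s + r) f = (\<Sum>m\<in>?A. mode_sum h (?s + r) m f)" for h
    by (subst charge_eq[of K f ?A]) (use K sub in auto)
  moreover have "(\<Sum>m\<in>?A. anti i p j q (mode_sum l r m f))
    = (\<Sum>m\<in>?A. mode_sum l r m (anti i p j q f)) +
    (if i = j then fsc (of_int (?s - 2 * r)) (\<Sum>m\<in>?A. mode_sum l (?s + r) m f)
     else fsc (- of_int (p - q) * of_int (qtriple i j l)) (\<Sum>m\<in>?A. mode_sum ?h (?s + r) m f))"
  proof (cases "i = j")
    case True
    have "anti i p j q (mode_sum l r m f) = mode_sum l r m (anti i p j q f)
        + fsc (- of_int (?s + 2 * (r - m))) (mode_sum l (?s + r) m f)
        + (\<Sum>c\<in>idx. fsc (- 2 * of_int m * qsign l c) (fer c (?s + r - ?s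
        - m) (bos (qperm l c) (m + ?s) f)))" for m
      unfolding mode_sum_def anti_sum anti_fsc fock.scale_sum_right sum.distrib[symmetric]
    proof (rule sum.cong[OF refl])
      fix c assume c: "c \<in> idx"
      show "fsc (qsign l c) (anti i p j q (fer c (r - m) (bos (qperm l c) m f))) =
         fsc (qsign l c) (fer c (r - m) (bos (qperm l c) m (anti i p j q f))) +
         fsc (- complex_of_int (p + q + 2 * (r - m)))
         (fsc (qsign l c) (fer c (p + q + r - m) (bos (qperm l c) m f))) +
         fsc (- 2 * of_int m * qsign l c) (fer c (?s + r - ?s - m) (bos (qperm l c) (m + ?s) f))"
        unfolding anti_fer[OF assms(1,2) c] anti_bos[OF assms(1,2) qperm_idx[OF assms(3) c]] using True
        by (simp add: fields_add fields_fsc fields_minus fields_diff fock.scale_right_distrib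
              fock.scale_right_diff_distrib algebra_simps)
    qed
    then have "(\<Sum>m\<in>?A. anti i p j q (mode_sum l r m f)) = (\<Sum>m\<in>?A. mode_sum l r m (anti i p j q f))
        + (\<Sum>m\<in>?A. fsc (- of_int (?s + 2 * (r - m))) (mode_sum l (?s + r) m f))
        + (\<Sum>m\<in>?A. \<Sum>c\<in>idx. fsc (- 2 * of_int m * qsign l c) (fer c (?s + r - ?s
        - m) (bos (qperm l c) (m + ?s) f)))"
      by (simp only: sum.distrib)
    also have "(\<Sum>m\<in>?A. \<Sum>c\<in>idx. fsc (- 2 * of_int m * qsign l c) (fer c (?s + r - ?s
      - m) (bos (qperm l c) (m + ?s) f)))
      = (\<Sum>m\<in>?A. fsc (- 2 * of_int (m - ?s)) (mode_sum l (?s + r) m f))"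
      using weighted_shift[where K = K and f = f and n = "?s + r" and s = ?s and w = "\<lambda>m.
        - 2 * of_int m" and i = l] K by simp
    also have "(\<Sum>m\<in>?A. mode_sum l r m (anti i p j q f))
        + (\<Sum>m\<in>?A. fsc (- of_int (?s + 2 * (r - m))) (mode_sum l (?s + r) m f))
        + (\<Sum>m\<in>?A. fsc (- 2 * of_int (m - ?s)) (mode_sum l (?s + r) m f))
      = (\<Sum>m\<in>?A. mode_sum l r m (anti i p j q f))
        + fsc (of_int (?s - 2 * r)) (\<Sum>m\<in>?A. mode_sum l (?s + r) m f)"
    proof -
      \<comment> \<open>The fermionic and the bosonic weight both depend on \<open>m\<close>; their
        sum does not, which is why a charge is recovered.\<close>
      have "fsc (- of_int (?s + 2 * (r - m))) h + fsc (- 2 * of_int (m - ?s)) h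
        = fsc (of_int (?s - 2 * r)) h" for m h
      proof -
        have "- of_int (?s + 2 * (r - m)) + - 2 * of_int (m - ?s) = (of_int (?s - 2 * r) :: complex)"
          by simp
        then show ?thesis by (metis fock.scale_left_distrib)
      qed
      then show ?thesis
        by (simp only: add.assoc sum.distrib[symmetric] fock.scale_sum_right)
    qed
    finally show ?thesis using True by simp
  next
    case False
    have "anti i p j q (mode_sum l r m f) = mode_sum l r m (anti i p j q f)
        + fsc (- of_int (p - q) * of_int (qtriple i j l)) (mode_sum ?h (?s + r) m f)" for m
    proof -
      let ?\<pi> = "\<lambda>c. qperm i (qperm j c)"
      have "anti i p j q (mode_sum l r m f) - mode_sum l r m (anti i p j q f)
        = (\<Sum>c\<in>idx. fsc (- of_int (p - q) * (qsign l c * (qsign i c * qsign j (?\<pi> c))))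
             (fer (?\<pi> c) (?s + r - m) (bos (qperm l c) m f)))"
        unfolding mode_sum_def anti_sum anti_fsc sum_subtractf[symmetric]
      proof (rule sum.cong[OF refl])
        fix c assume c: "c \<in> idx"
        show "fsc (qsign l c) (anti i p j q (fer c (r - m) (bos (qperm l c) m f))) -
           fsc (qsign l c) (fer c (r - m) (bos (qperm l c) m (anti i p j q f))) =
           fsc (- of_int (p - q) * (qsign l c * (qsign i c * qsign j (?\<pi> c))))
             (fer (?\<pi> c) (?s + r - m) (bos (qperm l c) m f))"
          unfolding anti_fer[OF assms(1,2) c] anti_bos[OF assms(1,2) qperm_idx[OF assms(3) c]] using False
          by (simp add: fields_add fields_fsc fock.scale_right_distrib algebra_simps)
      qed
      \<comment> \<open>Reindexing by the involution ?\<pi> brings the fermion index back to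
        \<open>c\<close>, and the signs become those of a product of three units.\<close>
      also have "\<dots>
        = (\<Sum>c\<in>idx. fsc (- of_int (p - q) * (qsign l (?\<pi> c) * (qsign i (?\<pi> c) * qsign j c)))
             (fer c (?s + r - m) (bos (qperm l (?\<pi> c)) m f)))"
      proof -
        have "?\<pi> (?\<pi> c) = c" "?\<pi> c \<in> idx" if "c \<in> idx" for c
          using that assms qperm_idx qperm_qperm qperm_commute[of i j] by simp_all
        then show ?thesis
          by (intro sum.reindex_bij_witness[of _ ?\<pi> ?\<pi>]) auto
      qed
      also have "\<dots> = fsc (- of_int (p - q) * of_int (qtriple i j l)) (mode_sum ?h (?s + r) m f)"
        unfolding mode_sum_def fock.scale_sum_right
        by (rule sum.cong[OF refl])
          (use assms False in \<open>simp add: qsign_triple qperm_triple mult.assoc\<close>)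
      finally show ?thesis by (simp add: algebra_simps)
    qed
    then show ?thesis using False
      by (simp only: sum.distrib fock.scale_sum_right if_False)
  qed
  ultimately show ?thesis by simp
qed

section \<open>Action on the vacuum and the central term\<close>

lemma charge_fvac:
  assumes "p \<ge> 0" shows "charge i p fvac = 0"
proof -
  have k: "killed_above 0 fvac" by (simp add: killed_above_def bos_fvac fer_fvac)
  have "charge i p fvac = (\<Sum>m\<in>{p..0}. mode_sum i p m fvac)"
    by (rule charge_eq[OF k]) auto
  also have "\<dots> = 0"
  proof (rule sum.neutral, rule ballI)
    fix m assume "m \<in> {p..0}"
    then have "m = 0" using assms by auto
    \<comment> \<open>Bosonic zero modes act as 0, so the mode 0 of a charge also kills the
      vacuum.\<close>
    then show "mode_sum i p m fvac = 0" by (simp add: mode_sum_def bos_fvac)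
  qed
  finally show ?thesis .
qed

lemma less_4_cases: "(i::nat) < 4 \<Longrightarrow> i = 0 \<or> i = 1 \<or> i = 2 \<or> i = 3"
  by linarith

definition zero_pair :: "nat \<Rightarrow> nat \<Rightarrow> nat \<times> nat \<Rightarrow> fock" where
  "zero_pair i j c = fsc (qsign j c * qsign i (qperm i (qperm j c))) (fer c 0 (fer (qperm i (qperm j c)) 0 fvac))"

text \<open>Bilinears in the four zero modes of a copy span so(4), and the combinations with
  distinct i and j lie in one of its two sl(2) factors. The vacuum belongs to a doublet of the other
  factor and is a singlet of this one.\<close>

lemma zero_mode_bilinear:
  assumes "i < 4" "j < 4" "i \<noteq> j"
  shows "(\<Sum>c\<in>idx. zero_pair i j c) = 0"
proof -
  have "(\<Sum>\<mu><4. zero_pair i j (s, \<mu>)) = 0" for s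
  proof -
    define P where "P \<mu> \<nu> = fer (s, \<mu>) 0 (fer (s, \<nu>) 0 fvac)" for \<mu> \<nu>
    have anti: "P \<mu> \<nu> = - P \<nu> \<mu>" if "\<mu> \<noteq> \<nu>" for \<mu> \<nu>
      using fer_fer[of "(s, \<mu>)" 0 "(s, \<nu>)" 0 fvac] that by (simp add: P_def eq_neg_iff_add_eq_0)
    have sq: "P \<mu> \<mu> = P 0 0" for \<mu>
    proof -
      have "fsc 2 (P \<mu> \<mu>) = fvac" for \<mu>
        using fer_fer[of "(s, \<mu>)" 0 "(s, \<mu>)" 0 fvac]
          fock.scale_left_distrib[of 1 1 "P \<mu> \<mu>"] by (simp add: P_def)
      then have "fsc 2 (P \<mu> \<mu>) = fsc 2 (P 0 0)" by simp
      then show ?thesis by (simp add: fock.scale_left_imp_eq)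
    qed
    have P1: "P \<mu> (Suc 0) = fsc \<i> (P \<mu> 0)" and P3: "P \<mu> 3 = fsc \<i> (P \<mu> 2)" for \<mu>
      using fer_zero_fvac[of 0 s] fer_zero_fvac[of 2 s] by (simp_all add: P_def fields_fsc eval_nat_numeral)
    \<comment> \<open>All products of two zero modes on the vacuum are multiples of just two
      vectors, \<open>P 0 0\<close> and \<open>P 0 2\<close>.\<close>
    have v: "P 0 (Suc 0) = fsc \<i> (P 0 0)" "P (Suc 0) 0 = - fsc \<i> (P 0 0)"
      "P 2 3 = fsc \<i> (P 0 0)" "P 3 2 = - fsc \<i> (P 0 0)"
      "P 2 0 = - P 0 2" "P 0 3 = fsc \<i> (P 0 2)" "P 3 0 = - fsc \<i> (P 0 2)"
      "P (Suc 0) 2 = fsc \<i> (P 0 2)" "P 2 (Suc 0) = - fsc \<i> (P 0 2)"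
      "P (Suc 0) 3 = - P 0 2" "P 3 (Suc 0) = P 0 2"
      using P1[of 0] P1[of 2] P1[of 3] P3[of 0] P3[of 1] P3[of 2] sq[of 2] anti[of 1 0] anti[of 3 2]
        anti[of 2 0] anti[of 3 0] anti[of 1 2] anti[of 1 3] anti[of 3 1]
      by simp_all
    show ?thesis
      using assms(3) less_4_cases[OF assms(1)] less_4_cases[OF assms(2)]
      by (elim disjE) (simp_all add: zero_pair_def eval_nat_numeral qsign_def qsgn_def qperm_def qadd_def
          v[unfolded P_def eval_nat_numeral, simplified])
  qed
  then show ?thesis
    by (simp add: idx_def sum.cartesian_product')
qed

text \<open>The mode p kills the vacuum, so one order of the product survives. Moving mode p through
  it produces boson contractions with total 4N p(p + 1)/2 and, from the fermionic zero modes, the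
  correction -2N p; together 2N p^2.\<close>

lemma anti_fvac_aux:
  assumes "i < 4" "j < 4" "p + q \<ge> 0" "p \<ge> 0"
  shows "anti i p j q fvac = (if i = j \<and> p + q = 0 then fsc (2 * of_nat N * of_int (p * p)) fvac else 0)"
proof (cases "q \<ge> 0")
  case True
  then show ?thesis using assms by (auto simp: anti_def charge_fvac)
next
  case False
  have k: "killed_above 0 fvac" by (simp add: killed_above_def bos_fvac fer_fvac)
  have "charge j q fvac = (\<Sum>m\<in>{q..0}. mode_sum j q m fvac)"
    by (rule charge_eq[OF k]) auto
  then have "anti i p j q fvac
    = (\<Sum>m\<in>{q..0}. \<Sum>c\<in>idx. fsc (qsign j c) (charge i p (fer c (q - m) (bos (qperm j c) m fvac))))"
    using assms(4) by (simp add: anti_def charge_fvac charge_sum mode_sum_def charge_fsc)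
  also have "\<dots> = (\<Sum>m\<in>{q..0}. \<Sum>c\<in>idx.
      (if i = j \<and> p + q = 0 then fsc (- of_int m) fvac else 0)
      + (if p + q = 0 \<and> m = q then fsc (of_int q) (zero_pair i j c) else 0))"
  proof (intro sum.cong refl)
    fix m c assume m: "m \<in> {q..0}" and c: "c \<in> idx"
    let ?d = "qperm j c"
    have d: "?d \<in> idx" using qperm_idx assms(2) c by simp
    have b: "charge i p (bos ?d m fvac) = fsc (- of_int m * qsign i (qperm i ?d)) (fer (qperm i ?d) (p + m) fvac)"
      using charge_bos[OF assms(1) d, of p m fvac] charge_fvac[OF assms(4)] by simp
    have sum0: "complex_of_int p + (complex_of_int q - complex_of_int m) = - complex_of_int m" if "p + q = 0"
      using that by (simp add: algebra_simps flip: of_int_add)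
    have b': "bos (qperm i c) (p + (q - m)) (bos ?d m fvac)
      = (if i = j \<and> p + q = 0 then fsc (- of_int m) fvac else 0)"
      using bos_bos[of "qperm i c" "p + (q - m)" ?d m fvac] bos_fvac[of "p + (q - m)"] m assms(3)
        qperm_inj[OF assms(1,2) c] by (auto simp: sum0)
    \<comment> \<open>The index \<open>p + m\<close> is at least \<open>p + q\<close>, hence
      nonnegative; positive fermion modes kill the vacuum, and index 0 occurs only for
      \<open>p + q = 0\<close> and \<open>m = q\<close>.\<close>
    have f: "fer c (q - m) (fer (qperm i ?d) (p + m) fvac)
      = (if p + q = 0 \<and> m = q then fer c 0 (fer (qperm i ?d) 0 fvac) else 0)"
    proof (cases "p + m > 0")
      case True
      then show ?thesis using fer_fvac[of "p + m"] by auto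
    next
      case False
      then have "p + q = 0" "m = q" using m assms(3) by auto
      then show ?thesis by (simp add: add.commute)
    qed
    have "charge i p (fer c (q - m) (bos ?d m fvac)) =
       fsc (qsign i c) (bos (qperm i c) (p + (q - m)) (bos ?d m fvac)) - fer c (q - m) (charge i p (bos ?d m fvac))"
      using charge_fer[OF assms(1) c, of p "q - m" "bos ?d m fvac"] by (simp add: eq_diff_eq)
    then show "fsc (qsign j c) (charge i p (fer c (q - m) (bos ?d m fvac))) =
      (if i = j \<and> p + q = 0 then fsc (- of_int m) fvac else 0)
      + (if p + q = 0 \<and> m = q then fsc (of_int q) (zero_pair i j c) else 0)"
      unfolding b b' fields_fsc f zero_pair_def using qsign_square[OF assms(2) c]
      by (auto simp: fields_fsc fields_minus algebra_simps)
  qed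
  also have "\<dots>
    = (\<Sum>m\<in>{q..0}. (if i = j \<and> p + q = 0 then fsc (- of_int m * of_nat (card idx)) fvac else 0)
      + (if p + q = 0 \<and> m = q then fsc (of_int q) (\<Sum>c\<in>idx. zero_pair i j c) else 0))"
  proof (rule sum.cong[OF refl])
    have const: "(\<Sum>c\<in>idx. fsc t fvac) = fsc (t * of_nat (card idx)) fvac" for t
      by (simp add: fock.scale_left_distrib flip: fock.scale_sum_left)
    have "(\<Sum>c\<in>idx. (if b then fsc t fvac else 0) + (if b' then fsc u (h c) else 0))
      = (if b then fsc (t * of_nat (card idx)) fvac else 0) + (if b' then fsc u (\<Sum>c\<in>idx. h c) else 0)"
      for b b' t u and h :: "nat \<times> nat \<Rightarrow> fock"
      by (cases b; cases b') (simp_all add: sum.distrib const fock.scale_sum_right)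
    then show "(\<Sum>c\<in>idx. (if i = j \<and> p + q = 0 then fsc (- of_int m) fvac else 0)
      + (if p + q = 0 \<and> m = q then fsc (of_int q) (zero_pair i j c) else 0)) =
      (if i = j \<and> p + q = 0 then fsc (- of_int m * of_nat (card idx)) fvac else 0)
      + (if p + q = 0 \<and> m = q then fsc (of_int q) (\<Sum>c\<in>idx. zero_pair i j c) else 0)"
      for m .
  qed
  also have "\<dots> = (if i = j \<and> p + q = 0 then fsc (2 * of_nat N * of_int (p * p)) fvac else 0)"
  proof (cases "p + q = 0")
    case False
    then show ?thesis by simp
  next
    case True
    then have q: "q = - p" by simp
    have triangle: "(\<Sum>m\<in>{- int n..0}. - of_int m) = (of_nat n * of_nat (Suc n) / 2 :: complex)" for n
    proof (induction n)
      case (Suc n)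
      have "{- int (Suc n)..0} = insert (- int (Suc n)) {- int n..0}" by auto
      with Suc show ?case by (simp add: field_simps)
    qed simp
    have triangle: "(\<Sum>m\<in>{- p..0}. - of_int m) = (of_int p * (of_int p + 1) / 2 :: complex)"
      using triangle[of "nat p"] assms(4) by (simp add: add.commute)
    have card: "card idx = 4 * N" by (simp add: idx_def)
    show ?thesis
    proof (cases "i = j")
      case False
      then show ?thesis using zero_mode_bilinear[OF assms(1,2) False] by (simp cong: if_cong)
    next
      case eq: True
      have half: "fer c 0 (fer c 0 fvac) = fsc (1/2) fvac" for c
      proof -
        have "fsc 2 (fer c 0 (fer c 0 fvac)) = fvac"
          using fer_fer[of c 0 c 0 fvac] fock.scale_left_distrib[of 1 1 "fer c 0 (fer c 0 fvac)"] by simp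
        then have "fsc (1/2) (fsc 2 (fer c 0 (fer c 0 fvac))) = fsc (1/2) fvac" by simp
        then show ?thesis by simp
      qed
      have "(\<Sum>c\<in>idx. zero_pair i j c)
        = (\<Sum>c\<in>idx. fsc (1/2) fvac)"
        by (rule sum.cong) (use assms eq in \<open>auto simp: zero_pair_def qperm_qperm qsign_square half\<close>)
      also have "\<dots> = fsc (2 * of_nat N) fvac"
        using card by (simp flip: fock.scale_sum_left)
      finally have Z: "(\<Sum>c\<in>idx. zero_pair i j c)
        = fsc (2 * of_nat N) fvac" .
      have "(\<Sum>m\<in>{q..0}. (if i = j \<and> p + q = 0 then fsc (- of_int m * of_nat (card idx)) fvac else 0)
          + (if p + q = 0 \<and> m = q then fsc (of_int q) (fsc (2 * of_nat N) fvac) else 0))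
        = fsc ((\<Sum>m\<in>{- p..0}. - of_int m) * (4 * of_nat N)) fvac + fsc (of_int q * (2 * of_nat N)) fvac"
      proof -
        have "(\<Sum>m\<in>{q..0}. if i = j \<and> p + q = 0 then fsc (- of_int m * of_nat (card idx)) fvac else 0)
          = (\<Sum>m\<in>{- p..0}. fsc (- of_int m * (4 * of_nat N)) fvac)"
          using True eq card q by simp
        also have "\<dots> = fsc ((\<Sum>m\<in>{- p..0}. - of_int m) * (4 * of_nat N)) fvac"
          by (simp only: sum_distrib_right fock.scale_sum_left)
        finally have A: "(\<Sum>m\<in>{q..0}.
        if i = j \<and> p + q = 0 then fsc (- of_int m * of_nat (card idx)) fvac else 0)
          = fsc ((\<Sum>m\<in>{- p..0}. - of_int m) * (4 * of_nat N)) fvac" .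
        have B: "(\<Sum>m\<in>{q..0}. if p + q = 0 \<and> m = q then h else 0) = h" for h :: fock
          using True q assms(4) by simp
        show ?thesis
          by (simp only: sum.distrib A B fock.scale_scale)
      qed
      also have "\<dots> = fsc (2 * of_nat N * of_int (p * p)) fvac"
      proof -
        have "of_int p * (of_int p + 1) / 2 * (4 * of_nat N) + of_int (- p) * (2 * of_nat N)
          = (2 * of_nat N * of_int (p * p) :: complex)"
          by (simp add: algebra_simps)
        then show ?thesis
          unfolding triangle q by (simp only: fock.scale_left_distrib[symmetric])
      qed
      finally show ?thesis unfolding Z using eq True by simp
    qed
  qed
  finally show ?thesis .
qed

lemma anti_fvac:
  assumes "i < 4" "j < 4" "p + q \<ge> 0"
  shows "anti i p j q fvac = (if i = j \<and> p + q = 0 then fsc (2 * of_nat N * of_int (p * p)) fvac else 0)"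
proof (cases "p \<ge> 0")
  case True
  then show ?thesis using anti_fvac_aux assms by blast
next
  case False
  then have "q \<ge> 0" using assms(3) by simp
  moreover have "anti i p j q fvac = anti j q i p fvac" by (simp add: anti_def add.commute)
  moreover have "q * q = p * p" if "p + q = 0" using that by (simp add: eq_neg_iff_add_eq_0[symmetric])
  ultimately show ?thesis using anti_fvac_aux[OF assms(2,1), of q p] assms(3)
    by (auto simp: add.commute)
qed

end

section \<open>The odd space and its triple product\<close>

text \<open>Coordinates on \<open>g_mhalf\<close>: under \<open>nt 0 1 0\<close> the entries b and c
  have weight 1, the entries a and d weight -1.\<close>

definition mh :: "complex \<Rightarrow> complex \<Rightarrow> complex \<Rightarrow> complex \<Rightarrow>
  mat4" where
  "mh a b c d = (\<chi> i j. if i = 2 \<and> j = 3 then a else if i = 2 \<and> j = 4 then b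
     else if i = 3 \<and> j = 1 then c else if i = 4 \<and> j = 1 then d else 0)"

definition nt :: "complex \<Rightarrow> complex \<Rightarrow> complex \<Rightarrow> mat4" where
  "nt p q r = (\<chi> i j. if i = 3 \<and> j = 4 then p else if i = 3 \<and> j = 3 then q
     else if i = 4 \<and> j = 4 then - q else if i = 4 \<and> j = 3 then r else 0)"

lemma supercomm_nth:
  "supercomm A B $ i $ j = (\<Sum>l\<in>UNIV. A $ i $ l * B $ l $ j
     - (if odd_index i \<noteq> odd_index l \<and> odd_index l \<noteq> odd_index j then -1 else 1) *
       (B $ i $ l * A $ l $ j))"
  unfolding supercomm_def matrix_matrix_mult_def even_comp_def odd_comp_def
  by (auto simp: sum_subtractf[symmetric] sum.distrib[symmetric] sum_negf[symmetric] intro!: sum.cong)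

lemma br_nth:
  "br A B $ i $ j = supercomm A B $ i $ j
     - (if i = j then (supercomm A B $ 1 $ 1 + supercomm A B $ 2 $ 2) / 2 else 0)"
  by (simp add: br_def psl_rep_def cmul_def mat_def)

lemma odd_index_numeral [simp]: "\<not> odd_index 1" "\<not> odd_index 2" "odd_index 3" "odd_index 4"
  by (simp_all add: odd_index_def)

lemma form_alt: "form A B = (\<Sum>l\<in>UNIV. A $ 1 $ l * B $ l $ 1 + A $ 2 $ l * B $ l $ 2
  - A $ 3 $ l * B $ l $ 3 - A $ 4 $ l * B $ l $ 4)"
  by (simp add: form_def supertrace_def matrix_matrix_mult_def sum.distrib sum_subtractf)

lemma s_nth:
  "e_s $ i $ j = (if i = 1 \<and> j = 2 then 1 else 0)"
  "f_s $ i $ j = (if i = 2 \<and> j = 1 then 1/2 else 0)"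
  "x_s $ i $ j = (if i = 1 \<and> j = 1 then 1/2 else if i = 2 \<and> j = 2 then - (1/2) else 0)"
  by (auto simp: e_s_def f_s_def x_s_def cmul_def munit_def)

lemma mh_nth: "mh a b c d $ i $ j = (if i = 2 \<and> j = 3 then a else if i = 2 \<and> j = 4 then b
     else if i = 3 \<and> j = 1 then c else if i = 4 \<and> j = 1 then d else 0)"
  by (simp add: mh_def)

lemma nt_nth: "nt p q r $ i $ j = (if i = 3 \<and> j = 4 then p else if i = 3 \<and> j = 3 then q
     else if i = 4 \<and> j = 4 then - q else if i = 4 \<and> j = 3 then r else 0)"
  by (simp add: nt_def)

lemma mat4_eqI:
  fixes A B :: mat4
  assumes "A $ 1 $ 1 = B $ 1 $ 1" "A $ 1 $ 2 = B $ 1 $ 2" "A $ 1 $ 3 = B $ 1 $ 3" "A $ 1 $ 4 = B $ 1 $ 4"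
    "A $ 2 $ 1 = B $ 2 $ 1" "A $ 2 $ 2 = B $ 2 $ 2" "A $ 2 $ 3 = B $ 2 $ 3" "A $ 2 $ 4 = B $ 2 $ 4"
    "A $ 3 $ 1 = B $ 3 $ 1" "A $ 3 $ 2 = B $ 3 $ 2" "A $ 3 $ 3 = B $ 3 $ 3" "A $ 3 $ 4 = B $ 3 $ 4"
    "A $ 4 $ 1 = B $ 4 $ 1" "A $ 4 $ 2 = B $ 4 $ 2" "A $ 4 $ 3 = B $ 4 $ 3" "A $ 4 $ 4 = B $ 4 $ 4"
  shows "A = B"
  using assms by (simp add: vec_eq_iff forall_4)

lemmas br_simps = br_nth supercomm_nth sum_4 s_nth mh_nth nt_nth

lemma mh_in_g_mhalf: "mh a b c d \<in> g_mhalf"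
  by (auto simp: ad_x_space_def psl22_def mh_nth cmul_def intro!: mat4_eqI) (simp_all add: br_simps)

lemma g_mhalf_eq:
  assumes "u \<in> g_mhalf" shows "u = mh (u $ 2 $ 3) (u $ 2 $ 4) (u $ 3 $ 1) (u $ 4 $ 1)"
proof -
  have "br x_s u $ i $ j = - (1/2) * u $ i $ j" for i j
    using assms by (simp add: ad_x_space_def cmul_def)
  note * = this
  have "3 * (u $ 1 $ 2) = 0" using *[of 1 2] by (simp add: br_simps field_simps)
  with *[of 1 1] *[of 1 3] *[of 1 4] *[of 2 1] *[of 2 2] *[of 3 2]
    *[of 3 3] *[of 3 4] *[of 4 2] *[of 4 3] *[of 4 4]
  show ?thesis by (intro mat4_eqI) (simp_all add: br_simps)
qed

lemma g_mhalf_cases: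
  assumes "u \<in> g_mhalf" obtains a b c d where "u = mh a b c d"
  using g_mhalf_eq[OF assms] by blast

lemma nt_in_g_nat: "nt p q r \<in> g_nat"
  by (auto simp: g_nat_def psl22_def nt_nth intro!: mat4_eqI) (simp_all add: br_simps)

lemma g_nat_eq:
  assumes "a \<in> g_nat" shows "a = nt (a $ 3 $ 4) (a $ 3 $ 3) (a $ 4 $ 3)"
proof -
  have t: "a $ 1 $ 1 + a $ 2 $ 2 = 0" "a $ 3 $ 3 + a $ 4 $ 4 = 0"
    using assms by (auto simp: g_nat_def psl22_def)
  have "br x_s a $ i $ j = 0" "br e_s a $ i $ j = 0" for i j
    using assms by (simp_all add: g_nat_def)
  from this(1)[of 1 2] this(1)[of 1 3] this(1)[of 1 4] this(1)[of 2 1] this(1)[of 2 3] this(1)[of 2 4]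
    this(1)[of 3 1] this(1)[of 3 2] this(1)[of 4 1] this(1)[of 4 2] this(2)[of 1 2] t
  show ?thesis by (intro mat4_eqI) (simp_all add: br_simps eq_neg_iff_add_eq_0 add.commute)
qed

lemma g_nat_cases:
  assumes "a \<in> g_nat" obtains p q r where "a = nt p q r"
  using g_nat_eq[OF assms] by blast

lemma mh_add: "mh a b c d + mh a' b' c' d' = mh (a + a') (b + b') (c + c') (d + d')"
  by (simp add: mh_nth vec_eq_iff)

lemma cmul_mh: "cmul t (mh a b c d) = mh (t * a) (t * b) (t * c) (t * d)"
  by (simp add: mh_nth vec_eq_iff cmul_def)

lemma nt_add: "nt p q r + nt p' q' r' = nt (p + p') (q + q') (r + r')"
  by (simp add: nt_nth vec_eq_iff)

lemma cmul_nt: "cmul t (nt p q r) = nt (t * p) (t * q) (t * r)"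
  by (simp add: nt_nth vec_eq_iff cmul_def)

lemma mh_inject: "mh a b c d = mh a' b' c' d' \<longleftrightarrow> a = a' \<and> b = b' \<and> c
  = c' \<and> d = d'"
proof
  assume "mh a b c d = mh a' b' c' d'"
  then have "mh a b c d $ i $ j = mh a' b' c' d' $ i $ j" for i j by simp
  from this[of 2 3] this[of 2 4] this[of 3 1] this[of 4 1]
  show "a = a' \<and> b = b' \<and> c = c' \<and> d = d'" by (simp add: mh_nth)
qed simp

lemma mh_zero: "mh 0 0 0 0 = 0"
  by (simp add: mh_nth vec_eq_iff)

lemma ang_mh: "ang (mh a b c d) (mh a' b' c' d') = a * c' + b * d' + c * a' + d * b'"
  by (simp add: ang_def form_alt br_simps)

lemma br_nt_mh: "br (nt p q r) (mh a b c d)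
    = mh (- (a * q + b * r)) (b * q - a * p) (p * d + q * c) (r * c - q * d)"
  by (rule mat4_eqI) (simp_all add: br_simps algebra_simps)

lemma br_mh_nt: "br (mh a b c d) (nt p q r)
    = mh (a * q + b * r) (a * p - b * q) (- (p * d + q * c)) (q * d - r * c)"
  by (rule mat4_eqI) (simp_all add: br_simps algebra_simps)

lemma br_nt_nt: "br (nt p q r) (nt p' q' r')
    = nt (2 * (q * p' - p * q')) (p * r' - r * p') (2 * (r * q' - q * r'))"
  by (rule mat4_eqI) (simp_all add: br_simps algebra_simps)

text \<open>The element of \<open>g_nat\<close> whose current occurs in the bracket of
  \<open>G u\<close> and \<open>G v\<close>; it is antisymmetric in u and v.\<close>

definition bil :: "mat4 \<Rightarrow> mat4 \<Rightarrow> mat4" where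
  "bil u v = nat_proj (br (br e_s u) v)"

definition mg :: "complex \<Rightarrow> complex \<Rightarrow> complex \<Rightarrow> complex \<Rightarrow>
  mat4" where
  "mg a b c d = (\<chi> i j. if i = 1 \<and> j = 3 then a else if i = 1 \<and> j = 4 then b
     else if i = 3 \<and> j = 2 then c else if i = 4 \<and> j = 2 then d else 0)"

lemma mg_nth: "mg a b c d $ i $ j = (if i = 1 \<and> j = 3 then a else if i = 1 \<and> j = 4 then b
     else if i = 3 \<and> j = 2 then c else if i = 4 \<and> j = 2 then d else 0)"
  by (simp add: mg_def)

lemma br_e_mh: "br e_s (mh a b c d) = mg a b (- c) (- d)"
  by (rule mat4_eqI) (simp_all add: br_simps mg_nth)

lemma bil_mh: "bil (mh a b c d) (mh a' b' c' d')
  = nt (b * c' - c * b') ((a * c' - b * d' - c * a' + d * b') / 2) (a * d' - d * a')"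
  unfolding bil_def br_e_mh nat_proj_def
  by (rule mat4_eqI) (simp_all add: form_alt br_simps mg_nth cmul_def field_simps)

lemma br_mg_mh: "br (br e_s (mh a b c d)) (mh a' b' c' d')
  = nt (b * c' - c * b') ((a * c' - b * d' - c * a' + d * b') / 2) (a * d' - d * a')
    + cmul (ang (mh a b c d) (mh a' b' c' d')) x_s"
  unfolding br_e_mh ang_mh
  by (rule mat4_eqI) (simp_all add: form_alt br_simps mg_nth cmul_def field_simps)

lemma br_mh_mh: "br (mh a b c d) (mh a' b' c' d')
  = cmul (2 * ang (mh a b c d) (mh a' b' c' d')) f_s"
  unfolding ang_mh
  by (rule mat4_eqI) (simp_all add: br_simps cmul_def algebra_simps)

lemma basis_nt:
  "munit 3 4 = nt 1 0 0" "munit 3 3 - munit 4 4 = nt 0 1 0" "munit 4 3 = nt 0 0 1"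
  by (auto simp: vec_eq_iff nt_nth munit_def)

lemma basis_mh:
  "munit 2 3 = mh 1 0 0 0" "munit 2 4 = mh 0 1 0 0" "munit 3 1 = mh 0 0 1 0" "munit 4 1 = mh 0 0 0 1"
  by (auto simp: vec_eq_iff mh_nth munit_def)

section \<open>Mode relations\<close>

lemma finsupp_sum_eq:
  assumes "\<And>j. j \<ge> n \<Longrightarrow> t j = 0"
  shows "finsupp_sum t = (\<Sum>j<n. t j)"
  unfolding finsupp_sum_def
  by (rule sum.mono_neutral_left) (use assms in \<open>auto simp: not_less[symmetric]\<close>)

lemma zero_gchoose: "(0 :: 'a :: field_char_0) gchoose j = (if j = 0 then 1 else 0)"
  by (cases j) simp_all

section \<open>The bracket of two supercurrents in linear form\<close>

context minimal_W_psl22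
begin

lemma bracket_nprod:
  assumes "lambda_bracket a b cs"
  shows "nprod (int n) a b = (if n < length cs then scl (fact n) (cs ! n) else 0)"
proof -
  have "scl (fact n) (scl (1 / fact n) (nprod (int n) a b)) = scl (fact n) (if n < length cs then cs ! n else 0)"
    using assms unfolding lambda_bracket_def by presburger
  then show ?thesis by (simp split: if_splits)
qed

lemma nprod_zero_left [simp]: "nprod n 0 b = 0"
  using nprod_scl_left[of n 0 0 b] by simp

lemma nprod_zero_right [simp]: "nprod n a 0 = 0"
  using nprod_scl_right[of n a 0 0] by simp

text \<open>Borcherds identity with m = l = -1, n = 0 and third vector \<open>vac\<close>. The
  central term of the bracket of currents contributes the (-3)-product of \<open>vac\<close> with
  itself, which is 0.\<close>

lemma normal_prod_J_commute:
  assumes "a \<in> g_nat" "b \<in> g_nat"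
  shows "normal_prod (J a) (J b) = normal_prod (J b) (J a) + deriv_T (J (br a b))"
proof -
  note n = bracket_nprod[OF JJ[OF assms]]
  let ?t = "\<lambda>j. scl (of_int (-1) gchoose j) (nprod (-1 + -1 - int j) (nprod (0 + int j) (J a) (J b)) vac)"
  let ?s = "\<lambda>j. scl ((-1) ^ j * (of_int 0 gchoose j))
          (nprod (-1 + 0 - int j) (J a) (nprod (-1 + int j) (J b) vac)
           - scl (koszul False False * int_sign 0) (nprod (0 + -1 - int j) (J b) (nprod (-1 + int j) (J a) vac)))"
  have "?t j = 0" if "j \<ge> 1" for j
    using that n[of j] by (cases "j = 1") (simp_all add: nprod_scl_left vac_left)
  then have "finsupp_sum ?t = deriv_T (J (br a b))"
    by (subst finsupp_sum_eq[of 1]) (use n[of 0] in \<open>simp_all add: deriv_T_def\<close>)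
  moreover have "finsupp_sum ?s = normal_prod (J a) (J b) - normal_prod (J b) (J a)"
    by (subst finsupp_sum_eq[of 1])
      (simp_all add: zero_gchoose koszul_def int_sign_def vac_right normal_prod_def)
  moreover have "finsupp_sum ?t = finsupp_sum ?s"
    by (rule borcherds) (use assms J_even in auto)
  ultimately show ?thesis by (simp add: algebra_simps)
qed

lemma deriv_T_add: "deriv_T (a + b) = deriv_T a + deriv_T b"
  by (simp add: deriv_T_def nprod_add_left)

lemma deriv_T_scl: "deriv_T (scl t a) = scl t (deriv_T a)"
  by (simp add: deriv_T_def nprod_scl_left)

lemma normal_prod_scl: "normal_prod (scl t a) b = scl t (normal_prod a b)"
  "normal_prod a (scl t b) = scl t (normal_prod a b)"
  by (simp_all add: normal_prod_def nprod_scl_left nprod_scl_right)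

lemma J_nt: "J (nt p q r) = scl p (J (nt 1 0 0)) + scl q (J (nt 0 1 0)) + scl r (J (nt 0 0 1))"
  using J_linear(1)[OF nt_in_g_nat nt_in_g_nat, of p 0 0 0 q 0]
    J_linear(1)[OF nt_in_g_nat nt_in_g_nat, of p q 0 0 0 r]
    J_linear(2)[OF nt_in_g_nat[of 1 0 0], of p] J_linear(2)[OF nt_in_g_nat[of 0 1 0], of q]
    J_linear(2)[OF nt_in_g_nat[of 0 0 1], of r]
  by (simp add: nt_add cmul_nt)

lemma nat_basis_nt: "nat_basis 0 = nt 1 0 0" "nat_basis 1 = nt 0 1 0" "nat_basis 2 = nt 0 0 1"
  by (simp_all add: nat_basis_def basis_nt numeral_2_eq_2)

lemma nat_dual_nt: "nat_dual 0 = nt 0 0 (-1)" "nat_dual 1 = nt 0 (-1/2) 0" "nat_dual 2 = nt (-1) 0 0"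
proof -
  have "- nt p q r = nt (- p) (- q) (- r)" for p q r
    by (simp add: nt_def vec_eq_iff)
  then show "nat_dual 0 = nt 0 0 (-1)" "nat_dual 1 = nt 0 (-1/2) 0" "nat_dual 2 = nt (-1) 0 0"
    by (simp_all add: nat_dual_def basis_nt numeral_2_eq_2 cmul_nt)
qed

lemma sum_3: "(\<Sum>\<alpha><3. f \<alpha>) = f 0 + f 1 + f (2::nat)"
  for f :: "nat \<Rightarrow> 'x :: comm_monoid_add"
  by (simp add: eval_nat_numeral)

text \<open>As a module over \<open>g_nat\<close>, the odd space is a sum of two doublets, and on a
  doublet the symmetrized product of two elements of sl(2) is a scalar. By invariance of
  \<open>ang\<close>, the symmetric part of the double sum is therefore a multiple of the quadratic
  Casimir expression and cancels the first sum. In the antisymmetric part the normal products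
  combine to commutators, which are derivatives of currents.\<close>

lemma normal_products_cancel:
  assumes "u \<in> g_mhalf" "v \<in> g_mhalf"
  shows "scl (ang u v) (\<Sum>\<alpha><3. normal_prod (J (nat_dual \<alpha>)) (J (nat_basis \<alpha>)))
         + scl 2 (\<Sum>\<alpha><3. \<Sum>\<beta><3. scl (ang (br (nat_basis \<alpha>) u) (br v (nat_dual \<beta>)))
             (normal_prod (J (nat_dual \<alpha>)) (J (nat_basis \<beta>))))
     = scl (-2) (deriv_T (J (bil u v)))"
proof -
  obtain a b c d where u: "u = mh a b c d" by (rule g_mhalf_cases[OF assms(1)])
  obtain a' b' c' d' where v: "v = mh a' b' c' d'" by (rule g_mhalf_cases[OF assms(2)])
  define e h f where "e = J (nt 1 0 0)" and "h = J (nt 0 1 0)" and "f = J (nt 0 0 1)"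
  have dual: "J (nat_dual 0) = scl (-1) f" "J (nat_dual 1) = scl (-1/2) h" "J (nat_dual 2) = scl (-1) e"
    unfolding nat_dual_nt by (subst J_nt; simp add: e_def h_def f_def)+
  have basis: "J (nat_basis 0) = e" "J (nat_basis 1) = h" "J (nat_basis 2) = f"
    by (simp_all only: nat_basis_nt e_def h_def f_def)
  have eh: "normal_prod e h = normal_prod h e + scl (-2) (deriv_T e)"
    using normal_prod_J_commute[OF nt_in_g_nat nt_in_g_nat, of 1 0 0 0 1 0]
    by (simp add: br_nt_nt e_def h_def J_nt[of "-2"] flip: deriv_T_scl)
  have ef: "normal_prod e f = normal_prod f e + deriv_T h"
    using normal_prod_J_commute[OF nt_in_g_nat nt_in_g_nat, of 1 0 0 0 0 1]
    by (simp add: br_nt_nt e_def h_def f_def)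
  have hf: "normal_prod h f = normal_prod f h + scl (-2) (deriv_T f)"
    using normal_prod_J_commute[OF nt_in_g_nat nt_in_g_nat, of 0 1 0 0 0 1]
    by (simp add: br_nt_nt f_def h_def J_nt[of 0 0 "-2"] flip: deriv_T_scl)
  define A where "A \<alpha> \<beta> = ang (br (nat_basis \<alpha>) u) (br v (nat_dual \<beta>))"
    for \<alpha> \<beta>
  have "scl (ang u v) (\<Sum>\<alpha><3. normal_prod (J (nat_dual \<alpha>)) (J (nat_basis \<alpha>)))
         + scl 2 (\<Sum>\<alpha><3. \<Sum>\<beta><3. scl (A \<alpha> \<beta>)
         (normal_prod (J (nat_dual \<alpha>)) (J (nat_basis \<beta>))))
    = scl (- ang u v - 2 * A 0 0) (normal_prod f e) + scl (- 2 * A 0 1) (normal_prod f h)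
    + scl (- 2 * A 0 2) (normal_prod f f) + scl (- A 1 0) (normal_prod h e)
    + scl (- ang u v / 2 - A 1 1) (normal_prod h h) + scl (- A 1 2) (normal_prod h f)
    + scl (- 2 * A 2 0) (normal_prod e e) + scl (- 2 * A 2 1) (normal_prod e h)
    + scl (- ang u v - 2 * A 2 2) (normal_prod e f)"
    unfolding sum_3 dual basis normal_prod_scl
    by (simp add: scale_right_distrib scale_left_diff_distrib
        scale_right_diff_distrib algebra_simps)
  also have "\<dots> = scl (- 2 * (b * c' - c * b')) (deriv_T e)
     + scl (- (a * c' - b * d' - c * a' + d * b')) (deriv_T h) + scl (- 2 * (a * d' - d * a')) (deriv_T f)"
  proof -
    have A: "A \<alpha> \<beta> = ang (br (nat_basis \<alpha>) (mh a b c d))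
      (br (mh a' b' c' d') (nat_dual \<beta>))" for \<alpha> \<beta>
      by (simp add: A_def u v)
    have coeffs:
      "- 2 * A 0 2 = 0" "- 2 * A 2 0 = 0" "- ang u v / 2 - A 1 1 = 0"
      "- ang u v - 2 * A 0 0 = a * c' - b * d' - c * a' + d * b'"
      "- ang u v - 2 * A 2 2 = - (a * c' - b * d' - c * a' + d * b')"
      "- 2 * A 0 1 = - (a * d' - d * a')" "- A 1 2 = a * d' - d * a'"
      "- A 1 0 = - (b * c' - c * b')" "- 2 * A 2 1 = b * c' - c * b'"
      unfolding A u v nat_basis_nt nat_dual_nt br_nt_mh br_mh_nt ang_mh
      by (simp_all add: field_simps)
    show ?thesis
      unfolding coeffs eh ef hf
      by (simp add: scale_right_distrib algebra_simps)
  qed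
  also have "\<dots> = scl (-2) (deriv_T (J (bil u v)))"
    unfolding u v bil_mh by (subst J_nt)
      (simp add: deriv_T_add deriv_T_scl scale_right_distrib e_def h_def f_def)
  finally show ?thesis unfolding A_def .
qed

text \<open>The derivative left by the cancellation turns 2(k+1) into 2k, and the double sum of
  commutators, equal to -4 \<open>J (bil u v)\<close>, turns 4(k+1) into 4k. All terms are then
  linear in L, J and the vacuum.\<close>

lemma GG_brackets:
  assumes "u \<in> g_mhalf" "v \<in> g_mhalf"
  shows "lambda_bracket (G u) (G v)
    [scl (- 2 * k * ang u v) L + scl (2 * k) (deriv_T (J (bil u v))),
     scl (4 * k) (J (bil u v)), scl (2 * ang u v * (k * (k + 1))) vac]"
proof -
  obtain a b c d where u: "u = mh a b c d" by (rule g_mhalf_cases[OF assms(1)])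
  obtain a' b' c' d' where v: "v = mh a' b' c' d'" by (rule g_mhalf_cases[OF assms(2)])
  define e h f where "e = J (nt 1 0 0)" and "h = J (nt 0 1 0)" and "f = J (nt 0 0 1)"
  have Jb: "J (bil u v) = scl (b * c' - c * b') e + scl ((a * c' - b * d' - c * a' + d * b') / 2) h
     + scl (a * d' - d * a') f"
    unfolding u v bil_mh e_def h_def f_def by (rule J_nt)
  define A where "A \<alpha> \<beta> = ang (br (nat_basis \<alpha>) u) (br v (nat_dual \<beta>))"
    for \<alpha> \<beta>
  have A: "A \<alpha> \<beta> = ang (br (nat_basis \<alpha>) (mh a b c d))
    (br (mh a' b' c' d') (nat_dual \<beta>))" for \<alpha> \<beta>
    by (simp add: A_def u v)
  have J2: "J (nt p q r) = scl p e + scl q h + scl r f" for p q r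
    unfolding e_def h_def f_def by (rule J_nt)
  have "scl 2 (\<Sum>\<alpha><3. \<Sum>\<beta><3. scl (A \<alpha> \<beta>)
    (J (br (nat_dual \<alpha>) (nat_basis \<beta>))))
    = scl (4 * A 2 1 - 2 * A 1 0) e + scl (2 * A 0 0 - 2 * A 2 2) h + scl (2 * A 1 2 - 4 * A 0 1) f"
    unfolding sum_3 nat_basis_nt nat_dual_nt br_nt_nt J2
    by (simp add: scale_right_distrib scale_left_diff_distrib scale_right_diff_distrib algebra_simps)
  also have "\<dots> = scl (-4) (J (bil u v))"
  proof -
    have coeffs: "4 * A 2 1 - 2 * A 1 0 = -4 * (b * c' - c * b')"
      "2 * A 0 0 - 2 * A 2 2 = -4 * ((a * c' - b * d' - c * a' + d * b') / 2)"
      "2 * A 1 2 - 4 * A 0 1 = -4 * (a * d' - d * a')"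
      unfolding A nat_basis_nt nat_dual_nt br_nt_mh br_mh_nt ang_mh
      by (simp_all add: field_simps)
    show ?thesis unfolding coeffs Jb by (simp only: scale_right_distrib scale_scale)
  qed
  finally have J1: "scl 2 (\<Sum>\<alpha><3. \<Sum>\<beta><3. scl (ang (br (nat_basis \<alpha>) u)
    (br v (nat_dual \<beta>)))
      (J (br (nat_dual \<alpha>) (nat_basis \<beta>)))) = scl (-4) (J (bil u v))"
    unfolding A_def .
  have first: "scl (- 2 * k * ang u v) L
         + scl (ang u v) (\<Sum>\<alpha><3. normal_prod (J (nat_dual \<alpha>)) (J (nat_basis \<alpha>)))
         + scl 2 (\<Sum>\<alpha><3. \<Sum>\<beta><3. scl (ang (br (nat_basis \<alpha>) u) (br v (nat_dual \<beta>)))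
             (normal_prod (J (nat_dual \<alpha>)) (J (nat_basis \<beta>))))
         + scl (2 * (k + 1)) (deriv_T (J (bil u v)))
     = scl (- 2 * k * ang u v) L + scl (2 * k) (deriv_T (J (bil u v)))"
    using normal_products_cancel[OF assms]
    by (simp only: add.assoc[of "scl (- 2 * k * ang u v) L"])
      (simp add: algebra_simps flip: scale_left_distrib)
  have second: "scl (4 * (k + 1)) (J (bil u v)) + scl (-4) (J (bil u v)) = scl (4 * k) (J (bil u v))"
    by (simp only: scale_left_distrib[symmetric]) simp
  show ?thesis
    using GG[OF assms] unfolding bil_def[symmetric] J1 first second .
qed

end

section \<open>Commutators and derivatives from the twisted Borcherds identity\<close>

context ramond_module
begin

lemma md_zero [simp]: "md r 0 w = 0" "md r a 0 = 0"
  using md_scl_left[of r 0 0 w] md_scl_right[of r a 0 0] by simp_all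

lemma md_minus: "md r a (- w) = - md r a w"
  using md_add_right[of r a w "- w"] by (simp add: eq_neg_iff_add_eq_0 add.commute)

lemma md_diff: "md r a (w - w') = md r a w - md r a w'"
  using md_add_right[of r a w "- w'"] by (simp add: md_minus)

lemma md_diff_left: "md r (a - b) w = md r a w - md r b w"
  using md_add_left[of r "a - b" b w] by simp

text \<open>Borcherds identity with n = 0: the binomial coefficients of 0 leave just j = 0 on the
  side of the iterated modes.\<close>

lemma md_commutator:
  assumes "a \<in> part p" "b \<in> part q" "r - twist p \<in> \<int>" "s - twist q \<in> \<int>"
    and "\<And>j. j \<ge> n \<Longrightarrow> nprod (int j) a b = 0"
  shows "md r a (md s b w) - mscl (koszul p q) (md s b (md r a w))
    = (\<Sum>j<n. mscl (of_rat (r gchoose j)) (md (r + s - of_nat j) (nprod (int j) a b) w))"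
proof -
  have "finsupp_sum (\<lambda>j. mscl (of_rat (r gchoose j)) (md (r + s - of_nat j) (nprod (0 + int j) a b) w))
    = (\<Sum>j<n. mscl (of_rat (r gchoose j)) (md (r + s - of_nat j) (nprod (int j) a b) w))"
    by (subst finsupp_sum_eq[of n]) (simp_all add: assms(5))
  moreover have "finsupp_sum (\<lambda>j. mscl ((-1) ^ j * (of_int 0 gchoose j))
          (md (r + of_int 0 - of_nat j) a (md (s + of_nat j) b w)
           - mscl (koszul p q * int_sign 0)
               (md (of_int 0 + s - of_nat j) b (md (r + of_nat j) a w))))
    = md r a (md s b w) - mscl (koszul p q) (md s b (md r a w))"
    by (subst finsupp_sum_eq[of 1]) (simp_all add: zero_gchoose int_sign_def)
  ultimately show ?thesis
    using md_borcherds[OF assms(1-4), of 0 w] by simp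
qed

text \<open>Borcherds identity with b the vacuum, s = 0 and n = -2. The iterated side vanishes: the
  modes of the vacuum in it have index at least 0 or at most -2, and only index -1 acts
  nontrivially.\<close>

lemma md_deriv:
  assumes "a \<in> part p" "r - twist p \<in> \<int>"
  shows "md r (nprod (-2) a vac) w = mscl (- of_rat r) (md (r - 1) a w)"
proof -
  have "finsupp_sum (\<lambda>j. mscl (of_rat (r gchoose j)) (md (r + 0 - of_nat j) (nprod (-2 + int j) a vac) w))
    = md r (nprod (-2) a vac) w + mscl (of_rat r) (md (r - 1) a w)"
  proof (subst finsupp_sum_eq[of 2])
    show "mscl (of_rat (r gchoose j)) (md (r + 0 - of_nat j) (nprod (-2 + int j) a vac) w) = 0" if "j \<ge> 2" for j
      using that by (simp add: V.vac_right)
  qed (simp add: V.vac_right numeral_2_eq_2)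
  moreover have "finsupp_sum (\<lambda>j. mscl ((-1) ^ j * (of_int (-2) gchoose j))
          (md (r + of_int (-2) - of_nat j) a (md (0 + of_nat j) vac w)
           - mscl (koszul p False * int_sign (-2))
               (md (of_int (-2) + 0 - of_nat j) vac (md (r + of_nat j) a w)))) = 0"
  proof (subst finsupp_sum_eq[of 0])
    fix j
    have "(of_nat j :: rat) \<noteq> -1" "of_int (-2) - of_nat j \<noteq> (-1 :: rat)"
      by (metis of_nat_0_le_iff not_one_le_zero neg_0_le_iff_le, use of_nat_0_le_iff[of j, where 'a
        = rat] in linarith)
    then show "mscl ((-1) ^ j * (of_int (-2) gchoose j))
          (md (r + of_int (-2) - of_nat j) a (md (0 + of_nat j) vac w)
           - mscl (koszul p False * int_sign (-2))
               (md (of_int (-2) + 0 - of_nat j) vac (md (r + of_nat j) a w))) = 0"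
      by (simp add: md_vac)
  qed simp
  moreover have "0 - twist False \<in> \<int>" by (simp add: twist_def)
  ultimately have "md r (nprod (-2) a vac) w + mscl (of_rat r) (md (r - 1) a w) = 0"
    using md_borcherds[OF assms(1) V.vac_even assms(2), of 0 "-2" w] by simp
  then show ?thesis by (simp add: eq_neg_iff_add_eq_0)
qed

end

definition trip :: "mat4 \<Rightarrow> mat4 \<Rightarrow> mat4 \<Rightarrow> mat4" where
  "trip u v w = br (bil u v) w"

lemma bil_in_g_nat: "u \<in> g_mhalf \<Longrightarrow> v \<in> g_mhalf \<Longrightarrow> bil u v \<in> g_nat"
  by (elim g_mhalf_cases) (simp add: bil_mh nt_in_g_nat)

lemma br_nat_mhalf: "a \<in> g_nat \<Longrightarrow> u \<in> g_mhalf \<Longrightarrow> br a u \<in> g_mhalf"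
  by (elim g_mhalf_cases g_nat_cases) (simp add: br_nt_mh mh_in_g_mhalf)

section \<open>Commutators of the modes of L, J and G\<close>

context ramond_W_module
begin

lemma half_twist: "of_int n + 1/2 - twist True \<in> \<int>" "of_int n - twist False \<in> \<int>"
  "of_int n + 1 - twist False \<in> \<int>"
  by (simp_all add: twist_def)

lemma modes_add:
  "G_mode u n (w + w') = G_mode u n w + G_mode u n w'"
  "J_mode a n (w + w') = J_mode a n w + J_mode a n w'"
  "L_mode n (w + w') = L_mode n w + L_mode n w'"
  by (simp_all add: G_mode_def J_mode_def L_mode_def md_add_right)

lemma modes_scl:
  "G_mode u n (mscl t w) = mscl t (G_mode u n w)"
  "J_mode a n (mscl t w) = mscl t (J_mode a n w)"
  "L_mode n (mscl t w) = mscl t (L_mode n w)"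
  by (simp_all add: G_mode_def J_mode_def L_mode_def md_scl_right)

lemma modes_zero [simp]: "G_mode u n 0 = 0" "J_mode a n 0 = 0" "L_mode n 0 = 0"
  by (simp_all add: G_mode_def J_mode_def L_mode_def)

lemma modes_diff:
  "G_mode u n (w - w') = G_mode u n w - G_mode u n w'"
  "J_mode a n (w - w') = J_mode a n w - J_mode a n w'"
  "L_mode n (w - w') = L_mode n w - L_mode n w'"
  by (simp_all add: G_mode_def J_mode_def L_mode_def md_diff)

lemma G_mode_linear:
  "u \<in> g_mhalf \<Longrightarrow> v \<in> g_mhalf \<Longrightarrow> G_mode (u + v) n w
    = G_mode u n w + G_mode v n w"
  "u \<in> g_mhalf \<Longrightarrow> G_mode (cmul t u) n w = mscl t (G_mode u n w)"
  by (simp_all add: G_mode_def G_linear md_add_left md_scl_left)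

lemma J_mode_linear:
  "a \<in> g_nat \<Longrightarrow> b \<in> g_nat \<Longrightarrow> J_mode (a + b) n w = J_mode a n w + J_mode b n w"
  "a \<in> g_nat \<Longrightarrow> J_mode (cmul t a) n w = mscl t (J_mode a n w)"
  by (simp_all add: J_mode_def J_linear md_add_left md_scl_left)

lemma J_G_commute:
  assumes "a \<in> g_nat" "u \<in> g_mhalf"
  shows "J_mode a m (G_mode u n w) = G_mode u n (J_mode a m w) + G_mode (br a u) (m + n) w"
proof -
  note n = bracket_nprod[OF JG[OF assms]]
  have "md (of_int m) (J a) (md (of_int n + 1/2) (G u) w)
      - mscl (koszul False True) (md (of_int n + 1/2) (G u) (md (of_int m) (J a) w))
    = (\<Sum>j<1. mscl (of_rat (of_int m gchoose j)) (md (of_int m + (of_int n + 1/2)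
      - of_nat j) (nprod (int j) (J a) (G u)) w))"
    by (rule md_commutator) (use assms J_even G_odd half_twist n in auto)
  then show ?thesis using n[of 0]
    by (simp add: J_mode_def G_mode_def koszul_def algebra_simps)
qed

lemma L_G_commute:
  assumes "u \<in> g_mhalf"
  shows "L_mode m (G_mode u n w) = G_mode u n (L_mode m w) + mscl (of_int m / 2 - of_int n) (G_mode u (m + n) w)"
proof -
  note n = bracket_nprod[OF LG[OF assms]]
  let ?r = "of_int m + 1 :: rat" and ?s = "of_int n + 1/2 :: rat"
  have "md ?r L (md ?s (G u) w) - mscl (koszul False True) (md ?s (G u) (md ?r L w))
    = (\<Sum>j<2. mscl (of_rat (?r gchoose j)) (md (?r + ?s - of_nat j) (nprod (int j) L (G u)) w))"
    by (rule md_commutator) (use assms L_even G_odd half_twist n in auto)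
  also have "\<dots> = md (?r + ?s) (deriv_T (G u)) w + mscl (of_rat ?r * (3/2)) (md (?r + ?s - 1) (G u) w)"
    using n[of 0] n[of 1] by (simp add: numeral_2_eq_2 md_scl_left)
  also have "md (?r + ?s) (deriv_T (G u)) w = mscl (- of_rat (?r + ?s)) (md (?r + ?s - 1) (G u) w)"
    unfolding deriv_T_def
    by (rule md_deriv[OF G_odd[OF assms]]) (simp add: twist_def)
  also have "mscl (- of_rat (?r + ?s)) (md (?r + ?s - 1) (G u) w) + mscl (of_rat ?r * (3/2))
    (md (?r + ?s - 1) (G u) w)
     = mscl (of_int m / 2 - of_int n) (md (?r + ?s - 1) (G u) w)"
  proof -
    have "- of_rat (?r + ?s) + of_rat ?r * (3/2) = (of_int m / 2 - of_int n :: complex)"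
      by (simp only: of_rat_add of_rat_divide of_rat_of_int_eq of_rat_1 of_rat_numeral_eq) (simp add: field_simps)
    then show ?thesis by (metis M.scale_left_distrib)
  qed
  finally show ?thesis
    by (simp add: L_mode_def G_mode_def koszul_def algebra_simps)
qed

text \<open>The derivative contributes -2k(p + q + 1) and the linear term 4k(p + 1/2) to the
  coefficient of J, in total 2k(p - q). The quadratic term carries the binomial coefficient (p +
  1/2)(p - 1/2)/2, hence p^2 - 1/4.\<close>

lemma G_G_anticommute:
  assumes "u \<in> g_mhalf" "v \<in> g_mhalf"
  shows "G_mode u p (G_mode v q w) + G_mode v q (G_mode u p w)
    = mscl (- 2 * k * ang u v) (L_mode (p + q) w)
    + mscl (2 * k * of_int (p - q)) (J_mode (bil u v) (p + q) w)
    + (if p + q = 0 then mscl (2 * k * (k + 1) * ((of_int p)\<^sup>2 - 1/4) * ang u v) w else 0)"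
proof -
  note n = bracket_nprod[OF GG_brackets[OF assms]]
  let ?r = "of_int p + 1/2 :: rat" and ?s = "of_int q + 1/2 :: rat"
  have "md ?r (G u) (md ?s (G v) w) - mscl (koszul True True) (md ?s (G v) (md ?r (G u) w))
    = (\<Sum>j<3. mscl (of_rat (?r gchoose j)) (md (?r + ?s - of_nat j) (nprod (int j) (G u) (G v)) w))"
    by (rule md_commutator) (use assms G_odd half_twist n in auto)
  also have "\<dots> = mscl (- 2 * k * ang u v) (md (?r + ?s) L w)
      + mscl (2 * k) (md (?r + ?s) (deriv_T (J (bil u v))) w)
      + mscl (of_rat ?r * (4 * k)) (md (?r + ?s - 1) (J (bil u v)) w)
      + mscl (of_rat (?r gchoose 2) * (4 * ang u v * (k * (k + 1)))) (md (?r + ?s - 2) vac w)"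
    using n[of 0] n[of 1] n[of 2]
    by (simp add: sum_3 md_scl_left md_add_left md_diff_left mult.assoc)
  also have "md (?r + ?s) (deriv_T (J (bil u v))) w = mscl (- of_rat (?r + ?s)) (md (?r + ?s - 1) (J (bil u v)) w)"
    unfolding deriv_T_def
    by (rule md_deriv[OF J_even[OF bil_in_g_nat[OF assms]]]) (simp add: twist_def)
  also have "?r + ?s - 1 = of_int (p + q)" by simp
  also have "?r + ?s = of_int (p + q) + 1" by simp
  also have "mscl (- 2 * k * ang u v) (md (of_int (p + q) + 1) L w)
      + mscl (2 * k) (mscl (- of_rat (of_int (p + q) + 1)) (md (of_int (p + q)) (J (bil u v)) w))
      + mscl (of_rat ?r * (4 * k)) (md (of_int (p + q)) (J (bil u v)) w)
    = mscl (- 2 * k * ang u v) (L_mode (p + q) w)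
      + mscl (2 * k * of_int (p - q)) (J_mode (bil u v) (p + q) w)"
  proof -
    have "2 * k * - of_rat (of_int (p + q) + 1) + of_rat ?r * (4 * k) = 2 * k * of_int (p - q)"
      by (simp only: of_rat_add of_rat_divide of_rat_of_int_eq of_rat_1 of_rat_numeral_eq) (simp add: algebra_simps)
    then have "mscl (2 * k) (mscl (- of_rat (of_int (p + q) + 1)) y) + mscl (of_rat ?r * (4 * k)) y
      = mscl (2 * k * of_int (p - q)) y" for y
      by (simp only: M.scale_scale M.scale_left_distrib[symmetric])
    then show ?thesis by (simp only: L_mode_def J_mode_def add.assoc)
  qed
  also have "mscl (of_rat (?r gchoose 2) * (4 * ang u v * (k * (k + 1)))) (md (of_int (p + q) + 1 - 2) vac w)
    = (if p + q = 0 then mscl (2 * k * (k + 1) * ((of_int p)\<^sup>2 - 1/4) * ang u v) w else 0)"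
  proof -
    have "of_int (p + q) + 1 - 2 = (-1 :: rat) \<longleftrightarrow> p + q = 0"
    proof -
      have "of_int (p + q) + 1 - 2 = (-1 :: rat) \<longleftrightarrow> of_int (p + q) = (0 :: rat)"
        by (rule iffI) linarith+
      then show ?thesis by (simp only: of_int_eq_0_iff)
    qed
    moreover have ch: "of_rat (?r gchoose 2) = (((of_int p)\<^sup>2 - 1/4) / 2 :: complex)"
      by (simp add: gbinomial_prod_rev numeral_2_eq_2 of_rat_mult of_rat_divide of_rat_add of_rat_diff
          power2_eq_square field_simps)
    moreover have "of_rat (?r gchoose 2) * (4 * ang u v * (k * (k + 1)))
        = 2 * k * (k + 1) * ((of_int p)\<^sup>2 - 1/4) * ang u v"
      unfolding ch by simp
    ultimately show ?thesis by (simp only: md_vac) simp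
  qed
  finally show ?thesis by (simp add: G_mode_def koszul_def)
qed

text \<open>Commuting L- and J-modes with a third supercurrent gives G-modes again, and the central
  term drops out. This consequence mentions G only and can be compared with operators on the Fock
  space.\<close>

lemma G_triple:
  assumes "u \<in> g_mhalf" "v \<in> g_mhalf" "x \<in> g_mhalf"
  shows "G_mode u p (G_mode v q (G_mode x r w)) + G_mode v q (G_mode u p (G_mode x r w))
    = G_mode x r (G_mode u p (G_mode v q w) + G_mode v q (G_mode u p w))
    + mscl (- k * ang u v * of_int (p + q - 2 * r)) (G_mode x (p + q + r) w)
    + mscl (2 * k * of_int (p - q)) (G_mode (trip u v x) (p + q + r) w)"
proof -
  define A B C where "A = - 2 * k * ang u v" and "B = 2 * k * of_int (p - q)"
    and "C = (if p + q = 0 then 2 * k * (k + 1) * ((of_int p)\<^sup>2 - 1/4) * ang u v else 0)"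
  have E: "G_mode u p (G_mode v q w) + G_mode v q (G_mode u p w)
    = mscl A (L_mode (p + q) w) + mscl B (J_mode (bil u v) (p + q) w) + mscl C w" for w
    unfolding G_G_anticommute[OF assms(1,2)] A_def B_def C_def by simp
  have A: "mscl A (mscl (of_int (p + q) / 2 - of_int r) y) = mscl (- k * ang u v * of_int (p + q - 2 * r)) y" for y
  proof -
    have "A * (of_int (p + q) / 2 - of_int r) = - k * ang u v * of_int (p + q - 2 * r)"
      by (simp add: A_def algebra_simps)
    then show ?thesis by (simp only: M.scale_scale)
  qed
  show ?thesis
    unfolding E L_G_commute[OF assms(3)] J_G_commute[OF bil_in_g_nat[OF assms(1,2)] assms(3)]
      modes_add modes_scl M.scale_right_distrib A trip_def B_def[symmetric]
    by (simp add: add_ac)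
qed

end

section \<open>A real orthonormal basis of the odd space\<close>

lemma cmul_simps:
  "cmul s (cmul t A) = cmul (s * t) A" "cmul 1 A = A" "cmul 0 A = 0" "cmul t 0 = 0"
  "cmul t (A + B) = cmul t A + cmul t B" "cmul (s + t) A = cmul s A + cmul t A"
  "- A = cmul (-1) A"
  by (simp_all add: cmul_def vec_eq_iff algebra_simps)

lemma g_mhalf_closed:
  "u \<in> g_mhalf \<Longrightarrow> v \<in> g_mhalf \<Longrightarrow> u + v \<in> g_mhalf" "u \<in>
    g_mhalf \<Longrightarrow> cmul t u \<in> g_mhalf"
  by (elim g_mhalf_cases; simp add: mh_add cmul_mh mh_in_g_mhalf)+

lemma g_nat_closed:
  "a \<in> g_nat \<Longrightarrow> b \<in> g_nat \<Longrightarrow> a + b \<in> g_nat" "a \<in> g_nat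
    \<Longrightarrow> cmul t a \<in> g_nat"
  by (elim g_nat_cases; simp add: nt_add cmul_nt nt_in_g_nat)+

section \<open>Identities of the form \<open>ang\<close>, the current \<open>bil\<close> and the
  triple product \<open>trip\<close>\<close>

lemma ang_sym: "u \<in> g_mhalf \<Longrightarrow> v \<in> g_mhalf \<Longrightarrow> ang u v = ang v u"
  by (elim g_mhalf_cases) (simp add: ang_mh)

lemma ang_cmul:
  assumes "u \<in> g_mhalf" "v \<in> g_mhalf"
  shows "ang u (cmul t v) = t * ang u v" "ang (cmul t v) u = t * ang v u"
proof -
  obtain a b c d where u: "u = mh a b c d" by (rule g_mhalf_cases[OF assms(1)])
  obtain a' b' c' d' where v: "v = mh a' b' c' d'" by (rule g_mhalf_cases[OF assms(2)])
  show "ang u (cmul t v) = t * ang u v" "ang (cmul t v) u = t * ang v u"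
    by (simp_all add: u v cmul_mh ang_mh algebra_simps)
qed

lemma ang_add:
  assumes "u \<in> g_mhalf" "v \<in> g_mhalf" "w \<in> g_mhalf"
  shows "ang u (v + w) = ang u v + ang u w" "ang (v + w) u = ang v u + ang w u"
proof -
  obtain a b c d where u: "u = mh a b c d" by (rule g_mhalf_cases[OF assms(1)])
  obtain a' b' c' d' where v: "v = mh a' b' c' d'" by (rule g_mhalf_cases[OF assms(2)])
  obtain x y z t where w: "w = mh x y z t" by (rule g_mhalf_cases[OF assms(3)])
  show "ang u (v + w) = ang u v + ang u w" "ang (v + w) u = ang v u + ang w u"
    by (simp_all add: u v w mh_add ang_mh algebra_simps)
qed

lemma nt_inject: "nt p q r = nt p' q' r' \<longleftrightarrow> p = p' \<and> q = q' \<and> r = r'"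
proof
  assume "nt p q r = nt p' q' r'"
  then have "nt p q r $ i $ j = nt p' q' r' $ i $ j" for i j by simp
  from this[of 3 4] this[of 3 3] this[of 4 3] show "p = p' \<and> q = q' \<and> r = r'" by (simp add: nt_nth)
qed simp

lemma bil_cmul:
  assumes "u \<in> g_mhalf" "v \<in> g_mhalf"
  shows "bil u (cmul t v) = cmul t (bil u v)" "bil (cmul t v) u = cmul t (bil v u)"
proof -
  obtain a b c d where u: "u = mh a b c d" by (rule g_mhalf_cases[OF assms(1)])
  obtain a' b' c' d' where v: "v = mh a' b' c' d'" by (rule g_mhalf_cases[OF assms(2)])
  show "bil u (cmul t v) = cmul t (bil u v)" "bil (cmul t v) u = cmul t (bil v u)"
    by (simp_all add: u v cmul_mh bil_mh cmul_nt nt_inject algebra_simps)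
qed

lemma bil_add:
  assumes "u \<in> g_mhalf" "v \<in> g_mhalf" "w \<in> g_mhalf"
  shows "bil u (v + w) = bil u v + bil u w" "bil (v + w) u = bil v u + bil w u"
proof -
  obtain a b c d where u: "u = mh a b c d" by (rule g_mhalf_cases[OF assms(1)])
  obtain a' b' c' d' where v: "v = mh a' b' c' d'" by (rule g_mhalf_cases[OF assms(2)])
  obtain x y z t where w: "w = mh x y z t" by (rule g_mhalf_cases[OF assms(3)])
  show "bil u (v + w) = bil u v + bil u w" "bil (v + w) u = bil v u + bil w u"
    by (simp_all add: u v w mh_add bil_mh nt_add nt_inject add_divide_distrib diff_divide_distrib algebra_simps)
qed

lemma trip_in_g_mhalf: "u \<in> g_mhalf \<Longrightarrow> v \<in> g_mhalf \<Longrightarrow> w \<in>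
  g_mhalf \<Longrightarrow> trip u v w \<in> g_mhalf"
  by (simp add: trip_def br_nat_mhalf bil_in_g_nat)

lemma br_nat_mhalf_cmul:
  assumes "a \<in> g_nat" "u \<in> g_mhalf"
  shows "br (cmul t a) u = cmul t (br a u)" "br a (cmul t u) = cmul t (br a u)"
proof -
  obtain a' b' c' d' where u: "u = mh a' b' c' d'" by (rule g_mhalf_cases[OF assms(2)])
  obtain p q r where a: "a = nt p q r" by (rule g_nat_cases[OF assms(1)])
  show "br (cmul t a) u = cmul t (br a u)" "br a (cmul t u) = cmul t (br a u)"
    by (simp_all add: u a cmul_mh br_nt_mh cmul_nt mh_inject algebra_simps)
qed

lemma br_nat_mhalf_add:
  assumes "a \<in> g_nat" "b \<in> g_nat" "u \<in> g_mhalf"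
  shows "br (a + b) u = br a u + br b u"
proof -
  obtain a' b' c' d' where u: "u = mh a' b' c' d'" by (rule g_mhalf_cases[OF assms(3)])
  obtain p q r where a: "a = nt p q r" by (rule g_nat_cases[OF assms(1)])
  obtain p' q' r' where b: "b = nt p' q' r'" by (rule g_nat_cases[OF assms(2)])
  show ?thesis
    by (simp_all add: u a b mh_add br_nt_mh nt_add mh_inject algebra_simps)
qed

lemma br_nat_mhalf_add':
  assumes "a \<in> g_nat" "u \<in> g_mhalf" "v \<in> g_mhalf"
  shows "br a (u + v) = br a u + br a v"
proof -
  obtain a' b' c' d' where u: "u = mh a' b' c' d'" by (rule g_mhalf_cases[OF assms(2)])
  obtain x y z t where v: "v = mh x y z t" by (rule g_mhalf_cases[OF assms(3)])
  obtain p q r where a: "a = nt p q r" by (rule g_nat_cases[OF assms(1)])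
  show ?thesis
    by (simp_all add: u a v mh_add br_nt_mh nt_add mh_inject algebra_simps)
qed

lemma trip_cmul:
  assumes "u \<in> g_mhalf" "w \<in> g_mhalf" "z \<in> g_mhalf"
  shows "trip (cmul t u) w z = cmul t (trip u w z)" "trip w (cmul t u) z = cmul t (trip w u z)"
    "trip w z (cmul t u) = cmul t (trip w z u)"
  using assms by (simp_all add: trip_def bil_cmul br_nat_mhalf_cmul bil_in_g_nat)

lemma trip_add:
  assumes "u \<in> g_mhalf" "v \<in> g_mhalf" "w \<in> g_mhalf" "z \<in> g_mhalf"
  shows "trip (u + v) w z = trip u w z + trip v w z" "trip w (u + v) z = trip w u z + trip w v z"
    "trip w z (u + v) = trip w z u + trip w z v"
  using assms by (simp_all add: trip_def bil_add br_nat_mhalf_add br_nat_mhalf_add' bil_in_g_nat)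

lemma trip_mh: "trip (mh a b c d) (mh a' b' c' d') (mh x y z t) =
  (let p = b * c' - c * b'; q = (a * c' - b * d' - c * a' + d * b') / 2; r = a * d' - d * a'
   in mh (- (x * q + y * r)) (y * q - x * p) (p * t + q * z) (r * z - q * t))"
  by (simp add: trip_def bil_mh br_nt_mh Let_def)

lemma trip_swap12:
  assumes "u \<in> g_mhalf" "v \<in> g_mhalf" "w \<in> g_mhalf"
  shows "trip v u w = cmul (-1) (trip u v w)"
  using assms by (elim g_mhalf_cases) (simp add: trip_mh Let_def cmul_mh mh_inject field_simps)

text \<open>On pairwise orthogonal vectors the right side vanishes, so that with
  \<open>trip_swap12\<close> the triple product is totally antisymmetric there.\<close>

lemma trip_sym23:
  assumes "u \<in> g_mhalf" "v \<in> g_mhalf" "w \<in> g_mhalf"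
  shows "trip u v w + trip u w v
    = cmul (- ang v w) u + cmul (ang u w / 2) v + cmul (ang u v / 2) w"
  using assms by (elim g_mhalf_cases)
    (simp add: trip_mh Let_def cmul_mh mh_add ang_mh mh_inject field_simps)

lemma ang_trip:
  assumes "u \<in> g_mhalf" "v \<in> g_mhalf" "w \<in> g_mhalf" "z \<in> g_mhalf"
  shows "ang (trip u v w) z = - ang w (trip u v z)"
  using assms by (elim g_mhalf_cases) (simp add: trip_mh Let_def ang_mh field_simps)

text \<open>On each doublet \<open>bil u v\<close> acts as a traceless 2 by 2 matrix, whose square
  is a scalar; the scalar is minus a quarter of the Gram determinant of u and v.\<close>

lemma trip_trip:
  assumes "u \<in> g_mhalf" "v \<in> g_mhalf" "w \<in> g_mhalf"
  shows "trip u v (trip u v w) = cmul (- (ang u u * ang v v - (ang u v)\<^sup>2) / 4) w"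
  using assms by (elim g_mhalf_cases)
    (simp add: trip_mh Let_def cmul_mh ang_mh mh_inject power2_eq_square field_simps)

section \<open>The real structure on the odd space\<close>

locale adapted_involution =
  fixes \<phi> :: "mat4 \<Rightarrow> mat4"
  assumes ac: "almost_compact \<phi>" and pos: "positive_on_g_mhalf \<phi>"
begin

lemma phi_facts:
  "a \<in> psl22 \<Longrightarrow> b \<in> psl22 \<Longrightarrow> \<phi> (a + b) = \<phi> a + \<phi> b"
  "a \<in> psl22 \<Longrightarrow> \<phi> (cmul c a) = cmul (cnj c) (\<phi> a)"
  "a \<in> psl22 \<Longrightarrow> b \<in> psl22 \<Longrightarrow> \<phi> (br a b) = br (\<phi> a) (\<phi> b)"
  "a \<in> psl22 \<Longrightarrow> \<phi> (\<phi> a) = a"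
  "\<phi> e_s = e_s" "\<phi> x_s = x_s" "\<phi> f_s = f_s"
  using ac by (simp_all add: almost_compact_def conj_linear_involution_def)

lemma in_psl22: "u \<in> g_mhalf \<Longrightarrow> u \<in> psl22" "a \<in> g_nat \<Longrightarrow> a \<in>
  psl22" "0 \<in> psl22"
  "e_s \<in> psl22" "x_s \<in> psl22" "f_s \<in> psl22"
  by (auto simp: ad_x_space_def g_nat_def psl22_def s_nth)

lemma phi_psl22: "a \<in> psl22 \<Longrightarrow> \<phi> a \<in> psl22"
proof -
  assume a: "a \<in> psl22"
  have "a = even_comp a + odd_comp a" by (simp add: even_comp_def odd_comp_def vec_eq_iff)
  moreover have e: "even_comp a \<in> psl_part False" and o: "odd_comp a \<in> psl_part True"
    using a by (auto simp: psl_part_def psl22_def even_comp_def odd_comp_def vec_eq_iff)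
  moreover have "x \<in> psl_part p \<Longrightarrow> \<phi> x \<in> psl_part p" for x p
    using ac by (simp add: almost_compact_def conj_linear_involution_def)
  from this[OF e] this[OF o] have "\<phi> (even_comp a) \<in> psl22" "\<phi> (odd_comp a) \<in> psl22"
    by (simp_all add: psl_part_def)
  moreover have "\<phi> (even_comp a + odd_comp a) = \<phi> (even_comp a) + \<phi> (odd_comp a)"
    using e o by (intro phi_facts(1)) (simp_all add: psl_part_def)
  ultimately have "\<phi> a = \<phi> (even_comp a) + \<phi> (odd_comp a)" "\<phi> (even_comp a) \<in>
    psl22" "\<phi> (odd_comp a) \<in> psl22"
    by simp_all
  then show ?thesis by (auto simp: psl22_def algebra_simps)
qed

lemma phi_zero: "\<phi> 0 = 0"
  using phi_facts(2)[of 0 0] by (simp add: in_psl22 cmul_simps)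

lemma phi_g_mhalf: assumes "u \<in> g_mhalf" shows "\<phi> u \<in> g_mhalf"
proof -
  have "br x_s (\<phi> u) = \<phi> (br x_s u)" using phi_facts assms by (simp add: in_psl22)
  also have "br x_s u = cmul (- (1/2)) u" using assms by (simp add: ad_x_space_def)
  also have "\<phi> \<dots> = cmul (- (1/2)) (\<phi> u)" using phi_facts(2)[of u] assms by (simp add: in_psl22)
  finally show ?thesis using phi_psl22 assms by (simp add: ad_x_space_def)
qed

lemma phi_g_nat: assumes "a \<in> g_nat" shows "\<phi> a \<in> g_nat"
proof -
  have "br s (\<phi> a) = 0" if "s \<in> psl22" "\<phi> s = s" "br s a = 0" for s
    using phi_facts(3)[of s a] that assms by (simp add: in_psl22 phi_zero)
  moreover have "br e_s a = 0" "br x_s a = 0" "br f_s a = 0" using assms by (simp_all add: g_nat_def)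
  ultimately have "br e_s (\<phi> a) = 0" "br x_s (\<phi> a) = 0" "br f_s (\<phi> a) = 0"
    using phi_facts(5-7) in_psl22(4-6) by blast+
  moreover have "\<phi> a \<in> psl22" using phi_psl22 in_psl22(2) assms by blast
  ultimately show ?thesis by (simp add: g_nat_def)
qed

text \<open>The bracket of u and v is a multiple of f with coefficient 2 \<open>ang u v\<close>;
  since \<phi> fixes f and is conjugate-linear, the coefficient is conjugated.\<close>

lemma ang_phi:
  assumes "u \<in> g_mhalf" "v \<in> g_mhalf"
  shows "ang (\<phi> u) (\<phi> v) = cnj (ang u v)"
proof -
  have brf: "br x y = cmul (2 * ang x y) f_s" if "x \<in> g_mhalf" "y \<in> g_mhalf" for x y
    using that by (elim g_mhalf_cases) (simp add: br_mh_mh)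
  have "cmul (2 * ang (\<phi> u) (\<phi> v)) f_s = \<phi> (br u v)"
    using brf[of "\<phi> u" "\<phi> v"] phi_facts(3)[of u v] assms phi_g_mhalf by (simp add: in_psl22)
  also have "\<dots> = cmul (cnj (2 * ang u v)) f_s"
    using brf[OF assms] phi_facts by (simp add: in_psl22)
  finally have "cmul (2 * ang (\<phi> u) (\<phi> v)) f_s $ 2 $ 1 = cmul (cnj (2 * ang u v)) f_s $ 2 $ 1" by simp
  then show ?thesis by (simp add: cmul_def s_nth)
qed

text \<open>The bracket of [e, u] with v is \<open>bil u v\<close> plus \<open>ang u v\<close> times
  x. As \<phi> fixes e and x, the x-parts agree by \<open>ang_phi\<close> and can be
  cancelled.\<close>

lemma bil_phi:
  assumes "u \<in> g_mhalf" "v \<in> g_mhalf"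
  shows "bil (\<phi> u) (\<phi> v) = \<phi> (bil u v)"
proof -
  have b: "br (br e_s x) y = bil x y + cmul (ang x y) x_s" if "x \<in> g_mhalf" "y \<in> g_mhalf" for x y
    using that by (elim g_mhalf_cases) (simp add: br_mg_mh bil_mh)
  have p: "br e_s u \<in> psl22" using assms(1)
    by (elim g_mhalf_cases) (simp add: br_e_mh psl22_def mg_nth)
  have "bil (\<phi> u) (\<phi> v) + cmul (ang (\<phi> u) (\<phi> v)) x_s = \<phi> (br (br e_s u) v)"
    using b[of "\<phi> u" "\<phi> v"] phi_facts(3)[OF p, of v] phi_facts(3)[of e_s u] phi_facts(5) assms phi_g_mhalf
    by (simp add: in_psl22)
  also have "\<dots> = \<phi> (bil u v) + cmul (cnj (ang u v)) x_s"
  proof -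
    have "cmul (ang u v) x_s \<in> psl22" by (simp add: psl22_def cmul_def s_nth)
    then show ?thesis
      using b[OF assms] phi_facts bil_in_g_nat[OF assms] by (simp add: in_psl22)
  qed
  finally show ?thesis using ang_phi[OF assms] by simp
qed

lemma trip_phi:
  assumes "u \<in> g_mhalf" "v \<in> g_mhalf" "w \<in> g_mhalf"
  shows "trip (\<phi> u) (\<phi> v) (\<phi> w) = \<phi> (trip u v w)"
  using bil_phi[OF assms(1,2)] phi_facts(3)[of "bil u v" w] bil_in_g_nat assms
  by (simp add: trip_def in_psl22)

definition unit_set :: "mat4 set \<Rightarrow> bool" where
  "unit_set U \<longleftrightarrow> (\<forall>u\<in>U. u \<in> g_mhalf \<and> \<phi> u = u \<and> ang u u = 1)"

text \<open>The vectors w + \<phi>(w) and \<i>(w - \<phi>(w)) are fixed by \<phi> and do not both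
  vanish. On a fixed vector \<open>ang\<close> is real, and positive by
  \<open>positive_on_g_mhalf\<close>, so it can be normalized.\<close>

lemma ex_unit_orthogonal:
  assumes U: "unit_set U" and w: "w \<in> g_mhalf" "w \<noteq> 0" "\<forall>u\<in>U. ang u w = 0"
  shows "\<exists>x. unit_set {x} \<and> (\<forall>u\<in>U. ang u x = 0)"
proof -
  have pw: "\<phi> w \<in> g_mhalf" and ppw: "\<phi> (\<phi> w) = w"
    using phi_g_mhalf phi_facts(4) w in_psl22 by auto
  have orth: "\<forall>u\<in>U. ang u (\<phi> w) = 0"
    using ang_phi[of _ w] U w by (force simp: unit_set_def)
  define x where "x t = cmul t w + cmul (cnj t) (\<phi> w)" for t
  have x: "x t \<in> g_mhalf" "\<phi> (x t) = x t" "\<forall>u\<in>U. ang u (x t) = 0" for t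
  proof -
    show "x t \<in> g_mhalf" using w pw by (simp add: x_def g_mhalf_closed)
    have "\<phi> (x t) = \<phi> (cmul t w) + \<phi> (cmul (cnj t) (\<phi> w))"
      unfolding x_def using w pw by (intro phi_facts) (auto intro: in_psl22 g_mhalf_closed)
    also have "\<dots> = x t"
      using w pw ppw phi_facts(2)[of w] phi_facts(2)[of "\<phi> w"] by (simp add: x_def in_psl22 add.commute)
    finally show "\<phi> (x t) = x t" .
    show "\<forall>u\<in>U. ang u (x t) = 0"
      using U orth w pw by (auto simp: x_def ang_add ang_cmul g_mhalf_closed unit_set_def)
  qed
  have "x 1 \<noteq> 0 \<or> x \<i> \<noteq> 0"
  proof (rule ccontr)
    assume "\<not> ?thesis"
    then have "cmul 1 w + cmul 1 (\<phi> w) = 0" "cmul \<i> w + cmul (- \<i>) (\<phi> w) = 0"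
      by (simp_all add: x_def)
    then have "w $ i $ j + \<phi> w $ i $ j = 0" "\<i> * w $ i $ j - \<i> * \<phi> w $ i $ j = 0" for i j
      by (auto simp: cmul_def vec_eq_iff)
    then have "w $ i $ j = 0" for i j
      by (simp add: right_diff_distrib[symmetric])
    then show False using w by (simp add: vec_eq_iff)
  qed
  then obtain t where t: "x t \<noteq> 0" by blast
  have "ang (x t) (x t) = cnj (ang (x t) (x t))" using ang_phi[of "x t" "x t"] x by simp
  then have im: "ang (x t) (x t) = of_real (Re (ang (x t) (x t)))"
    by (simp add: complex_eq_iff)
  have r: "Re (ang (x t) (x t)) > 0" (is "?r > 0")
    using pos x[of t] t by (metis positive_on_g_mhalf_def)
  let ?c = "of_real (1 / sqrt ?r) :: complex"
  have "unit_set {cmul ?c (x t)}"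
  proof -
    have "\<phi> (cmul ?c (x t)) = cmul ?c (x t)" using phi_facts(2)[of "x t"] x by (simp add: in_psl22)
    moreover have "ang (cmul ?c (x t)) (cmul ?c (x t)) = 1"
    proof -
      have "ang (cmul ?c (x t)) (cmul ?c (x t)) = ?c * ?c * of_real ?r"
        using x[of t] im by (simp add: ang_add ang_cmul g_mhalf_closed)
      also have "\<dots> = of_real (1 / sqrt ?r * (1 / sqrt ?r) * ?r)" by (simp only: of_real_mult)
      also have "1 / sqrt ?r * (1 / sqrt ?r) * ?r = 1" using r by simp
      finally show ?thesis by simp
    qed
    ultimately show ?thesis using x by (simp add: unit_set_def g_mhalf_closed)
  qed
  moreover have "\<forall>u\<in>U. ang u (cmul ?c (x t)) = 0"
    using x U by (simp add: ang_add ang_cmul unit_set_def)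
  ultimately show ?thesis by blast
qed

lemma ex_orthonormal_triple:
  "\<exists>u v w. unit_set {u, v, w} \<and> ang u v = 0 \<and> ang u w = 0 \<and> ang v w = 0"
proof -
  obtain u where u: "unit_set {u}"
    using ex_unit_orthogonal[of "{}" "mh 1 0 0 0"] mh_in_g_mhalf mh_inject[of 1 0 0 0 0 0 0 0]
    by (auto simp: unit_set_def mh_zero)
  obtain a b c d where um: "u = mh a b c d"
    using u by (auto simp: unit_set_def elim: g_mhalf_cases)
  have uu: "2 * a * c + 2 * b * d = 1" using u by (simp add: unit_set_def um ang_mh algebra_simps)
  \<comment> \<open>\<open>ang\<close> pairs a with c and b with d, so changing the signs of c and d
    gives a vector orthogonal to u.\<close>
  have "mh a b (- c) (- d) \<noteq> mh 0 0 0 0" using uu by (auto simp: mh_inject)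
  then obtain v where v: "unit_set {v}" "ang u v = 0"
    using ex_unit_orthogonal[OF u, of "mh a b (- c) (- d)"] mh_in_g_mhalf
    by (auto simp: mh_zero um ang_mh)
  then have uv: "unit_set {u, v}" using u by (simp add: unit_set_def)
  obtain a' b' c' d' where vm: "v = mh a' b' c' d'"
    using v by (auto simp: unit_set_def elim: g_mhalf_cases)
  have vv: "2 * a' * c' + 2 * b' * d' = 1" using v by (simp add: unit_set_def vm ang_mh algebra_simps)
  have uv0: "a * c' + b * d' + c * a' + d * b' = 0" using v by (simp add: um vm ang_mh)
  \<comment> \<open>Entries are 2 by 2 minors of the coordinates of u and v. Orthogonality to u and
    v is the vanishing of a 3 by 3 determinant with a repeated row; every minor occurs, so all four
    vectors vanish only if u and v are proportional.\<close>
  let ?W = "{mh (d * b' - b * d') (b * c' - c * b') 0 (c * d' - d * c'),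
     mh (d * a' - a * d') (a * c' - c * a') (c * d' - d * c') 0,
     mh 0 (a * b' - b * a') (b * d' - d * b') (d * a' - a * d'),
     mh (a * b' - b * a') 0 (b * c' - c * b') (c * a' - a * c')}"
  have "\<exists>w\<in>?W. w \<noteq> 0"
  proof (rule ccontr)
    assume "\<not> ?thesis"
    then have z: "a * b' = b * a'" "a * c' = c * a'" "a * d' = d * a'" "b * c' = c * b'" "b * d'
      = d * b'" "c * d' = d * c'"
      by (auto simp: mh_zero[symmetric] mh_inject)
    have "a = 0" "b = 0" "c = 0" "d = 0"
      using z uv0 vv by algebra+
    then show False using uu by simp
  qed
  moreover have "\<forall>w\<in>?W. ang u w = 0 \<and> ang v w = 0 \<and> w \<in> g_mhalf"
    by (auto simp: um vm ang_mh algebra_simps mh_in_g_mhalf)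
  ultimately obtain w where "w \<in> g_mhalf" "w \<noteq> 0" "\<forall>z\<in>{u, v}. ang z w = 0" by blast
  from ex_unit_orthogonal[OF uv this] obtain x where "unit_set {x}" "ang u x = 0" "ang v x = 0" by auto
  then have "unit_set {u, v, x}" using uv by (simp add: unit_set_def)
  then show ?thesis using v \<open>ang u x = 0\<close> \<open>ang v x = 0\<close> by blast
qed

text \<open>Three real orthonormal vectors determine the fourth: t = 2 \<open>trip x y z\<close> has
  norm 1 because the square of \<open>trip x y\<close> on z is -1/4, and t is real because \<phi>
  respects \<open>trip\<close>. Total antisymmetry and these squares force all remaining products.
  Defining t by the triple product, and not just as a fourth orthonormal vector, selects the
  orientation encoded in \<open>qtriple\<close>.\<close>

lemma ex_adapted_basis:
  "\<exists>b. (\<forall>i<4. b i \<in> g_mhalf \<and> \<phi> (b i) = b i)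
    \<and> (\<forall>i<4. \<forall>j<4. ang (b i) (b j) = (if i = j then 1 else 0))
    \<and> (\<forall>i<4. \<forall>j<4. \<forall>l<4. trip (b i) (b j) (b l)
        = (if i = j then 0 else cmul (of_int (qtriple i j l) / 2) (b (qadd (qadd i j) l))))"
proof -
  obtain x y z where "unit_set {x, y, z}" and o: "ang x y = 0" "ang x z = 0" "ang y z = 0"
    using ex_orthonormal_triple by blast
  then have m: "x \<in> g_mhalf" "y \<in> g_mhalf" "z \<in> g_mhalf" and f: "\<phi> x = x" "\<phi> y
    = y" "\<phi> z = z"
    and n: "ang x x = 1" "ang y y = 1" "ang z z = 1"
    by (simp_all add: unit_set_def)
  note o' = o ang_sym[OF m(2,1)] ang_sym[OF m(3,1)] ang_sym[OF m(3,2)]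
  define t where "t = cmul 2 (trip x y z)"
  have tm: "t \<in> g_mhalf" by (simp add: t_def m trip_in_g_mhalf g_mhalf_closed)
  have ft: "\<phi> t = t"
    using trip_phi[OF m] f phi_facts(2)[of "trip x y z" 2] trip_in_g_mhalf[OF m]
    by (simp add: t_def in_psl22)
  have right: "trip u v v = cmul (-1/2) u"
    if "u \<in> g_mhalf" "v \<in> g_mhalf" "ang u v = 0" "ang v v = 1" for u v
  proof -
    have "cmul 2 (trip u v v) = cmul (-1) u"
      using trip_sym23[OF that(1,2,2)] that(3,4) cmul_simps(6)[of 1 1 "trip u v v"] by (simp add: cmul_simps)
    then have "cmul (1/2) (cmul 2 (trip u v v)) = cmul (1/2) (cmul (-1) u)" by simp
    then show ?thesis by (simp add: cmul_simps)
  qed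
  have same: "trip u u v = 0" if "u \<in> g_mhalf" "v \<in> g_mhalf" for u v
  proof -
    have "trip u u v $ i $ j = - trip u u v $ i $ j" for i j
      using trip_swap12[OF that(1,1,2)] by (metis cmul_simps(7) vector_uminus_component)
    then show ?thesis by (simp add: vec_eq_iff)
  qed
  have swap23: "trip u w v = cmul (-1) (trip u v w)"
    if "u \<in> g_mhalf" "v \<in> g_mhalf" "w \<in> g_mhalf" "ang u v = 0" "ang u w = 0" "ang v w = 0" for u v w
    using trip_sym23[OF that(1-3)] that(4-6)
      by (simp add: cmul_simps(3) cmul_simps(7)[symmetric] eq_neg_iff_add_eq_0 add.commute)
  have swap12: "trip v u w = cmul (-1) (trip u v w)"
    if "u \<in> g_mhalf" "v \<in> g_mhalf" "w \<in> g_mhalf" for u v w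
    by (rule trip_swap12[OF that])
  have sq: "trip u v (trip u v w) = cmul (-1/4) w"
    if "u \<in> g_mhalf" "v \<in> g_mhalf" "w \<in> g_mhalf" "ang u v = 0" "ang u u = 1" "ang v v = 1" for u v w
    using trip_trip[OF that(1-3)] that(4-6) by simp
  have xyz: "trip x y z = cmul (1/2) t" by (simp add: t_def cmul_simps)
  have xzy: "trip x z y = cmul (-1/2) t" using swap23[OF m(1,2,3) o] xyz by (simp add: cmul_simps)
  have yxz: "trip y x z = cmul (-1/2) t" using swap12[OF m(1,2,3)] xyz by (simp add: cmul_simps)
  have yzx: "trip y z x = cmul (1/2) t" using swap23[of y x z] m o' yxz by (simp add: cmul_simps)
  have zxy: "trip z x y = cmul (1/2) t" using swap12[of x z y] m xzy by (simp add: cmul_simps)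
  have zyx: "trip z y x = cmul (-1/2) t" using swap12[of y z x] m yzx by (simp add: cmul_simps)
  have t2: "t = cmul (-2) (trip x z y)" "t = cmul 2 (trip y z x)"
    by (simp_all add: xzy yzx cmul_simps)
  have xyt: "trip x y t = cmul (-1/2) z"
    using sq[of x y z] m o' n by (simp add: t_def trip_add trip_cmul trip_in_g_mhalf cmul_simps)
  have xzt: "trip x z t = cmul (1/2) y"
    unfolding t2(1) using sq[of x z y] m o' n by (simp add: trip_add trip_cmul trip_in_g_mhalf cmul_simps)
  have yzt: "trip y z t = cmul (-1/2) x"
    unfolding t2(2) using sq[of y z x] m o' n by (simp add: trip_add trip_cmul trip_in_g_mhalf cmul_simps)
  have at: "ang t w = - 2 * ang z (trip x y w)" if "w \<in> g_mhalf" for w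
    using ang_trip[OF m that] that m by (simp add: t_def ang_add ang_cmul trip_in_g_mhalf)
  have ot: "ang t x = 0" "ang t y = 0" "ang t z = 0" "ang t t = 1"
  proof -
    have "trip x y x = cmul (1/2) y" using swap12[of y x x] right[of y x] m o' n by (simp add: cmul_simps)
    then show "ang t x = 0" using at[OF m(1)] m o' by (simp add: ang_add ang_cmul)
    show "ang t y = 0" using at[OF m(2)] right[of x y] m o' n by (simp add: ang_add ang_cmul)
    have "ang t z = ang z t" using ang_sym[OF tm m(3)] .
    then show "ang t z = 0" using at[OF m(3)] xyz tm m by (simp add: ang_add ang_cmul)
    show "ang t t = 1" using at[OF tm] xyt n m by (simp add: ang_add ang_cmul)
  qed
  note ot' = ot ang_sym[OF m(1) tm] ang_sym[OF m(2) tm] ang_sym[OF m(3) tm]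
  have xty: "trip x t y = cmul (1/2) z" using swap23[of x y t] xyt m tm o' ot' by (simp add: cmul_simps)
  have xtz: "trip x t z = cmul (-1/2) y" using swap23[of x z t] xzt m tm o' ot' by (simp add: cmul_simps)
  have ytz: "trip y t z = cmul (1/2) x" using swap23[of y z t] yzt m tm o' ot' by (simp add: cmul_simps)
  have yxt: "trip y x t = cmul (1/2) z" using swap12[of x y t] xyt m tm by (simp add: cmul_simps)
  have zxt: "trip z x t = cmul (-1/2) y" using swap12[of x z t] xzt m tm by (simp add: cmul_simps)
  have zyt: "trip z y t = cmul (1/2) x" using swap12[of y z t] yzt m tm by (simp add: cmul_simps)
  have ytx: "trip y t x = cmul (-1/2) z" using swap23[of y x t] yxt m tm o' ot' by (simp add: cmul_simps)
  have ztx: "trip z t x = cmul (1/2) y" using swap23[of z x t] zxt m tm o' ot' by (simp add: cmul_simps)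
  have zty: "trip z t y = cmul (-1/2) x" using swap23[of z y t] zyt m tm o' ot' by (simp add: cmul_simps)
  have t1: "trip t x y = cmul (-1/2) z" "trip t x z = cmul (1/2) y" "trip t y z = cmul (-1/2) x"
    "trip t y x = cmul (1/2) z" "trip t z x = cmul (-1/2) y" "trip t z y = cmul (1/2) x"
    using swap12[of x t y] swap12[of x t z] swap12[of y t z] swap12[of y t x] swap12[of z t x] swap12[of z t y]
      xty xtz ytz ytx ztx zty m tm by (simp_all add: cmul_simps)
  define b where "b i = [x, y, z, t] ! i" for i
  have b: "b 0 = x" "b (Suc 0) = y" "b 2 = z" "b 3 = t" by (simp_all add: b_def numeral_2_eq_2 numeral_3_eq_3)
  have all4: "(\<forall>i<4. P i) \<longleftrightarrow> P 0 \<and> P (Suc 0) \<and> P 2 \<and> P 3"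
    for P :: "nat \<Rightarrow> bool"
    by (simp add: ball_4)
  have left: "trip u v u = cmul (1/2) v"
    if "u \<in> g_mhalf" "v \<in> g_mhalf" "ang v u = 0" "ang u u = 1" for u v
    using swap12[OF that(2,1,1)] right[OF that(2,1,3,4)] by (simp add: cmul_simps)
  note lr = right[OF m(1,2)] right[OF m(1,3)] right[OF m(2,1)] right[OF m(2,3)] right[OF m(3,1)] right[OF m(3,2)]
    right[OF m(1) tm] right[OF m(2) tm] right[OF m(3) tm] right[OF tm m(1)] right[OF tm m(2)] right[OF tm m(3)]
    left[OF m(1,2)] left[OF m(1,3)] left[OF m(2,1)] left[OF m(2,3)] left[OF m(3,1)] left[OF m(3,2)]
    left[OF m(1) tm] left[OF m(2) tm] left[OF m(3) tm] left[OF tm m(1)] left[OF tm m(2)] left[OF tm m(3)]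
  show ?thesis
  proof (intro exI[of _ b] conjI)
    show "\<forall>i<4. b i \<in> g_mhalf \<and> \<phi> (b i) = b i" unfolding all4 b using m tm f ft by simp
    show "\<forall>i<4. \<forall>j<4. ang (b i) (b j) = (if i = j then 1 else 0)"
      unfolding all4 b using o' n ot' by simp
    show "\<forall>i<4. \<forall>j<4. \<forall>l<4. trip (b i) (b j) (b l)
        = (if i = j then 0 else cmul (of_int (qtriple i j l) / 2) (b (qadd (qadd i j) l)))"
      unfolding all4 b
      by (simp add: same m tm lr o' n ot' xyz xzy yxz yzx zxy zyx xyt xzt yzt xty xtz ytz yxt zxt zyt
          ytx ztx zty t1 qtriple_def qadd_def numeral_2_eq_2[symmetric] numeral_3_eq_3[symmetric] b)
  qed
qed

end

locale adapted_basis = adapted_involution +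
  fixes k :: int and b :: "nat \<Rightarrow> mat4"
  assumes k_le: "k \<le> -2"
    and b_mem: "i < 4 \<Longrightarrow> b i \<in> g_mhalf" and b_fixed: "i < 4 \<Longrightarrow> \<phi> (b i) = b i"
    and b_orthonormal: "i < 4 \<Longrightarrow> j < 4 \<Longrightarrow> ang (b i) (b j) = (if i = j then 1 else 0)"
    and b_trip: "i < 4 \<Longrightarrow> j < 4 \<Longrightarrow> l < 4 \<Longrightarrow> trip (b i) (b j) (b l)
        = (if i = j then 0 else cmul (of_int (qtriple i j l) / 2) (b (qadd (qadd i j) l)))"
begin

text \<open>Orthonormality is \<open>M ** N = mat 1\<close>, where N holds the coordinates permuted
  as \<open>ang\<close> pairs them. A right inverse of a square matrix is a left inverse, and
  \<open>N ** M = mat 1\<close> is the expansion.\<close>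

lemma basis_expansion:
  assumes "u \<in> g_mhalf"
  shows "u = cmul (ang (b 0) u) (b 0) + cmul (ang (b 1) u) (b 1) + cmul (ang (b 2) u) (b 2) + cmul
    (ang (b 3) u) (b 3)"
proof -
  obtain a0 b0 c0 d0 where 0: "b 0 = mh a0 b0 c0 d0" using b_mem[of 0] by (auto elim: g_mhalf_cases)
  obtain a1 b1 c1 d1 where 1: "b 1 = mh a1 b1 c1 d1" using b_mem[of 1] by (auto elim: g_mhalf_cases)
  obtain a2 b2 c2 d2 where 2: "b 2 = mh a2 b2 c2 d2" using b_mem[of 2] by (auto elim: g_mhalf_cases)
  obtain a3 b3 c3 d3 where 3: "b 3 = mh a3 b3 c3 d3" using b_mem[of 3] by (auto elim: g_mhalf_cases)
  obtain x y z t where u: "u = mh x y z t" using assms by (rule g_mhalf_cases)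
  define row :: "complex \<Rightarrow> complex \<Rightarrow> complex \<Rightarrow> complex \<Rightarrow>
    complex^4" where
    "row p q r s = (\<chi> j. if j = 1 then p else if j = 2 then q else if j = 3 then r else s)" for p q r s
  define M :: "complex^4^4" where "M = (\<chi> i. if i = 1 then row a0 b0 c0 d0 else if i = 2 then row a1 b1 c1 d1
     else if i = 3 then row a2 b2 c2 d2 else row a3 b3 c3 d3)"
  define N :: "complex^4^4" where "N = (\<chi> i. if i = 1 then row c0 c1 c2 c3 else if i = 2 then row d0 d1 d2 d3
     else if i = 3 then row a0 a1 a2 a3 else row b0 b1 b2 b3)"
  have o: "ang (b i) (b j) = (if i = j then 1 else 0)" if "i \<in> {0,1,2,3}" "j \<in> {0,1,2,3}" for i j
    using that by (intro b_orthonormal) auto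
  have "M ** N = mat 1"
    using o[of 0 0] o[of 0 1] o[of 0 2] o[of 0 3] o[of 1 0] o[of 1 1] o[of 1 2] o[of 1 3]
      o[of 2 0] o[of 2 1] o[of 2 2] o[of 2 3] o[of 3 0] o[of 3 1] o[of 3 2] o[of 3 3]
    unfolding 0 1 2 3 ang_mh
    by (intro mat4_eqI) (simp_all add: matrix_matrix_mult_def sum_4 mat_def M_def N_def row_def)
  then have "N ** M = mat 1"
    by (simp add: matrix_left_right_inverse)
  then have nm: "(N ** M) $ i $ j = mat 1 $ i $ j" for i j by simp
  note e = nm[of 1 1] nm[of 1 2] nm[of 1 3] nm[of 1 4] nm[of 2 1] nm[of 2 2] nm[of 2 3] nm[of 2 4]
    nm[of 3 1] nm[of 3 2] nm[of 3 3] nm[of 3 4] nm[of 4 1] nm[of 4 2] nm[of 4 3] nm[of 4 4]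
  note e' = e[unfolded matrix_matrix_mult_def M_def N_def row_def mat_def, simplified sum_4, simplified]
  show ?thesis
    unfolding u 0 1 2 3 ang_mh cmul_mh mh_add mh_inject
    using e' by (intro conjI; algebra)
qed

lemma basis_induct:
  assumes "u \<in> g_mhalf" and basis: "\<And>i. i < 4 \<Longrightarrow> P (b i)"
    and add: "\<And>v w. v \<in> g_mhalf \<Longrightarrow> w \<in> g_mhalf \<Longrightarrow> P v
      \<Longrightarrow> P w \<Longrightarrow> P (v + w)"
    and cmul: "\<And>t v. v \<in> g_mhalf \<Longrightarrow> P v \<Longrightarrow> P (cmul t v)"
  shows "P u"
proof -
  have h: "P (cmul t (b i))" "cmul t (b i) \<in> g_mhalf" if "i < 4" for t i
    using that basis cmul b_mem g_mhalf_closed by simp_all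
  show ?thesis
    by (subst basis_expansion[OF assms(1)]) (simp add: h add g_mhalf_closed(1))
qed

section \<open>Supercharges on the Fock space indexed by the odd space\<close>

abbreviation N :: nat where "N \<equiv> nat (- (k + 1))"

abbreviation chg :: "nat \<Rightarrow> int \<Rightarrow> fock \<Rightarrow> fock"
  where "chg \<equiv> supercharges.charge N"

definition fG :: "mat4 \<Rightarrow> int \<Rightarrow> fock \<Rightarrow> fock" where
  "fG u n f = fsc (of_real (sqrt (- of_int k))) (\<Sum>i<4. fsc (ang (b i) u) (chg i n f))"

lemma root_square: "of_real (sqrt (- of_int k)) * of_real (sqrt (- of_int k)) = (- of_int k :: complex)"
  using k_le by (simp flip: of_real_mult)

lemma fG_add_right: "fG u n (f + g) = fG u n f + fG u n g"
  by (simp add: fG_def supercharges.charge_add fock.scale_right_distrib sum.distrib)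

lemma fG_fsc: "fG u n (fsc t f) = fsc t (fG u n f)"
  by (simp add: fG_def supercharges.charge_fsc fock.scale_sum_right mult_ac)

lemma fG_add: "u \<in> g_mhalf \<Longrightarrow> v \<in> g_mhalf \<Longrightarrow> fG (u + v) n f
  = fG u n f + fG v n f"
  by (simp add: fG_def ang_add b_mem fock.scale_left_distrib fock.scale_right_distrib sum.distrib)

lemma fG_cmul: "u \<in> g_mhalf \<Longrightarrow> fG (cmul t u) n f = fsc t (fG u n f)"
  by (simp add: fG_def ang_cmul b_mem fock.scale_sum_right mult_ac)

lemma fG_basis: "i < 4 \<Longrightarrow> fG (b i) n f = fsc (of_real (sqrt (- of_int k))) (chg i n f)"
proof -
  assume i: "i < 4"
  have "(\<Sum>j<4. fsc (ang (b j) (b i)) (chg j n f)) = (\<Sum>j<4. if j = i then chg i n f else 0)"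
    by (rule sum.cong) (use i in \<open>auto simp: b_orthonormal\<close>)
  then show ?thesis using i by (simp add: fG_def)
qed

lemma fG_vac: "n \<ge> 0 \<Longrightarrow> fG u n fvac = 0"
  by (simp add: fG_def supercharges.charge_fvac)

lemma fG_zero [simp]: "fG u n 0 = 0"
  using fG_fsc[of u n 0 0] by simp

text \<open>The square of the scaling factor is -k, and -k times 2N p^2 is 2k(k+1)p^2 for N =
  -(k+1). By bilinearity the basis suffices.\<close>

lemma fG_vac_anti:
  assumes "u \<in> g_mhalf" "v \<in> g_mhalf" "p + q \<ge> 0"
  shows "fG u p (fG v q fvac) + fG v q (fG u p fvac)
    = (if p + q = 0 then fsc (2 * of_int k * (of_int k + 1) * (of_int p)\<^sup>2 * ang u v) fvac else 0)"
proof -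
  define c where "c = (if p + q = 0 then 2 * of_int k * (of_int k + 1) * (of_int p)\<^sup>2 else 0 :: complex)"
  define lhs where "lhs u v = fG u p (fG v q fvac) + fG v q (fG u p fvac)" for u v
  define rhs where "rhs u v = fsc (c * ang u v) fvac" for u v
  have add: "lhs (u + v) w = lhs u w + lhs v w" "lhs w (u + v) = lhs w u + lhs w v"
    "rhs (u + v) w = rhs u w + rhs v w" "rhs w (u + v) = rhs w u + rhs w v"
    if "u \<in> g_mhalf" "v \<in> g_mhalf" "w \<in> g_mhalf" for u v w
    using that by (simp_all add: lhs_def rhs_def fG_add fG_add_right ang_add distrib_left
        fock.scale_left_distrib add_ac)
  have cm: "lhs (cmul t u) w = fsc t (lhs u w)" "lhs w (cmul t u) = fsc t (lhs w u)"
    "rhs (cmul t u) w = fsc t (rhs u w)" "rhs w (cmul t u) = fsc t (rhs w u)"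
    if "u \<in> g_mhalf" "w \<in> g_mhalf" for t u w
    using that by (simp_all add: lhs_def rhs_def fG_cmul fG_fsc ang_cmul fock.scale_right_distrib mult_ac)
  have bb: "lhs (b i) (b j) = rhs (b i) (b j)" if "i < 4" "j < 4" for i j
  proof -
    have N: "of_nat N = (- (of_int k + 1) :: complex)" using k_le by simp
    have "lhs (b i) (b j) = fsc (- of_int k) (supercharges.anti N i p j q fvac)"
      using that by (simp add: lhs_def fG_basis supercharges.anti_def supercharges.charge_fsc
          root_square fock.scale_right_distrib)
    also have "\<dots> = rhs (b i) (b j)"
      unfolding supercharges.anti_fvac[OF that assms(3)] N rhs_def b_orthonormal[OF that] c_def
      using that by (cases "i = j"; cases "p + q = 0") (simp_all add: power2_eq_square algebra_simps)
    finally show ?thesis .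
  qed
  have "lhs u v = rhs u v"
  proof (rule basis_induct[OF assms(1)])
    fix i :: nat assume i: "i < 4"
    show "lhs (b i) v = rhs (b i) v"
      by (rule basis_induct[OF assms(2)]) (use bb i b_mem in \<open>simp_all add: add cm\<close>)
  qed (use assms in \<open>simp_all add: add cm\<close>)
  then show ?thesis by (simp add: lhs_def rhs_def c_def)
qed

text \<open>The counterpart of \<open>G_triple\<close>, reduced to the basis by trilinearity. The
  factor 1/2 in \<open>b_trip\<close> accounts for 2k here against the factor -k from rescaling in
  \<open>anti_charge\<close>.\<close>

lemma fG_triple:
  assumes "u \<in> g_mhalf" "v \<in> g_mhalf" "x \<in> g_mhalf"
  shows "fG u p (fG v q (fG x r f)) + fG v q (fG u p (fG x r f))
    = fG x r (fG u p (fG v q f) + fG v q (fG u p f))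
    + fsc (- of_int k * ang u v * of_int (p + q - 2 * r)) (fG x (p + q + r) f)
    + fsc (2 * of_int k * of_int (p - q)) (fG (trip u v x) (p + q + r) f)"
proof -
  define lhs where "lhs u v x = fG u p (fG v q (fG x r f)) + fG v q (fG u p (fG x r f))
    - fG x r (fG u p (fG v q f) + fG v q (fG u p f))" for u v x
  define rhs where "rhs u v x = fsc (- of_int k * ang u v * of_int (p + q - 2 * r)) (fG x (p + q + r) f)
    + fsc (2 * of_int k * of_int (p - q)) (fG (trip u v x) (p + q + r) f)" for u v x
  note cl = trip_in_g_mhalf g_mhalf_closed
  have add: "lhs (u + v) w z = lhs u w z + lhs v w z" "lhs w (u + v) z = lhs w u z + lhs w v z"
    "lhs w z (u + v) = lhs w z u + lhs w z v" "rhs (u + v) w z = rhs u w z + rhs v w z"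
    "rhs w (u + v) z = rhs w u z + rhs w v z" "rhs w z (u + v) = rhs w z u + rhs w z v"
    if "u \<in> g_mhalf" "v \<in> g_mhalf" "w \<in> g_mhalf" "z \<in> g_mhalf" for u v w z
    using that unfolding lhs_def rhs_def
    by (simp_all add: fG_add fG_add_right ang_add trip_add cl fock.scale_right_distrib
        fock.scale_left_distrib distrib_left distrib_right left_diff_distrib fock.scale_left_diff_distrib)
  have cm: "lhs (cmul t u) w z = fsc t (lhs u w z)" "lhs w (cmul t u) z = fsc t (lhs w u z)"
    "lhs w z (cmul t u) = fsc t (lhs w z u)" "rhs (cmul t u) w z = fsc t (rhs u w z)"
    "rhs w (cmul t u) z = fsc t (rhs w u z)" "rhs w z (cmul t u) = fsc t (rhs w z u)"
    if "u \<in> g_mhalf" "w \<in> g_mhalf" "z \<in> g_mhalf" for t u w z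
    using that unfolding lhs_def rhs_def
    by (simp_all add: fG_cmul fG_fsc fG_add_right ang_cmul trip_cmul cl fock.scale_right_distrib
        fock.scale_right_diff_distrib mult_ac)
  have bbb: "lhs (b i) (b j) (b l) = rhs (b i) (b j) (b l)" if ijl: "i < 4" "j < 4" "l < 4" for i j l
  proof -
    let ?s = "of_real (sqrt (- of_int k)) :: complex"
    have s3: "fsc ?s (fsc ?s (fsc ?s h)) = fsc (- of_int k * ?s) h" for h
      using root_square by (simp add: mult.assoc[symmetric])
    have "lhs (b i) (b j) (b l) = fsc (- of_int k * ?s) (supercharges.anti N i p j q (chg l r f)
        - chg l r (supercharges.anti N i p j q f))"
      unfolding lhs_def fG_basis[OF ijl(1)] fG_basis[OF ijl(2)] fG_basis[OF ijl(3)]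
        supercharges.charge_fsc supercharges.charge_add s3 supercharges.anti_def
      by (simp add: supercharges.charge_fsc supercharges.charge_add fock.scale_right_distrib
          fock.scale_right_diff_distrib s3 del: fock.scale_scale)
    also have "\<dots> = rhs (b i) (b j) (b l)"
    proof (cases "i = j")
      case True
      then show ?thesis
        unfolding supercharges.anti_charge[OF ijl] rhs_def b_trip[OF ijl] b_orthonormal[OF ijl(1,2)]
        using fG_cmul[of "b 0" 0 "p + q + r" f] b_mem[of 0] ijl
        by (simp add: cmul_simps fG_basis mult_ac)
    next
      case False
      have "qadd (qadd i j) l < 4" using quaternion_perm(1) ijl by simp
      then show ?thesis using False
        unfolding supercharges.anti_charge[OF ijl] rhs_def b_trip[OF ijl] b_orthonormal[OF ijl(1,2)]
        by (simp add: fG_cmul b_mem fG_basis algebra_simps)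
    qed
    finally show ?thesis .
  qed
  have "lhs u v x = rhs u v x"
  proof (rule basis_induct[OF assms(1)])
    fix i :: nat assume i: "i < 4"
    show "lhs (b i) v x = rhs (b i) v x"
    proof (rule basis_induct[OF assms(2)])
      fix j :: nat assume j: "j < 4"
      show "lhs (b i) (b j) x = rhs (b i) (b j) x"
        by (rule basis_induct[OF assms(3)]) (use bbb i j b_mem in \<open>simp_all add: add cm\<close>)
    qed (use i b_mem assms in \<open>simp_all add: add cm\<close>)
  qed (use assms in \<open>simp_all add: add cm\<close>)
  then show ?thesis by (simp add: lhs_def rhs_def algebra_simps)
qed

text \<open>The charges are attached to a basis fixed by \<phi>, so applying \<phi> to u conjugates
  its coefficients, just as taking adjoints does.\<close>

lemma fG_adjoint:
  assumes "u \<in> g_mhalf"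
  shows "fip (fG u n f) g = fip f (fG (\<phi> u) (- n) g)"
proof -
  have "cnj (ang (b i) u) = ang (b i) (\<phi> u)" if "i < 4" for i
    using ang_phi[OF b_mem[OF that] assms] b_fixed[OF that] by simp
  then show ?thesis
    by (simp add: fG_def fip_sum_left fip_sum_right fip_scale_left fip_scale_right
        supercharges.charge_adjoint)
qed

end

section \<open>Words in raising modes\<close>

definition weight_half :: "int \<Rightarrow> mat4 set" where
  "weight_half \<epsilon> = {u \<in> g_mhalf. br (nt 0 1 0) u
    = cmul (of_int \<epsilon>) u \<and> (\<epsilon> = 1 \<or> \<epsilon> = -1)}"

lemma weight_half_mh: "mh 0 b c 0 \<in> weight_half 1" "mh a 0 0 d \<in> weight_half (-1)"
  by (simp_all add: weight_half_def mh_in_g_mhalf br_nt_mh cmul_mh)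

lemma weight_half_decomp:
  assumes "u \<in> g_mhalf" obtains v w where "u = v + w" "v \<in> weight_half 1" "w \<in> weight_half (-1)"
proof -
  obtain a b c d where "u = mh a b c d" by (rule g_mhalf_cases[OF assms])
  then have "u = mh 0 b c 0 + mh a 0 0 d" by (simp add: mh_add)
  then show ?thesis using that weight_half_mh by blast
qed

lemma weight_half_cases:
  assumes "u \<in> weight_half \<epsilon>"
  obtains b c where "\<epsilon> = 1" "u = mh 0 b c 0" | a d where "\<epsilon> = -1" "u = mh a 0 0 d"
proof -
  obtain a b c d where u: "u = mh a b c d" using assms by (auto simp: weight_half_def elim: g_mhalf_cases)
  have "\<epsilon> = 1 \<or> \<epsilon> = -1" using assms by (simp add: weight_half_def)
  then show ?thesis
    using assms that unfolding u by (auto simp: weight_half_def br_nt_mh cmul_mh mh_inject)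
qed

lemma weight_half_g_mhalf: "u \<in> weight_half \<epsilon> \<Longrightarrow> u \<in> g_mhalf"
  by (simp add: weight_half_def)

text \<open>An action of modes of G subject to the triple relation only, with no value prescribed
  for an anticommutator. The instance of interest is the space of pairs.\<close>

locale supercharge_module = vector_space sc for sc :: "complex \<Rightarrow> 'a::ab_group_add \<Rightarrow> 'a" +
  fixes k :: complex and g :: "mat4 \<Rightarrow> int \<Rightarrow> 'a \<Rightarrow> 'a"
  assumes g_add_right: "g u n (x + y) = g u n x + g u n y"
    and g_scale_right: "g u n (sc t x) = sc t (g u n x)"
    and g_add_left: "u \<in> g_mhalf \<Longrightarrow> v \<in> g_mhalf \<Longrightarrow> g (u + v) n x
      = g u n x + g v n x"
    and g_triple: "u \<in> g_mhalf \<Longrightarrow> v \<in> g_mhalf \<Longrightarrow> w \<in> g_mhalf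
      \<Longrightarrow>
      g u p (g v q (g w r x)) + g v q (g u p (g w r x)) = g w r (g u p (g v q x) + g v q (g u p x))
      + sc (- k * ang u v * of_int (p + q - 2 * r)) (g w (p + q + r) x)
      + sc (2 * k * of_int (p - q)) (g (trip u v w) (p + q + r) x)"
begin

definition anticomm :: "mat4 \<Rightarrow> int \<Rightarrow> mat4 \<Rightarrow> int \<Rightarrow> 'a
  \<Rightarrow> 'a" where
  "anticomm u p v q x = g u p (g v q x) + g v q (g u p x)"

lemma anticomm_add_right: "anticomm u p v q (x + y) = anticomm u p v q x + anticomm u p v q y"
  by (simp add: anticomm_def g_add_right add_ac)

lemma anticomm_scale_right: "anticomm u p v q (sc t x) = sc t (anticomm u p v q x)"
  by (simp add: anticomm_def g_scale_right scale_right_distrib)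

lemma anticomm_add_left:
  "u \<in> g_mhalf \<Longrightarrow> u' \<in> g_mhalf \<Longrightarrow> anticomm (u + u') p v q x
    = anticomm u p v q x + anticomm u' p v q x"
  "u \<in> g_mhalf \<Longrightarrow> u' \<in> g_mhalf \<Longrightarrow> anticomm v q (u + u') p x
    = anticomm v q u p x + anticomm v q u' p x"
  by (simp_all add: anticomm_def g_add_left g_add_right add_ac)

text \<open>The mode \<open>g u n\<close> of a vector of weight \<open>\<epsilon>\<close> has degree
  \<open>- 3 n - \<epsilon>\<close>, which never vanishes.\<close>

inductive_set words :: "'a \<Rightarrow> 'a set" for \<omega> where
  base: "\<omega> \<in> words \<omega>"
| add: "x \<in> words \<omega> \<Longrightarrow> y \<in> words \<omega> \<Longrightarrow> x + y \<in>
  words \<omega>"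
| scale: "x \<in> words \<omega> \<Longrightarrow> sc t x \<in> words \<omega>"
| mode: "x \<in> words \<omega> \<Longrightarrow> u \<in> weight_half \<epsilon> \<Longrightarrow> 0 <
  - 3 * n - \<epsilon> \<Longrightarrow> g u n x \<in> words \<omega>"
| anticomm: "x \<in> words \<omega> \<Longrightarrow> u \<in> weight_half \<epsilon> \<Longrightarrow> v
  \<in> weight_half \<delta> \<Longrightarrow> 0 < - 3 * (p + q) - \<epsilon> - \<delta> \<Longrightarrow>
    anticomm u p v q x \<in> words \<omega>"

definition triple_term :: "mat4 \<Rightarrow> int \<Rightarrow> mat4 \<Rightarrow> int \<Rightarrow> mat4
  \<Rightarrow> int \<Rightarrow> 'a \<Rightarrow> 'a" where
  "triple_term u p v q w r x = sc (- k * ang u v * of_int (p + q - 2 * r)) (g w (p + q + r) x)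
      + sc (2 * k * of_int (p - q)) (g (trip u v w) (p + q + r) x)"

lemma anticomm_g:
  "u \<in> g_mhalf \<Longrightarrow> v \<in> g_mhalf \<Longrightarrow> w \<in> g_mhalf \<Longrightarrow>
    anticomm u p v q (g w r x) = g w r (anticomm u p v q x) + triple_term u p v q w r x"
  using g_triple by (simp add: anticomm_def triple_term_def add_ac)

text \<open>Modes are moved to the right until they reach \<omega>, where those of negative degree
  give 0 and anticommutators of degree at most 0 give scalars. Exchanging two modes costs an
  anticommutator, exchanging an anticommutator with a mode costs modes, exchanging two
  anticommutators costs anticommutators; so both closure properties are proved together.
  Anticommutators are letters of their own because they can have positive degree while one of their
  factors has negative degree.\<close>

lemma words_closed:
  assumes kill: "\<And>u \<epsilon> n. u \<in> weight_half \<epsilon> \<Longrightarrow> - 3 * n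
    - \<epsilon> < 0 \<Longrightarrow> g u n \<omega> = 0"
    and scalar: "\<And>u v \<epsilon> \<delta> p q. u \<in> weight_half \<epsilon> \<Longrightarrow> v
      \<in> weight_half \<delta> \<Longrightarrow> - 3 * (p + q) - \<epsilon> - \<delta> \<le> 0 \<Longrightarrow>
      \<exists>c. anticomm u p v q \<omega> = sc c \<omega>"
    and "x \<in> words \<omega>"
  shows "(\<forall>u\<in>g_mhalf. \<forall>n. g u n x \<in> words \<omega>) \<and>
    (\<forall>u\<in>g_mhalf. \<forall>v\<in>g_mhalf. \<forall>p q. anticomm u p v q x \<in> words \<omega>)"
  using assms(3)
proof (induction rule: words.induct)
  case base
  have z: "0 \<in> words \<omega>" using words.scale[OF words.base, of 0] by simp
  have g: "g u n \<omega> \<in> words \<omega>" if "u \<in> weight_half \<epsilon>" for u n \<epsilon>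
  proof (cases "- 3 * n - \<epsilon> < 0")
    case True
    then show ?thesis using kill that z by simp
  next
    case False
    moreover have "- 3 * n - \<epsilon> \<noteq> 0" using that by (auto simp: weight_half_def) presburger+
    ultimately show ?thesis using words.mode[OF words.base that] by simp
  qed
  have a: "anticomm u p v q \<omega> \<in> words \<omega>"
    if "u \<in> weight_half \<epsilon>" "v \<in> weight_half \<delta>" for u v p q \<epsilon> \<delta>
  proof (cases "- 3 * (p + q) - \<epsilon> - \<delta> \<le> 0")
    case True
    then show ?thesis using scalar[OF that] words.base words.scale by metis
  next
    case False
    then show ?thesis using words.anticomm[OF words.base that] by simp
  qed
  show ?case
  proof (intro conjI ballI allI)
    fix u n assume "u \<in> g_mhalf"
    then obtain y z where "u = y + z" "y \<in> weight_half 1" "z \<in> weight_half (-1)"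
      by (rule weight_half_decomp)
    then show "g u n \<omega> \<in> words \<omega>" using g g_add_left weight_half_g_mhalf words.add by metis
  next
    fix u v p q assume "u \<in> g_mhalf" "v \<in> g_mhalf"
    obtain y z where u: "u = y + z" "y \<in> weight_half 1" "z \<in> weight_half (-1)"
      by (rule weight_half_decomp[OF \<open>u \<in> g_mhalf\<close>])
    obtain y' z' where v: "v = y' + z'" "y' \<in> weight_half 1" "z' \<in> weight_half (-1)"
      by (rule weight_half_decomp[OF \<open>v \<in> g_mhalf\<close>])
    have "anticomm u p v q \<omega> = anticomm y p y' q \<omega> + anticomm y p z' q \<omega> +
      (anticomm z p y' q \<omega> + anticomm z p z' q \<omega>)"
      using u v weight_half_g_mhalf by (simp add: anticomm_add_left)
    then show "anticomm u p v q \<omega> \<in> words \<omega>" using u v a words.add by simp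
  qed
next
  case (add x y)
  then show ?case by (simp add: g_add_right anticomm_add_right words.add)
next
  case (scale x t)
  then show ?case by (simp add: g_scale_right anticomm_scale_right words.scale)
next
  case (mode x u \<epsilon> n)
  have u: "u \<in> g_mhalf" using mode weight_half_g_mhalf by blast
  have t: "triple_term v p w q u n x \<in> words \<omega>" if "v \<in> g_mhalf" "w \<in> g_mhalf" for v p w q
    unfolding triple_term_def using mode.IH that u trip_in_g_mhalf by (intro words.add words.scale) auto
  show ?case
  proof (intro conjI ballI allI)
    fix v m assume v: "v \<in> g_mhalf"
    have "g v m (g u n x) = anticomm v m u n x + sc (-1) (g u n (g v m x))"
      by (simp add: anticomm_def)
    moreover have "g u n (g v m x) \<in> words \<omega>" using words.mode mode v by blast
    ultimately show "g v m (g u n x) \<in> words \<omega>"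
      using mode.IH v u by (simp only: words.add words.scale)
  next
    fix v w p q assume "v \<in> g_mhalf" "w \<in> g_mhalf"
    moreover from this have "g u n (anticomm v p w q x) \<in> words \<omega>" using words.mode mode by blast
    ultimately show "anticomm v p w q (g u n x) \<in> words \<omega>"
      using t u by (simp add: anticomm_g words.add)
  qed
next
  case (anticomm x u \<epsilon> v \<delta> p q)
  have uv: "u \<in> g_mhalf" "v \<in> g_mhalf" using anticomm weight_half_g_mhalf by auto
  have step: "y \<in> words \<omega> \<Longrightarrow> anticomm u p v q y \<in> words \<omega>" for y
    using words.anticomm anticomm by blast
  show ?case
  proof (intro conjI ballI allI)
    fix w r assume w: "w \<in> g_mhalf"
    have "g w r (anticomm u p v q x) = anticomm u p v q (g w r x) + sc (-1) (triple_term u p v q w r x)"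
      using anticomm_g uv w by simp
    moreover have "triple_term u p v q w r x \<in> words \<omega>"
      unfolding triple_term_def using anticomm.IH uv w trip_in_g_mhalf by (intro words.add words.scale) auto
    ultimately show "g w r (anticomm u p v q x) \<in> words \<omega>"
      using anticomm.IH w step by (simp only: words.add words.scale)
  next
    fix w z r s assume wz: "w \<in> g_mhalf" "z \<in> g_mhalf"
    let ?A = "anticomm w r z s"
    have half: "?A (g a m (g b n x)) = g a m (g b n (?A x)) + g a m (triple_term w r z s b n x) +
      triple_term w r z s a m (g b n x)"
      if "a \<in> g_mhalf" "b \<in> g_mhalf" for a m b n
      using that wz by (simp add: anticomm_g g_add_right)
    \<comment> \<open>A mode applied to a triple term is not covered by the induction hypothesis;
      the sum of both orders is, being a combination of anticommutators.\<close>
    have pair: "g a m (triple_term w r z s b n x) + triple_term w r z s b n (g a m x) \<in> words \<omega>"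
      if "a \<in> g_mhalf" "b \<in> g_mhalf" for a m b n
    proof -
      have "g a m (triple_term w r z s b n x) + triple_term w r z s b n (g a m x)
        = sc (- k * ang w z * of_int (r + s - 2 * n)) (anticomm a m b (r + s + n) x)
        + sc (2 * k * of_int (r - s)) (anticomm a m (trip w z b) (r + s + n) x)"
        by (simp only: triple_term_def anticomm_def g_add_right g_scale_right scale_right_distrib add_ac)
      moreover have "\<dots> \<in> words \<omega>"
        using anticomm.IH that wz trip_in_g_mhalf by (intro words.add words.scale) auto
      ultimately show ?thesis by simp
    qed
    have "?A (anticomm u p v q x) = anticomm u p v q (?A x)
      + (g u p (triple_term w r z s v q x) + triple_term w r z s v q (g u p x))
      + (g v q (triple_term w r z s u p x) + triple_term w r z s u p (g v q x))"
      using half[OF uv] half[OF uv(2,1)]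
        by (simp add: anticomm_def anticomm_add_right[unfolded anticomm_def] add_ac)
    then show "?A (anticomm u p v q x) \<in> words \<omega>"
      using anticomm.IH wz uv step pair by (simp add: words.add)
  qed
qed

end

section \<open>Submodules\<close>

context ramond_module
begin

lemma finsupp_sum_in_subspace:
  assumes "M.subspace W" "\<And>j. t j \<in> W" shows "finsupp_sum t \<in> W"
  unfolding finsupp_sum_def by (rule M.subspace_sum) (use assms in auto)

lemma twist_add: "r - twist (p \<noteq> q) \<in> \<int> \<Longrightarrow> r - twist p - twist q \<in> \<int>"
proof -
  assume r: "r - twist (p \<noteq> q) \<in> \<int>"
  show ?thesis
  proof (cases "p \<and> q")
    case True
    then have "r - twist p - twist q = r - twist (p \<noteq> q) - 1" by (simp add: twist_def)
    then show ?thesis using r by (metis Ints_1 Ints_diff)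
  next
    case False
    then have eq: "r - twist p - twist q = r - twist (p \<noteq> q)" by (auto simp: twist_def)
    show ?thesis unfolding eq by (rule r)
  qed
qed

text \<open>Downward induction on n from the truncation bound. In the Borcherds identity the term j
  = 0 is the wanted mode, the terms with j > 0 contain higher products, and the opposite side is
  built from modes of a and b.\<close>

lemma nprod_preserves:
  assumes W: "M.subspace W" and a: "a \<in> part p" "\<And>r w. w \<in> W \<Longrightarrow> md r a w \<in> W"
    and b: "b \<in> part q" "\<And>r w. w \<in> W \<Longrightarrow> md r b w \<in> W"
  shows "w \<in> W \<Longrightarrow> md r (nprod n a b) w \<in> W"
proof -
  obtain K where K: "\<forall>n\<ge>K. nprod n a b = 0" using V.truncation by blast
  have "\<forall>r. \<forall>w\<in>W. md r (nprod n a b) w \<in> W"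
  proof (induction "nat (K - n)" arbitrary: n rule: less_induct)
    case less
    show ?case
    proof (intro allI ballI)
      fix r w assume w: "w \<in> W"
      show "md r (nprod n a b) w \<in> W"
      proof (cases "n \<ge> K \<or> r - twist (p \<noteq> q) \<notin> \<int>")
        case True
        then have "md r (nprod n a b) w = 0"
          using K md_twisted[OF V.nprod_part[OF a(1) b(1)]] by auto
        then show ?thesis using M.subspace_0[OF W] by simp
      next
        case False
        \<comment> \<open>This splitting of \<open>r\<close> puts both indices into the classes that
          the twists of \<open>a\<close> and \<open>b\<close> allow.\<close>
        let ?r = "twist p" and ?s = "r - twist p"
        let ?t = "\<lambda>j. mscl (of_rat (?r gchoose j)) (md (?r + ?s - of_nat j) (nprod (n + int j) a b) w)"
        let ?m = "nat (K - n)"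
        have z: "?t j = 0" if "j \<ge> Suc ?m" for j
          using K that by simp
        have "finsupp_sum ?t = (\<Sum>j<Suc ?m. ?t j)"
          by (rule finsupp_sum_eq) (use z in simp)
        also have "\<dots> = ?t 0 + (\<Sum>j<?m. ?t (Suc j))"
          by (rule sum.lessThan_Suc_shift)
        also have "?t 0 = md r (nprod n a b) w" by simp
        finally have eq: "md r (nprod n a b) w = finsupp_sum ?t - (\<Sum>j<?m. ?t (Suc j))" by simp
        have "finsupp_sum ?t \<in> W"
        proof -
          have "?r - twist p \<in> \<int>" "?s - twist q \<in> \<int>" using False twist_add[of r p q] by simp_all
          note md_borcherds[OF a(1) b(1) this, of n w]
          moreover have "finsupp_sum (\<lambda>j. mscl ((-1) ^ j * (of_int n gchoose j))
            (md (?r + of_int n - of_nat j) a (md (?s + of_nat j) b w)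
             - mscl (koszul p q * int_sign n)
               (md (of_int n + ?s - of_nat j) b (md (?r + of_nat j) a w)))) \<in> W"
            by (intro finsupp_sum_in_subspace W M.subspace_scale M.subspace_diff a(2) b(2) w)
          ultimately show ?thesis by simp
        qed
        moreover have "(\<Sum>j<?m. ?t (Suc j)) \<in> W"
        proof (rule M.subspace_sum[OF W], rule M.subspace_scale[OF W])
          fix j
          have "nat (K - (n + int (Suc j))) < nat (K - n)" using False by auto
          from less[OF this] w show "md (?r + ?s - of_nat (Suc j)) (nprod (n + int (Suc j)) a b) w \<in> W" by blast
        qed
        ultimately show ?thesis unfolding eq by (rule M.subspace_diff[OF W])
      qed
    qed
  qed
  then show "w \<in> W \<Longrightarrow> md r (nprod n a b) w \<in> W" by blast
qed

lemma generators_preserve: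
  assumes W: "M.subspace W" and gen: "V.span (V.word_vec gs ` V.ordered_words gs) = UNIV"
    and gs: "\<And>a. a \<in> set gs \<Longrightarrow> (\<exists>p. a \<in> part p) \<and>
      (\<forall>r. \<forall>w\<in>W. md r a w \<in> W)"
    and w: "w \<in> W"
  shows "md r a w \<in> W"
proof -
  have word: "(\<exists>p. V.word_vec gs x \<in> part p) \<and> (\<forall>r. \<forall>w\<in>W. md r
    (V.word_vec gs x) w \<in> W)"
    if "\<forall>(i, n) \<in> set x. i < length gs" for x
    using that
  proof (induction x)
    case Nil
    then show ?case using V.vac_even M.subspace_0[OF W] by (auto simp: md_vac)
  next
    case (Cons y x)
    obtain i n where y: "y = (i, n)" by (cases y)
    with Cons obtain p where p: "V.word_vec gs x \<in> part p" and x: "\<forall>r. \<forall>w\<in>W. md r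
      (V.word_vec gs x) w \<in> W"
      by auto
    have "gs ! i \<in> set gs" using Cons y by simp
    then obtain q where q: "gs ! i \<in> part q" and i: "\<forall>r. \<forall>w\<in>W. md r (gs ! i) w
      \<in> W" using gs by blast
    have "nprod (- int n) (gs ! i) (V.word_vec gs x) \<in> part (q \<noteq> p)" by (rule V.nprod_part[OF q p])
    moreover have "md r (nprod (- int n) (gs ! i) (V.word_vec gs x)) w \<in> W" if "w \<in> W" for r w
      by (rule nprod_preserves[OF W q _ p]) (use i x that in auto)
    ultimately show ?case by (auto simp: y)
  qed
  have "a \<in> V.span (V.word_vec gs ` V.ordered_words gs)" using gen by simp
  then show ?thesis
    using w
  proof (induction arbitrary: r w rule: V.span_induct_alt)
    case base
    then show ?case using M.subspace_0[OF W] by simp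
  next
    case (step c x y)
    then have "md r x w \<in> W" using word by (force simp: V.ordered_words_def)
    then show ?case using step W by (simp add: md_add_left md_scl_left M.subspace_add M.subspace_scale)
  qed
qed

lemma mpart_unique:
  assumes "y \<in> mpart False" "y' \<in> mpart False" "z \<in> mpart True" "z' \<in> mpart True" "y + z = y' + z'"
  shows "y = y' \<and> z = z'"
proof -
  have eq: "y - y' = z' - z" using assms(5) by (simp add: algebra_simps)
  have "y - y' \<in> mpart False" using assms M.subspace_diff[OF M.subspace_part] by blast
  moreover have "y - y' \<in> mpart True" unfolding eq using assms M.subspace_diff[OF M.subspace_part] by blast
  ultimately have "y - y' \<in> mpart False \<inter> mpart True" by (rule IntI)
  then have "y - y' = 0" unfolding M.part_inter by simp
  then show ?thesis using eq by simp
qed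

lemma mpart_zero: "0 \<in> mpart p"
  by (rule M.subspace_0[OF M.subspace_part])

end

section \<open>Submodules and highest weight vectors in terms of the modes of G\<close>

context ramond_W_module
begin

lemma g_nat_bil_decomp:
  assumes "a \<in> g_nat"
  obtains u1 v1 u2 v2 u3 v3 where "a = bil u1 v1 + bil u2 v2 + bil u3 v3"
    "{u1, v1, u2, v2, u3, v3} \<subseteq> g_mhalf"
proof -
  obtain p q r where a: "a = nt p q r" by (rule g_nat_cases[OF assms])
  have "a = bil (mh 0 p 0 0) (mh 0 0 1 0) + bil (mh (2 * q) 0 0 0) (mh 0 0 1 0) + bil (mh r 0 0 0) (mh 0 0 0 1)"
    by (simp add: a bil_mh nt_add)
  then show ?thesis using that mh_in_g_mhalf by simp
qed

definition G_anticomm :: "mat4 \<Rightarrow> int \<Rightarrow> mat4 \<Rightarrow> int \<Rightarrow> 'm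
  \<Rightarrow> 'm" where
  "G_anticomm u p v q w = G_mode u p (G_mode v q w) + G_mode v q (G_mode u p w)"

text \<open>Interchanging p and q reverses the J-term of the anticommutator and preserves the L-term
  and the central term.\<close>

lemma J_via_G:
  assumes "u \<in> g_mhalf" "v \<in> g_mhalf"
  shows "mscl (4 * k * of_int (p - q)) (J_mode (bil u v) (p + q) w) = G_anticomm u p v q w - G_anticomm u q v p w"
proof -
  have "p + q = 0 \<Longrightarrow> (of_int q)\<^sup>2 = ((of_int p)\<^sup>2 :: complex)"
    by (simp add: eq_neg_iff_add_eq_0[symmetric])
  then have "G_anticomm u p v q w - G_anticomm u q v p w
    = mscl (2 * k * of_int (p - q)) (J_mode (bil u v) (p + q) w)
      - mscl (2 * k * of_int (q - p)) (J_mode (bil u v) (p + q) w)"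
    unfolding G_anticomm_def G_G_anticommute[OF assms] by (simp add: add.commute[of q p])
  also have "\<dots> = mscl (4 * k * of_int (p - q)) (J_mode (bil u v) (p + q) w)"
    unfolding M.scale_left_diff_distrib[symmetric] by (simp add: algebra_simps)
  finally show ?thesis by simp
qed

text \<open>For equal vectors \<open>bil\<close> vanishes, which isolates the L-mode; the correction
  at n = 0 is the central term at p = 0.\<close>

lemma L_via_G:
  "mscl (- 4 * k) (L_mode n w) = G_anticomm (mh 1 0 1 0) n (mh 1 0 1 0) 0 w
    + (if n = 0 then mscl (k * (k + 1)) w else 0)"
proof -
  let ?u = "mh 1 0 1 0"
  have a: "ang ?u ?u = 2" by (simp add: ang_mh)
  have b: "bil ?u ?u = cmul 0 (nt 0 0 0)" by (simp add: bil_mh cmul_nt)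
  have "G_anticomm ?u n ?u 0 w = mscl (- 4 * k) (L_mode n w) + (if n = 0 then mscl (- (k * (k + 1))) w else 0)"
    unfolding G_anticomm_def G_G_anticommute[OF mh_in_g_mhalf mh_in_g_mhalf] a b
    using J_mode_linear(2)[OF nt_in_g_nat[of 0 0 0], of 0 n w] by (simp add: mult.commute)
  then show ?thesis by simp
qed

text \<open>As k is nonzero, the modes of J and L are combinations of anticommutators of G-modes and
  of scalars; strong generation extends stability to all fields.\<close>

lemma submodule_of_G_stable:
  assumes W: "M.subspace W" and hom: "\<And>w. w \<in> W \<Longrightarrow> \<exists>y\<in>W \<inter> mpart
    False. \<exists>z\<in>W \<inter> mpart True. w = y + z"
    and G: "\<And>u n w. u \<in> g_mhalf \<Longrightarrow> w \<in> W \<Longrightarrow> G_mode u n w \<in> W"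
  shows "submodule W"
proof -
  have anticomm: "G_anticomm u p v q w \<in> W" if "u \<in> g_mhalf" "v \<in> g_mhalf" "w \<in> W" for u v p q w
    unfolding G_anticomm_def by (intro M.subspace_add[OF W] G that)
  have unscale: "w \<in> W" if "mscl t w \<in> W" "t \<noteq> 0" for t w
    using M.subspace_scale[OF W that(1), of "1 / t"] that(2) by simp
  have J: "J_mode a n w \<in> W" if a: "a \<in> g_nat" and w: "w \<in> W" for a n w
  proof -
    have bil: "J_mode (bil u v) n w \<in> W" if uv: "u \<in> g_mhalf" "v \<in> g_mhalf" for u v
    proof -
      \<comment> \<open>The factor p - q has to be nonzero, whence the pair (1, -1) for n =
        0.\<close>
      obtain p q where pq: "n = p + q" "p \<noteq> q"
        by (cases "n = 0") (auto intro: that[of 1 "-1"] that[of n 0])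
      have "mscl (4 * k * of_int (p - q)) (J_mode (bil u v) n w) \<in> W"
        unfolding pq(1) J_via_G[OF uv] using anticomm uv w M.subspace_diff[OF W] by blast
      then show ?thesis by (rule unscale) (use level_nonzero pq in simp)
    qed
    obtain u1 v1 u2 v2 u3 v3 where d: "a = bil u1 v1 + bil u2 v2 + bil u3 v3"
      "{u1, v1, u2, v2, u3, v3} \<subseteq> g_mhalf" by (rule g_nat_bil_decomp[OF a])
    then have "J_mode a n w = J_mode (bil u1 v1) n w + J_mode (bil u2 v2) n w + J_mode (bil u3 v3) n w"
      by (simp add: J_mode_linear bil_in_g_nat g_nat_closed)
    then show ?thesis using bil d M.subspace_add[OF W] by simp
  qed
  have L: "L_mode n w \<in> W" if w: "w \<in> W" for n w
  proof -
    have "mscl (- 4 * k) (L_mode n w) \<in> W"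
      unfolding L_via_G using anticomm[OF mh_in_g_mhalf mh_in_g_mhalf w] w
      by (intro M.subspace_add[OF W]) (auto intro: M.subspace_scale[OF W] M.subspace_0[OF W])
    then show ?thesis by (rule unscale) (use level_nonzero in simp)
  qed
  have even: "md r a w \<in> W" if "a \<in> part False" "\<And>n. md (of_int n) a w \<in> W" for r a w
  proof (cases "r \<in> \<int>")
    case True
    then show ?thesis using that(2) by (auto elim: Ints_cases)
  next
    case False
    then have "md r a w = 0" using md_twisted[OF that(1), of r] by (simp add: twist_def)
    then show ?thesis using M.subspace_0[OF W] by simp
  qed
  have odd: "md r (G u) w \<in> W" if "u \<in> g_mhalf" "w \<in> W" for r u w
  proof (cases "r - 1/2 \<in> \<int>")
    case True
    then obtain n where "r - 1/2 = of_int n" by (auto elim: Ints_cases)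
    then have "r = of_int n + 1/2" by (simp add: algebra_simps)
    then show ?thesis using G[OF that, of n] by (simp add: G_mode_def)
  next
    case False
    then have "md r (G u) w = 0" using md_twisted[OF G_odd[OF that(1)], of r] by (simp add: twist_def)
    then show ?thesis using M.subspace_0[OF W] by simp
  qed
  have gs: "(\<exists>p. a \<in> part p) \<and> (\<forall>r. \<forall>w\<in>W. md r a w \<in> W)"
    if "a \<in> set (L # map J [munit 3 4, munit 3 3 - munit 4 4, munit 4 3]
         @ map G [munit 2 3, munit 2 4, munit 3 1, munit 4 1])" for a
  proof -
    have "a = L \<or> (\<exists>x\<in>g_nat. a = J x) \<or> (\<exists>u\<in>g_mhalf. a = G u)"
      using that unfolding basis_nt basis_mh using nt_in_g_nat mh_in_g_mhalf by auto
    then show ?thesis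
    proof (elim disjE bexE)
      assume a: "a = L"
      have "md r L w \<in> W" if "w \<in> W" for r w
      proof (rule even[OF L_even])
        show "md (of_int n) L w \<in> W" for n using L[OF that, of "n - 1"] by (simp add: L_mode_def)
      qed
      then show ?thesis using a L_even by blast
    next
      fix x assume x: "x \<in> g_nat" "a = J x"
      have "md r (J x) w \<in> W" if "w \<in> W" for r w
        by (rule even[OF J_even[OF x(1)]]) (use J[OF x(1) that] in \<open>simp add: J_mode_def\<close>)
      then show ?thesis using x J_even by blast
    next
      fix u assume u: "u \<in> g_mhalf" "a = G u"
      then show ?thesis using odd G_odd by blast
    qed
  qed
  have "md r a w \<in> W" if "w \<in> W" for r a w
    using generated[unfolded strongly_freely_generated_def] generators_preserve[OF W _ gs that] by blast
  then show ?thesis using W hom by (simp add: submodule_def)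
qed

lemma modes_mpart:
  "u \<in> g_mhalf \<Longrightarrow> w \<in> mpart p \<Longrightarrow> G_mode u n w \<in> mpart (\<not> p)"
  "a \<in> g_nat \<Longrightarrow> w \<in> mpart p \<Longrightarrow> J_mode a n w \<in> mpart p"
  "w \<in> mpart p \<Longrightarrow> L_mode n w \<in> mpart p"
  using md_part[OF G_odd] md_part[OF J_even] md_part[OF L_even]
  by (auto simp: G_mode_def J_mode_def L_mode_def)

text \<open>Each condition is an eigenvalue equation for an operator of definite parity, with
  eigenvalue 0 for the odd ones, so it passes to both parity components, and one of these is
  nonzero. Homogeneity is used to see that the projection of the graph to M is graded.\<close>

lemma homogeneous_highest_weight_vector:
  assumes "highest_weight_vector \<nu> l0 v"
  obtains y p where "highest_weight_vector \<nu> l0 y" "y \<in> mpart p"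
proof -
  obtain y z where yz: "y \<in> mpart False" "z \<in> mpart True" "v = y + z" using M.part_sum by blast
  have ev: "T y = mscl c y \<and> T z = mscl c z"
    if "T v = mscl c v" "T (y + z) = T y + T z" "T y \<in> mpart False" "T z \<in> mpart True" for T c
    using mpart_unique[of "T y" "mscl c y" "T z" "mscl c z"] that yz M.subspace_scale[OF M.subspace_part]
    by (simp add: M.scale_right_distrib)
  have ev0: "T y = 0 \<and> T z = 0"
    if "T v = 0" "T (y + z) = T y + T z" "T y \<in> mpart False" "T z \<in> mpart True" for T
    using ev[of T 0] that by simp
  have od0: "T y = 0 \<and> T z = 0"
    if "T v = 0" "T (y + z) = T y + T z" "T y \<in> mpart True" "T z \<in> mpart False" for T
    using mpart_unique[of "T z" 0 "T y" 0] that yz mpart_zero by (simp add: add.commute)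
  note hw = assms[unfolded highest_weight_vector_def]
  have nat: "h \<in> h_nat \<Longrightarrow> h \<in> g_nat" "h \<in> root_space_theta1 \<Longrightarrow> h
    \<in> g_nat"
    "u \<in> weight_space_half_theta1 \<Longrightarrow> u \<in> g_mhalf" for h u
    by (auto simp: h_nat_def root_space_theta1_def weight_space_half_theta1_def)
  have "L_mode 0 y = mscl l0 y \<and> L_mode 0 z = mscl l0 z"
    by (rule ev) (use hw yz modes_mpart modes_add in auto)
  moreover have "J_mode h 0 y = mscl (\<nu> h) y \<and> J_mode h 0 z = mscl (\<nu> h) z" if "h \<in> h_nat" for h
    by (rule ev) (use that hw yz nat modes_mpart modes_add in auto)
  moreover have "L_mode n y = 0 \<and> L_mode n z = 0" if "n > 0" for n
    by (rule ev0) (use that hw yz modes_mpart modes_add in auto)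
  moreover have "J_mode a n y = 0 \<and> J_mode a n z = 0" if "n > 0" "a \<in> g_nat" for n a
    by (rule ev0) (use that hw yz modes_mpart modes_add in auto)
  moreover have "J_mode a 0 y = 0 \<and> J_mode a 0 z = 0" if "a \<in> root_space_theta1" for a
    by (rule ev0) (use that hw yz nat modes_mpart modes_add in auto)
  moreover have "G_mode u n y = 0 \<and> G_mode u n z = 0" if "n > 0" "u \<in> g_mhalf" for n u
    by (rule od0) (use that hw yz modes_mpart(1)[of u y False] modes_mpart(1)[of u z True] modes_add in auto)
  moreover have "G_mode u 0 y = 0 \<and> G_mode u 0 z = 0" if "u \<in> weight_space_half_theta1" for u
    by (rule od0) (use that hw yz nat(3) modes_mpart(1)[of u y False] modes_mpart(1)[of u z True] modes_add in auto)
  moreover have "y \<noteq> 0 \<or> z \<noteq> 0" using hw yz by auto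
  ultimately have "highest_weight_vector \<nu> l0 y \<or> highest_weight_vector \<nu> l0 z"
    unfolding highest_weight_vector_def by (elim disjE) simp_all
  then show ?thesis using that yz by blast
qed

end

section \<open>Comparison with the Fock space\<close>

text \<open>A suitable product \<open>P\<close> of factors T - d with d in S kills a given element
  of the span, but multiplies v by a product of nonzero differences c - d.\<close>

lemma (in vector_space) eigenvector_not_in_other_eigenspaces:
  assumes T: "\<And>x y. T (x + y) = T x + T y" "\<And>t x. T (scale t x) = scale t (T x)"
    and v: "v \<in> span {x. \<exists>d\<in>S. T x = scale d x}" "T v = scale c v" "c \<notin> S"
  shows "v = 0"
proof -
  define P where "P ds x = foldr (\<lambda>d y. T y - scale d y) ds x" for ds x
  have neg: "T (- x) = - T x" for x using T(2)[of "-1" x] by simp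
  have P_add: "P ds (x + y) = P ds x + P ds y" for ds x y
    by (induction ds) (simp_all add: P_def T scale_right_distrib)
  have P_scale: "P ds (scale t x) = scale t (P ds x)" for ds t x
    by (induction ds) (simp_all add: P_def T scale_right_diff_distrib mult.commute)
  have P_zero: "P ds 0 = 0" for ds using P_scale[of ds 0 0] by simp
  have P_T: "P ds (T x) = T (P ds x)" for ds x
    by (induction ds) (simp_all add: P_def T neg diff_conv_add_uminus del: add_uminus_conv_diff)
  have P_append: "P (ds @ es) x = P ds (P es x)" for ds es x by (simp add: P_def)
  have P_commute: "P ds (P es x) = P es (P ds x)" for ds es x
  proof (induction ds)
    case (Cons d ds)
    have "P es (T y - scale d y) = T (P es y) - scale d (P es y)" for y
      using P_add[of es "T y" "scale (- d) y"] P_scale[of es "- d" y] by (simp add: P_T)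
    then show ?case using Cons by (simp add: P_def)
  qed (simp add: P_def)
  have "\<exists>ds. set ds \<subseteq> S \<and> P ds x = 0" if "x \<in> span {x. \<exists>d\<in>S. T x
    = scale d x}" for x
    using that
  proof (induction rule: span_induct_alt)
    case base
    show ?case by (intro exI[of _ "[]"]) (simp add: P_def)
  next
    case (step c x y)
    then obtain d ds where d: "d \<in> S" "T x = scale d x" "set ds \<subseteq> S" "P ds y = 0" by blast
    have "P [d] x = 0" using d by (simp add: P_def)
    then have "P ([d] @ ds) (scale c x + y) = 0"
      unfolding P_append P_add P_scale d(4) P_commute[of "[d]" ds] by (simp add: P_zero)
    moreover have "set ([d] @ ds) \<subseteq> S" using d by simp
    ultimately show ?case by blast
  qed
  from this[OF v(1)] obtain ds where ds: "set ds \<subseteq> S" "P ds v = 0" by blast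
  have "\<exists>t. t \<noteq> 0 \<and> P ds v = scale t v"
    using ds(1)
  proof (induction ds)
    case (Cons d ds)
    then obtain t where t: "t \<noteq> 0" "P ds v = scale t v" by auto
    have "P (d # ds) v = scale ((c - d) * t) v"
      using t v(2) by (simp add: P_def T scale_left_diff_distrib algebra_simps)
    moreover have "c - d \<noteq> 0" using Cons v(3) by auto
    ultimately show ?case using t by (intro exI[of _ "(c - d) * t"]) simp
  qed (auto simp: P_def intro: exI[of _ 1])
  then show ?thesis using ds(2) by auto
qed

locale ramond_ground_state = ramond_W_module scl part vac nprod "of_int k" L J G mscl mpart md
    + adapted_basis \<phi> k b
  for scl :: "complex \<Rightarrow> 'v::ab_group_add \<Rightarrow> 'v" and part vac nprod and k :: int and L J G
    and mscl :: "complex \<Rightarrow> 'm::ab_group_add \<Rightarrow> 'm" and mpart md \<phi> b +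
  fixes v0 :: 'm and par :: bool
  assumes hw: "highest_weight_vector (\<lambda>h. 0) (- (of_int k + 1) / 4) v0" and v0_part: "v0 \<in> mpart par"
    and irr: irreducible_module
begin

definition pair_scale :: "complex \<Rightarrow> 'm \<times> fock \<Rightarrow> 'm \<times> fock" where
  "pair_scale t x = (mscl t (fst x), fsc t (snd x))"

definition pair_G :: "mat4 \<Rightarrow> int \<Rightarrow> 'm \<times> fock \<Rightarrow> 'm \<times> fock" where
  "pair_G u n x = (G_mode u n (fst x), fG u n (snd x))"

sublocale P: supercharge_module pair_scale "of_int k" pair_G
proof unfold_locales
  fix u v w p q r x
  assume "u \<in> g_mhalf" "v \<in> g_mhalf" "w \<in> g_mhalf"
  then show "pair_G u p (pair_G v q (pair_G w r x)) + pair_G v q (pair_G u p (pair_G w r x))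
    = pair_G w r (pair_G u p (pair_G v q x) + pair_G v q (pair_G u p x))
      + pair_scale (- of_int k * ang u v * of_int (p + q - 2 * r)) (pair_G w (p + q + r) x)
      + pair_scale (2 * of_int k * of_int (p - q)) (pair_G (trip u v w) (p + q + r) x)"
    using G_triple[of u v w p q r "fst x"] fG_triple[of u v w p q r "snd x"]
    by (simp add: pair_G_def pair_scale_def del: of_int_diff of_int_add)
qed (auto simp: pair_scale_def pair_G_def prod_eq_iff M.scale_right_distrib M.scale_left_distrib
    fock.scale_right_distrib fock.scale_left_distrib modes_add modes_scl fG_add_right fG_fsc
    G_mode_linear fG_add)

text \<open>Three times the energy above the ground state minus the weight under
  \<open>nt 0 1 0\<close>. The factor 3 exceeds the weight, at most 2, of an anticommutator, so that
  a nonzero p + q decides the sign of its degree; lowering zero modes have positive degree.\<close>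

definition degree :: "'m \<Rightarrow> 'm" where
  "degree w = mscl 3 (L_mode 0 w) - mscl (3 * (- (of_int k + 1) / 4)) w - J_mode (nt 0 1 0) 0 w"

lemma degree_linear: "degree (x + y) = degree x + degree y" "degree (mscl t x) = mscl t (degree x)"
  by (simp_all add: degree_def modes_add modes_scl M.scale_right_distrib M.scale_right_diff_distrib
    mult.commute algebra_simps)

lemma nt_h_nat: "nt 0 q 0 \<in> h_nat"
  by (auto simp: h_nat_def nt_in_g_nat nt_nth)

lemma h_nat_nt: assumes "h \<in> h_nat" shows "\<exists>q. h = nt 0 q 0"
proof -
  have "h $ 3 $ 4 = 0" "h $ 4 $ 3 = 0" using assms by (auto simp: h_nat_def)
  moreover have "h = nt (h $ 3 $ 4) (h $ 3 $ 3) (h $ 4 $ 3)" using assms by (intro g_nat_eq) (simp add: h_nat_def)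
  ultimately show ?thesis by metis
qed

lemma degree_v0: "degree v0 = 0"
  using hw nt_h_nat[of 1] by (simp add: degree_def highest_weight_vector_def)

lemma degree_G:
  assumes "u \<in> weight_half \<epsilon>"
  shows "degree (G_mode u n w) = G_mode u n (degree w) + mscl (of_int (- 3 * n - \<epsilon>)) (G_mode u n w)"
proof -
  have u: "u \<in> g_mhalf" "br (nt 0 1 0) u = cmul (of_int \<epsilon>) u" using assms
    by (simp_all add: weight_half_def)
  have "degree (G_mode u n w) = G_mode u n (degree w) + (mscl (3 * - of_int n) (G_mode u n w)
    - mscl (of_int \<epsilon>) (G_mode u n w))"
    unfolding degree_def L_G_commute[OF u(1)] J_G_commute[OF nt_in_g_nat u(1)] u(2) G_mode_linear(2)[OF u(1)]
      modes_diff modes_scl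
    by (simp add: M.scale_right_distrib algebra_simps)
  then show ?thesis
    by (simp only: M.scale_left_diff_distrib[symmetric]) simp
qed

text \<open>A span of eigenvectors rather than a sum of components of M, as M is not known to be
  diagonalized by \<open>degree\<close>.\<close>

definition degree_ge :: "int \<Rightarrow> 'm set" where
  "degree_ge c = M.span {x. \<exists>d\<in>of_int ` {c..}. degree x = mscl d x}"

lemma degree_ge_subspace: "M.subspace (degree_ge c)"
  by (simp add: degree_ge_def)

lemma degree_ge_mono: "c \<le> c' \<Longrightarrow> degree_ge c' \<subseteq> degree_ge c"
  unfolding degree_ge_def by (rule M.span_mono) auto

lemma v0_degree_ge: "v0 \<in> degree_ge 0"
  unfolding degree_ge_def by (rule M.span_base) (use degree_v0 in \<open>auto intro!: bexI[of _ 0]\<close>)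

lemma v0_not_degree_ge: "v0 \<notin> degree_ge 1"
proof
  assume "v0 \<in> degree_ge 1"
  then have "v0 = 0"
    unfolding degree_ge_def
    by (rule M.eigenvector_not_in_other_eigenspaces[OF degree_linear, where c = 0]) (auto simp: degree_v0)
  then show False using hw by (simp add: highest_weight_vector_def)
qed

lemma degree_ge_map:
  assumes "\<And>x y. T (x + y) = T x + T y" "\<And>t x. T (mscl t x) = mscl t (T x)"
    and T: "\<And>x. degree (T x) = T (degree x) + mscl (of_int e) (T x)" and "x \<in> degree_ge c"
  shows "T x \<in> degree_ge (c + e)"
  using assms(4) unfolding degree_ge_def
proof (induction rule: M.span_induct_alt)
  case base
  have "T 0 = 0" using assms(2)[of 0 0] by simp
  then show ?case by (simp add: M.span_zero)
next
  case (step t x y)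
  then obtain d where d: "d \<ge> c" "degree x = mscl (of_int d) x" by auto
  then have "degree (T x) = mscl (of_int (d + e)) (T x)"
    by (simp add: T assms(2) M.scale_left_distrib)
  moreover have "of_int (d + e) \<in> (of_int ` {c + e..} :: complex set)" using d by (intro imageI) simp
  ultimately have "T x \<in> {x. \<exists>d\<in>of_int ` {c + e..}. degree x = mscl d x}" by blast
  then have "mscl t (T x) \<in> M.span {x. \<exists>d\<in>of_int ` {c + e..}. degree x = mscl d x}"
    by (intro M.span_scale M.span_base)
  then show ?case using step by (simp add: assms M.span_add)
qed

lemma degree_ge_G: "u \<in> weight_half \<epsilon> \<Longrightarrow> x \<in> degree_ge c \<Longrightarrow>
  G_mode u n x \<in> degree_ge (c + (- 3 * n - \<epsilon>))"
  by (rule degree_ge_map) (simp_all add: modes_add modes_scl degree_G)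

lemma degree_ge_anticomm:
  assumes "u \<in> weight_half \<epsilon>" "v \<in> weight_half \<delta>" "x \<in> degree_ge c"
  shows "G_anticomm u p v q x \<in> degree_ge (c + (- 3 * (p + q) - \<epsilon> - \<delta>))"
proof -
  have eq: "c + (- 3 * q - \<delta>) + (- 3 * p - \<epsilon>) = c + (- 3 * (p + q) - \<epsilon> - \<delta>)"
    "c + (- 3 * p - \<epsilon>) + (- 3 * q - \<delta>) = c + (- 3 * (p + q) - \<epsilon> - \<delta>)" by simp_all
  show ?thesis
    unfolding G_anticomm_def
    by (rule M.subspace_add[OF degree_ge_subspace degree_ge_G[OF assms(1) degree_ge_G[OF assms(2,3)], of p
      q, unfolded eq]
      degree_ge_G[OF assms(2) degree_ge_G[OF assms(1,3)], of q p, unfolded eq]])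
qed

section \<open>The graph and its two projections\<close>

definition ground_pair :: "'m \<times> fock" where "ground_pair = (v0, fvac)"

abbreviation graph :: "('m \<times> fock) set" where "graph \<equiv> P.words ground_pair"

lemma anticomm_pair: "P.anticomm u p v q (m, f) = (G_anticomm u p v q m, fG u p (fG v q f) + fG v q (fG u p f))"
  by (simp add: P.anticomm_def pair_G_def G_anticomm_def)

lemma mode_kills_ground_pair:
  assumes u: "u \<in> weight_half \<epsilon>" and n: "- 3 * n - \<epsilon> < 0"
  shows "pair_G u n ground_pair = 0"
proof -
  have e: "\<epsilon> = 1 \<or> \<epsilon> = -1" using u by (simp add: weight_half_def)
  then have n0: "n \<ge> 0" using n by auto
  have "G_mode u n v0 = 0"
  proof (cases "n > 0")
    case True
    then show ?thesis using hw weight_half_g_mhalf[OF u] by (simp add: highest_weight_vector_def)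
  next
    case False
    \<comment> \<open>Negative degree at n = 0 means weight +1, the case in which the highest weight
      condition requires the zero mode to vanish.\<close>
    then have n: "n = 0" "\<epsilon> = 1" using n0 n e by auto
    from u n(2) obtain c d where m: "u = mh 0 c d 0" by (auto elim: weight_half_cases)
    have "u \<in> weight_space_half_theta1"
      unfolding weight_space_half_theta1_def
    proof (intro CollectI conjI ballI)
      show "u \<in> g_mhalf" by (rule weight_half_g_mhalf[OF u])
      fix h assume "h \<in> h_nat"
      then obtain r where "h = nt 0 r 0" using h_nat_nt by blast
      then show "br h u = cmul (theta1 h / 2) u"
        by (simp add: m br_nt_mh cmul_mh theta1_def nt_nth mult.commute)
    qed
    then show ?thesis using hw n by (simp add: highest_weight_vector_def)
  qed
  then show ?thesis using fG_vac[OF n0] by (simp add: pair_G_def ground_pair_def zero_prod_def)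
qed

text \<open>The constants meet here. For p + q = 0 the eigenvalue -(k+1)/4 of L_0 contributes
  k(k+1)/2 times \<open>ang u v\<close>, which removes the -1/4 from the central term and leaves
  2k(k+1)p^2, the value on the Fock vacuum.\<close>

lemma anticomm_ground_pair:
  assumes u: "u \<in> weight_half \<epsilon>" and v: "v \<in> weight_half \<delta>" and d: "- 3 * (p + q)
    - \<epsilon> - \<delta> \<le> 0"
  shows "\<exists>c. P.anticomm u p v q ground_pair = pair_scale c ground_pair"
proof -
  have e: "\<epsilon> = 1 \<or> \<epsilon> = -1" "\<delta> = 1 \<or> \<delta> = -1" using u v
    by (simp_all add: weight_half_def)
  have uv: "u \<in> g_mhalf" "v \<in> g_mhalf" using weight_half_g_mhalf u v by auto
  have pq: "p + q \<ge> 0" using e d by auto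
  define c where "c = (if p + q = 0 then 2 * of_int k * (of_int k + 1) * (of_int p)\<^sup>2 * ang u v else
    0 :: complex)"
  have f: "fG u p (fG v q fvac) + fG v q (fG u p fvac) = fsc c fvac"
    using fG_vac_anti[OF uv pq] by (simp add: c_def)
  have "G_anticomm u p v q v0 = mscl c v0"
  proof (cases "p + q > 0")
    case True
    then show ?thesis using hw bil_in_g_nat[OF uv]
      by (simp add: G_anticomm_def G_G_anticommute[OF uv] c_def highest_weight_vector_def)
  next
    case False
    then have pq: "p + q = 0" using pq by simp
    have "J_mode (bil u v) 0 v0 = 0"
    proof -
      \<comment> \<open>For p + q = 0 the degree condition excludes two lowering vectors, so
        \<open>bil u v\<close> has weight 0 or \<open>theta1\<close>; in both cases its zero mode
        kills \<open>v0\<close>, since \<nu> = 0.\<close>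
      have "bil u v \<in> h_nat \<or> bil u v \<in> root_space_theta1"
      proof (cases "\<epsilon> = 1 \<and> \<delta> = 1")
        case True
        then obtain a b c d where "u = mh 0 a b 0" "v = mh 0 c d 0" using u v by (auto elim!: weight_half_cases)
        then obtain r where r: "bil u v = nt r 0 0" by (simp add: bil_mh)
        have "br h (nt r 0 0) = cmul (theta1 h) (nt r 0 0)" if h: "h \<in> h_nat" for h
        proof -
          obtain s where "h = nt 0 s 0" using h h_nat_nt by blast
          then show ?thesis by (simp add: br_nt_nt cmul_nt theta1_def nt_nth mult.assoc)
        qed
        then have "bil u v \<in> root_space_theta1" using r by (simp add: root_space_theta1_def nt_in_g_nat)
        then show ?thesis ..
      next
        case False
        then have "\<epsilon> + \<delta> = 0" using e d pq by auto
        then have "(\<exists>a b c d. u = mh 0 a b 0 \<and> v = mh c 0 0 d) \<or> (\<exists>a b c d. u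
        = mh a 0 0 b \<and> v = mh 0 c d 0)"
          using u v by (auto elim!: weight_half_cases)
        then have "bil u v \<in> h_nat" using nt_h_nat by (auto simp: bil_mh)
        then show ?thesis ..
      qed
      then show ?thesis using hw by (auto simp: highest_weight_vector_def)
    qed
    moreover have "L_mode 0 v0 = mscl (- (of_int k + 1) / 4) v0" using hw by (simp add: highest_weight_vector_def)
    ultimately have "G_anticomm u p v q v0 = mscl (- 2 * of_int k * ang u v * (- (of_int k + 1) / 4)
       + 2 * of_int k * (of_int k + 1) * ((of_int p)\<^sup>2 - 1/4) * ang u v) v0"
      unfolding G_anticomm_def G_G_anticommute[OF uv] pq
      by (simp only: M.scale_zero_right M.scale_scale M.scale_left_distrib if_True simp_thms add_0_right)
    also have "- 2 * of_int k * ang u v * (- (of_int k + 1) / 4)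
       + 2 * of_int k * (of_int k + 1) * ((of_int p)\<^sup>2 - 1/4) * ang u v = c"
      by (simp add: c_def pq field_simps)
    finally show ?thesis .
  qed
  then show ?thesis using f by (auto simp: ground_pair_def anticomm_pair pair_scale_def)
qed

lemma graph_G: "x \<in> graph \<Longrightarrow> u \<in> g_mhalf \<Longrightarrow> pair_G u n x \<in> graph"
proof -
  assume x: "x \<in> graph" and u: "u \<in> g_mhalf"
  have "(\<forall>u\<in>g_mhalf. \<forall>n. pair_G u n x \<in> graph) \<and>
    (\<forall>u\<in>g_mhalf. \<forall>v\<in>g_mhalf. \<forall>p q. P.anticomm u p v q x \<in> graph)"
    by (rule P.words_closed[OF _ _ x]) (use mode_kills_ground_pair anticomm_ground_pair in blast)+
  then show ?thesis using u by blast
qed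

lemma graph_zero: "0 \<in> graph"
  using P.words.scale[OF P.words.base, of 0 ground_pair] by simp

lemma graph_subspace: "P.subspace graph"
  by (rule P.subspaceI) (auto intro: graph_zero P.words.add P.words.scale)

text \<open>A letter of positive degree raises the first component into degree at least 1, while its
  adjoint kills the Fock vacuum, so that the vacuum coefficient of the second component becomes
  0.\<close>

lemma graph_projection:
  "x \<in> graph \<Longrightarrow> fst x - mscl (fip fvac (snd x)) v0 \<in> degree_ge 1"
proof (induction rule: P.words.induct)
  case base
  show ?case using M.subspace_0[OF degree_ge_subspace] by (simp add: ground_pair_def fip_fvac)
next
  case (add x y)
  from M.subspace_add[OF degree_ge_subspace add.IH] show ?case
    by (simp add: fip_add_right M.scale_left_distrib algebra_simps)
next
  case (scale x t)
  from M.subspace_scale[OF degree_ge_subspace scale.IH, of t] show ?case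
    by (simp add: pair_scale_def fip_scale_right M.scale_right_diff_distrib)
next
  case (mode x u \<epsilon> n)
  have e: "\<epsilon> = 1 \<or> \<epsilon> = -1" using mode by (simp add: weight_half_def)
  then have n: "n \<le> 0" using mode(3) by auto
  have u: "u \<in> g_mhalf" using mode weight_half_g_mhalf by blast
  have "fst x \<in> degree_ge 0"
    using M.subspace_add[OF degree_ge_subspace subsetD[OF degree_ge_mono mode.IH] M.subspace_scale[OF
      degree_ge_subspace v0_degree_ge]]
    by (metis diff_add_cancel zero_le_one)
  then have "G_mode u n (fst x) \<in> degree_ge (0 + (- 3 * n - \<epsilon>))" using degree_ge_G mode by blast
  then have "G_mode u n (fst x) \<in> degree_ge 1" using degree_ge_mono[of 1 "- 3 * n - \<epsilon>"] mode by auto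
  moreover have "fip fvac (fG u n (snd x)) = 0"
  proof -
    have "fip (fG u n (snd x)) fvac = 0" using fG_adjoint[OF u] fG_vac n by simp
    then show ?thesis using fip_cnj[of fvac "fG u n (snd x)"] by simp
  qed
  ultimately show ?case by (simp add: pair_G_def)
next
  case (anticomm x u \<epsilon> v \<delta> p q)
  obtain m f where x: "x = (m, f)" by (cases x)
  have e: "\<epsilon> = 1 \<or> \<epsilon> = -1" "\<delta> = 1 \<or> \<delta> = -1" using anticomm
    by (simp_all add: weight_half_def)
  then have pq: "p + q \<le> 0" using anticomm(4) by auto
  have uv: "u \<in> g_mhalf" "v \<in> g_mhalf" using anticomm weight_half_g_mhalf by auto
  have "m \<in> degree_ge 0"
    using M.subspace_add[OF degree_ge_subspace subsetD[OF degree_ge_mono anticomm.IH] M.subspace_scale[OF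
      degree_ge_subspace v0_degree_ge]] x
    by (metis diff_add_cancel zero_le_one fst_conv)
  then have "G_anticomm u p v q m \<in> degree_ge (0 + (- 3 * (p + q) - \<epsilon> - \<delta>))"
    using degree_ge_anticomm anticomm by blast
  then have "G_anticomm u p v q m \<in> degree_ge 1" using degree_ge_mono[of 1 "- 3 * (p + q) - \<epsilon>
    - \<delta>"] anticomm by auto
  moreover have "fip (fG u p (fG v q f) + fG v q (fG u p f)) fvac = 0"
  proof -
    have "fip (fG u p (fG v q f) + fG v q (fG u p f)) fvac
      = fip f (fG (\<phi> v) (- q) (fG (\<phi> u) (- p) fvac) + fG (\<phi> u) (- p) (fG (\<phi> v) (- q) fvac))"
      using uv phi_g_mhalf by (simp add: fip_add_left fip_add_right fG_adjoint)
    also have "fG (\<phi> v) (- q) (fG (\<phi> u) (- p) fvac) + fG (\<phi> u) (- p) (fG (\<phi> v) (- q) fvac) = 0"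
    proof (cases "p + q = 0")
      case False
      then show ?thesis using fG_vac_anti[of "\<phi> v" "\<phi> u" "- q" "- p"] uv phi_g_mhalf pq by simp
    next
      case True
      \<comment> \<open>Positive degree at p + q = 0 leaves two lowering vectors; their weight space
        is isotropic for \<open>ang\<close>, so the scalar on the vacuum is 0.\<close>
      have "\<epsilon> = -1" "\<delta> = -1" using anticomm(4) e True by auto
      then have "ang v u = 0" using anticomm(2,3) by (auto elim!: weight_half_cases simp: ang_mh)
      then have "ang (\<phi> v) (\<phi> u) = 0" using ang_phi uv by simp
      then show ?thesis using fG_vac_anti[of "\<phi> v" "\<phi> u" "- q" "- p"] uv phi_g_mhalf pq by simp
    qed
    finally show ?thesis by simp
  qed
  then have "fip fvac (fG u p (fG v q f) + fG v q (fG u p f)) = 0"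
    using fip_cnj[of fvac "fG u p (fG v q f) + fG v q (fG u p f)"] by simp
  ultimately show ?case by (simp add: x anticomm_pair)
qed

lemma degree_mpart: "w \<in> mpart p \<Longrightarrow> degree w \<in> mpart p"
  unfolding degree_def using modes_mpart(2)[OF nt_in_g_nat] modes_mpart(3)
  by (intro M.subspace_diff[OF M.subspace_part] M.subspace_scale[OF M.subspace_part])

lemma degree_ge_homogeneous:
  assumes "x \<in> degree_ge c" shows "\<exists>y\<in>degree_ge c \<inter> mpart False.
    \<exists>z\<in>degree_ge c \<inter> mpart True. x = y + z"
  using assms unfolding degree_ge_def
proof (induction rule: M.span_induct_alt)
  case base
  show ?case using M.span_zero mpart_zero by (intro bexI[of _ 0]) auto
next
  case (step t x w)
  let ?S = "{x. \<exists>d\<in>of_int ` {c..}. degree x = mscl d x}"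
  obtain d where d: "d \<in> of_int ` {c..}" "degree x = mscl d x" using step by blast
  obtain y z where yz: "y \<in> mpart False" "z \<in> mpart True" "x = y + z" using M.part_sum by blast
  have "degree y = mscl d y \<and> degree z = mscl d z"
  proof (rule mpart_unique)
    show "degree y + degree z = mscl d y + mscl d z"
      using d(2) by (simp add: yz(3) degree_linear M.scale_right_distrib)
  qed (use yz degree_mpart M.subspace_scale[OF M.subspace_part] in auto)
  then have "y \<in> M.span ?S" "z \<in> M.span ?S" using d(1) by (auto intro!: M.span_base)
  moreover obtain y' z' where w: "y' \<in> M.span ?S \<inter> mpart False" "z' \<in> M.span ?S \<inter>
    mpart True" "w = y' + z'"
    using step by blast
  ultimately have "mscl t y + y' \<in> M.span ?S \<inter> mpart False" "mscl t z + z' \<in> M.span ?S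
    \<inter> mpart True"
    using yz by (auto intro!: M.span_add M.span_scale M.subspace_add[OF M.subspace_part]
      M.subspace_scale[OF M.subspace_part])
  moreover have "mscl t x + w = (mscl t y + y') + (mscl t z + z')"
    by (simp add: yz(3) w(3) M.scale_right_distrib)
  ultimately show ?case by blast
qed

text \<open>Irreducibility speaks of graded submodules. Odd modes interchange the two parity
  projections of K, and these stay in \<open>degree_ge 1\<close> because that space is graded; the
  graded hull therefore still misses \<open>v0\<close>.\<close>

lemma graph_left_injective:
  assumes "(m, 0) \<in> graph" shows "m = 0"
proof -
  define K where "K = {m. (m, 0) \<in> graph}"
  have K_sub: "M.subspace K"
    unfolding K_def
  proof (rule M.subspaceI; clarify)
    show "(0, 0) \<in> graph" using graph_zero by (simp add: zero_prod_def)
    show "(x + y, 0) \<in> graph" if "(x, 0) \<in> graph" "(y, 0) \<in> graph" for x y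
      using P.words.add[OF that] by simp
    show "(mscl t x, 0) \<in> graph" if "(x, 0) \<in> graph" for t x
      using P.words.scale[OF that, of t] by (simp add: pair_scale_def)
  qed
  have K_G: "G_mode u n x \<in> K" if "x \<in> K" "u \<in> g_mhalf" for x u n
    using graph_G[of "(x, 0)" u n] that by (simp add: K_def pair_G_def)
  have K_degree_ge: "K \<subseteq> degree_ge 1"
    using graph_projection by (force simp: K_def)
  \<comment> \<open>K is not known to be graded; W below is its graded hull.\<close>
  define R where "R p = {y \<in> mpart p. \<exists>z\<in>mpart (\<not> p). y + z \<in> K}" for p
  have R_sub: "M.subspace (R p)" for p
    unfolding R_def
  proof (rule M.subspaceI; clarify)
    show "0 \<in> mpart p \<and> (\<exists>z\<in>mpart (\<not> p). 0 + z \<in> K)"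
      using mpart_zero M.subspace_0[OF K_sub] by (auto intro!: bexI[of _ 0])
  next
    fix x y z z' assume *: "x \<in> mpart p" "y \<in> mpart p" "z \<in> mpart (\<not> p)" "x + z \<in> K"
      "z' \<in> mpart (\<not> p)" "y + z' \<in> K"
    have "x + y + (z + z') \<in> K" using M.subspace_add[OF K_sub *(4,6)] by (simp add: add_ac)
    then show "x + y \<in> mpart p \<and> (\<exists>z\<in>mpart (\<not> p). x + y + z \<in> K)"
      using * M.subspace_add[OF M.subspace_part] by blast
  next
    fix t x z assume *: "x \<in> mpart p" "z \<in> mpart (\<not> p)" "x + z \<in> K"
    have "mscl t x + mscl t z \<in> K" using M.subspace_scale[OF K_sub *(3), of t]
      by (simp add: M.scale_right_distrib)
    then show "mscl t x \<in> mpart p \<and> (\<exists>z\<in>mpart (\<not> p). mscl t x + z \<in> K)"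
      using * M.subspace_scale[OF M.subspace_part] by blast
  qed
  have R_G: "G_mode u n y \<in> R (\<not> p)" if "y \<in> R p" "u \<in> g_mhalf" for u n y p
  proof -
    obtain z where "y \<in> mpart p" "z \<in> mpart (\<not> p)" "y + z \<in> K"
      using \<open>y \<in> R p\<close> by (auto simp: R_def)
    then show ?thesis
      using K_G[of "y + z" u n] modes_mpart(1)[of u y p n] modes_mpart(1)[of u z "\<not> p" n] that(2)
      by (auto simp: R_def modes_add intro!: bexI[of _ "G_mode u n z"])
  qed
  have R_degree_ge: "R p \<subseteq> degree_ge 1" for p
  proof
    fix y assume "y \<in> R p"
    then obtain z where yz: "y \<in> mpart p" "z \<in> mpart (\<not> p)" "y + z \<in> degree_ge 1"
      using K_degree_ge by (auto simp: R_def)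
    obtain a c where ac: "a \<in> degree_ge 1" "a \<in> mpart False" "c \<in> degree_ge 1" "c \<in> mpart
      True" "y + z = a + c"
      using degree_ge_homogeneous[OF yz(3)] by blast
    show "y \<in> degree_ge 1"
    proof (cases p)
      case True
      then have "z = a \<and> y = c" using yz ac by (intro mpart_unique) (simp_all add: add.commute)
      then show ?thesis using ac by simp
    next
      case False
      then have "y = a \<and> z = c" using yz ac by (intro mpart_unique) simp_all
      then show ?thesis using ac by simp
    qed
  qed
  define W where "W = {y + z |y z. y \<in> R False \<and> z \<in> R True}"
  have W_sub: "M.subspace W" unfolding W_def by (rule M.subspace_sums[OF R_sub R_sub])
  have W_mem: "R p \<subseteq> W" for p
    using M.subspace_0[OF R_sub] by (cases p) (force simp: W_def)+
  have "submodule W"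
  proof (rule submodule_of_G_stable[OF W_sub])
    fix w assume "w \<in> W"
    then obtain y z where yz: "y \<in> R False" "z \<in> R True" "w = y + z" by (auto simp: W_def)
    have "y \<in> W \<inter> mpart False" "z \<in> W \<inter> mpart True"
      using yz subsetD[OF W_mem yz(1)] subsetD[OF W_mem yz(2)] by (simp_all add: R_def)
    then show "\<exists>y\<in>W \<inter> mpart False. \<exists>z\<in>W \<inter> mpart True. w = y + z"
      using yz(3) by blast
    fix u n assume u: "u \<in> g_mhalf"
    have "G_mode u n y \<in> W" "G_mode u n z \<in> W"
      using R_G[OF yz(1) u] R_G[OF yz(2) u] W_mem by blast+
    then show "G_mode u n w \<in> W" using M.subspace_add[OF W_sub] by (simp add: yz(3) modes_add)
  qed
  moreover have "W \<subseteq> degree_ge 1"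
    unfolding W_def using subsetD[OF R_degree_ge] by (blast intro: M.subspace_add[OF degree_ge_subspace])
  then have "W \<noteq> UNIV" using v0_not_degree_ge by blast
  ultimately have W0: "W = {0}" using irr by (auto simp: irreducible_module_def)
  obtain y z where yz: "y \<in> mpart False" "z \<in> mpart True" "m = y + z" using M.part_sum by blast
  then have "y \<in> R False" "z \<in> R True" using assms by (auto simp: R_def K_def add.commute)
  then have "y = 0" "z = 0" using W_mem W0 by blast+
  then show ?thesis using yz by simp
qed

text \<open>The projection to M is graded since it is generated from the homogeneous vector
  \<open>v0\<close> by odd modes, so irreducibility applies to it.\<close>

lemma graph_left_surjective: "\<exists>f. (m, f) \<in> graph"
proof -
  define U where "U = fst ` graph"
  have U_sub: "M.subspace U"
    unfolding U_def
  proof (rule M.subspaceI)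
    show "0 \<in> fst ` graph" using graph_zero by force
    show "x + y \<in> fst ` graph" if "x \<in> fst ` graph" "y \<in> fst ` graph" for x y
    proof -
      from that obtain f f' where "(x, f) \<in> graph" "(y, f') \<in> graph" by force
      from P.words.add[OF this] show ?thesis by force
    qed
    show "mscl t x \<in> fst ` graph" if "x \<in> fst ` graph" for t x
    proof -
      from that obtain f where "(x, f) \<in> graph" by force
      from P.words.scale[OF this, of t] show ?thesis by (force simp: pair_scale_def)
    qed
  qed
  have U_G: "G_mode u n x \<in> U" if x: "x \<in> U" and "u \<in> g_mhalf" for u n x
  proof -
    from x obtain f where "(x, f) \<in> graph" by (force simp: U_def)
    from graph_G[OF this that(2), of n] show ?thesis by (force simp: U_def pair_G_def)
  qed
  have U_hom: "\<exists>y\<in>U \<inter> mpart False. \<exists>z\<in>U \<inter> mpart True. fst x = y + z"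
    if "x \<in> graph" for x
    using that
  proof (induction rule: P.words.induct)
    case base
    have "v0 \<in> U" using P.words.base[of ground_pair] by (force simp: U_def ground_pair_def)
    then show ?case using v0_part mpart_zero M.subspace_0[OF U_sub]
      by (cases par) (auto simp: ground_pair_def intro: bexI[of _ 0] bexI[of _ v0])
  next
    case (add x y)
    then obtain a c a' c' where "a \<in> U \<inter> mpart False" "c \<in> U \<inter> mpart True" "fst x = a + c"
      "a' \<in> U \<inter> mpart False" "c' \<in> U \<inter> mpart True" "fst y = a' + c'" by blast
    then show ?case
      using M.subspace_add[OF U_sub] M.subspace_add[OF M.subspace_part]
      by (intro bexI[of _ "a + a'"] bexI[of _ "c + c'"]) (auto simp: add_ac)
  next
    case (scale x t)
    then obtain a c where "a \<in> U \<inter> mpart False" "c \<in> U \<inter> mpart True" "fst x = a + c" by blast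
    then show ?case
      using M.subspace_scale[OF U_sub] M.subspace_scale[OF M.subspace_part]
      by (intro bexI[of _ "mscl t a"] bexI[of _ "mscl t c"]) (auto simp: pair_scale_def M.scale_right_distrib)
  next
    case (mode x u \<epsilon> n)
    then obtain a c where "a \<in> U \<inter> mpart False" "c \<in> U \<inter> mpart True" "fst x = a + c" by blast
    moreover have "u \<in> g_mhalf" using mode weight_half_g_mhalf by blast
    ultimately show ?case
      using U_G modes_mpart(1)[of u a False n] modes_mpart(1)[of u c True n]
      by (intro bexI[of _ "G_mode u n c"] bexI[of _ "G_mode u n a"]) (auto simp: pair_G_def modes_add add.commute)
  next
    case (anticomm x u \<epsilon> v \<delta> p q)
    then obtain a c where ac: "a \<in> U \<inter> mpart False" "c \<in> U \<inter> mpart True" "fst x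
      = a + c" by blast
    have uv: "u \<in> g_mhalf" "v \<in> g_mhalf" using anticomm weight_half_g_mhalf by auto
    have "G_anticomm u p v q w \<in> U \<inter> mpart s" if w: "w \<in> U \<inter> mpart s" for w s
    proof -
      have "G_mode u p (G_mode v q w) \<in> mpart (\<not> (\<not> s))" "G_mode v q (G_mode u p w) \<in>
        mpart (\<not> (\<not> s))"
        using w uv modes_mpart(1) by blast+
      then show ?thesis
        using U_G w uv M.subspace_add[OF U_sub] M.subspace_add[OF M.subspace_part] by (simp add: G_anticomm_def)
    qed
    moreover have "fst (P.anticomm u p v q x) = G_anticomm u p v q a + G_anticomm u p v q c"
      using ac(3) by (cases x) (simp add: anticomm_pair G_anticomm_def modes_add add_ac)
    ultimately show ?case using ac by blast
  qed
  have "submodule U"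
    by (rule submodule_of_G_stable[OF U_sub]) (use U_hom U_G in \<open>auto simp: U_def\<close>)
  moreover have "v0 \<in> U" using P.words.base[of ground_pair] by (force simp: U_def ground_pair_def)
  moreover have "v0 \<noteq> 0" using hw by (simp add: highest_weight_vector_def)
  ultimately have "U = UNIV" using irr by (auto simp: irreducible_module_def)
  then have "m \<in> U" by simp
  then show ?thesis by (force simp: U_def)
qed

text \<open>Adjoint modes keep pairs with first component 0 in the graph, which reduces
  orthogonality to the vacuum; there it holds because \<open>v0\<close> is not in
  \<open>degree_ge 1\<close>. Finally f is itself a second component.\<close>

lemma graph_right_injective:
  assumes "(0, f) \<in> graph" shows "f = 0"
proof -
  have "\<forall>f. (0, f) \<in> graph \<longrightarrow> fip (snd x) f = 0" if "x \<in> graph" for x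
    using that
  proof (induction rule: P.words.induct)
    case base
    show ?case
    proof (intro allI impI)
      fix f assume "(0, f) \<in> graph"
      then have "- mscl (fip fvac f) v0 \<in> degree_ge 1" using graph_projection by force
      then have "mscl (fip fvac f) v0 \<in> degree_ge 1" using M.subspace_neg[OF degree_ge_subspace] by force
      then have "fip fvac f \<noteq> 0 \<Longrightarrow> v0 \<in> degree_ge 1"
        using M.subspace_scale[OF degree_ge_subspace, of _ 1 "1 / fip fvac f"] by fastforce
      then show "fip (snd ground_pair) f = 0" using v0_not_degree_ge by (auto simp: ground_pair_def)
    qed
  next
    case (add x y)
    then show ?case by (simp add: fip_add_left)
  next
    case (scale x t)
    then show ?case by (simp add: pair_scale_def fip_scale_left)
  next
    case (mode x u \<epsilon> n)
    then have u: "u \<in> g_mhalf" using weight_half_g_mhalf by blast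
    have "(0, fG (\<phi> u) (- n) f) \<in> graph" if "(0, f) \<in> graph" for f
      using graph_G[OF that phi_g_mhalf[OF u], of "- n"] by (simp add: pair_G_def)
    moreover have "snd (pair_G u n x) = fG u n (snd x)" by (simp add: pair_G_def)
    ultimately show ?case
      using mode.IH u by (auto simp: fG_adjoint)
  next
    case (anticomm x u \<epsilon> v \<delta> p q)
    then have uv: "u \<in> g_mhalf" "v \<in> g_mhalf" using weight_half_g_mhalf by auto
    have "(0, fG (\<phi> w) n f) \<in> graph" if "(0, f) \<in> graph" "w \<in> g_mhalf" for f w n
      using graph_G[OF that(1) phi_g_mhalf[OF that(2)], of n] by (simp add: pair_G_def)
    then show ?case
      using anticomm.IH uv by (cases x) (auto simp: anticomm_pair fG_adjoint fip_add_left)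
  qed
  from this[OF assms] assms have "fip f f = 0" by simp
  then show ?thesis using fip_pos[of f] by fastforce
qed

section \<open>The embedding and the transported Hermitian form\<close>

definition emb :: "'m \<Rightarrow> fock" where
  "emb m = (SOME f. (m, f) \<in> graph)"

lemma emb_graph: "(m, emb m) \<in> graph"
  unfolding emb_def using graph_left_surjective by (rule someI_ex)

lemma emb_eq: "(m, f) \<in> graph \<Longrightarrow> emb m = f"
proof -
  assume "(m, f) \<in> graph"
  from P.subspace_diff[OF graph_subspace emb_graph[of m] this] have "(0, emb m - f) \<in> graph" by simp
  from graph_right_injective[OF this] show ?thesis by simp
qed

lemma emb_linear: "emb (x + y) = emb x + emb y" "emb (mscl t x) = fsc t (emb x)"
  "u \<in> g_mhalf \<Longrightarrow> emb (G_mode u n x) = fG u n (emb x)"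
  using P.words.add[OF emb_graph[of x] emb_graph[of y]] P.words.scale[OF emb_graph[of x], of t] graph_G[OF
    emb_graph[of x], of u n]
  by (auto simp: pair_scale_def pair_G_def intro!: emb_eq)

definition herm :: "'m \<Rightarrow> 'm \<Rightarrow> complex" where
  "herm x y = fip (emb x) (emb y)"

lemma herm_simps:
  "herm x (y + z) = herm x y + herm x z" "herm (x + y) z = herm x z + herm y z"
  "herm x (mscl t y) = t * herm x y" "herm (mscl t x) y = cnj t * herm x y"
  by (simp_all add: herm_def emb_linear fip_add_right fip_scale_right fip_add_left fip_scale_left)

lemma herm_diff: "herm x (y - z) = herm x y - herm x z" "herm (x - y) z = herm x z - herm y z"
  "herm x (- y) = - herm x y"
  using herm_simps(1)[of x "y - z" z] herm_simps(2)[of "x - y" y z] herm_simps(3)[of x "-1" y]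
  by (simp_all add: eq_diff_eq)

lemma herm_zero: "herm 0 y = 0" "herm x 0 = 0"
  using herm_simps(3)[of x 0 0] herm_simps(4)[of 0 0 y] by simp_all

lemma herm_positive: "positive_definite_hermitian herm"
  unfolding positive_definite_hermitian_def
proof (intro conjI allI impI)
  show "herm y x = cnj (herm x y)" for x y unfolding herm_def by (rule fip_cnj)
  fix x :: 'm assume "x \<noteq> 0"
  then have "emb x \<noteq> 0" using emb_graph[of x] graph_left_injective by metis
  then show "0 < Re (herm x x)" unfolding herm_def by (rule fip_pos)
qed (simp_all add: herm_simps)

lemma herm_G: "u \<in> g_mhalf \<Longrightarrow> herm (G_mode u n x) y = herm x (G_mode (\<phi> u) (- n) y)"
  by (simp add: herm_def emb_linear fG_adjoint phi_g_mhalf)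

lemma herm_anticomm:
  assumes "u \<in> g_mhalf" "v \<in> g_mhalf"
  shows "herm (G_anticomm u p v q x) y = herm x (G_anticomm (\<phi> u) (- p) (\<phi> v) (- q) y)"
  using assms by (simp add: G_anticomm_def herm_simps herm_G phi_g_mhalf)

text \<open>J-modes are differences of anticommutators of G-modes. Passing to adjoints negates p and
  q, hence also the factor p - q, and this is the origin of the minus sign.\<close>

lemma herm_J:
  assumes "a \<in> g_nat" shows "herm (J_mode a n x) y = herm x (- J_mode (\<phi> a) (- n) y)"
proof -
  have bil: "herm (J_mode (bil u v) n x) y = - herm x (J_mode (\<phi> (bil u v)) (- n) y)"
    if uv: "u \<in> g_mhalf" "v \<in> g_mhalf" for u v
  proof -
    obtain p q where pq: "n = p + q" "p \<noteq> q"
      by (cases "n = 0") (auto intro: that[of 1 "-1"] that[of n 0])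
    let ?c = "4 * of_int k * of_int (p - q) :: complex"
    have c: "?c \<noteq> 0" using pq k_le by simp
    have "?c * herm (J_mode (bil u v) n x) y = herm (mscl ?c (J_mode (bil u v) n x)) y"
      by (simp add: herm_simps)
    also have "\<dots> = herm x (G_anticomm (\<phi> u) (- p) (\<phi> v) (- q) y
      - G_anticomm (\<phi> u) (- q) (\<phi> v) (- p) y)"
      unfolding pq(1) J_via_G[OF uv] herm_diff herm_anticomm[OF uv] by simp
    also have "\<dots> = herm x (mscl (- ?c) (J_mode (\<phi> (bil u v)) (- n) y))"
    proof -
      have "4 * of_int k * of_int (- p - - q) = - ?c" "- p + - q = - n" using pq(1) by (simp_all add: algebra_simps)
      then show ?thesis
        using J_via_G[OF phi_g_mhalf[OF uv(1)] phi_g_mhalf[OF uv(2)], of "- p" "- q" y]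
        by (simp only: bil_phi[OF uv])
    qed
    also have "\<dots> = ?c * (- herm x (J_mode (\<phi> (bil u v)) (- n) y))" by (simp add: herm_simps herm_diff)
    finally show ?thesis using c mult_cancel_left by blast
  qed
  obtain u1 v1 u2 v2 u3 v3 where d: "a = bil u1 v1 + bil u2 v2 + bil u3 v3"
    "{u1, v1, u2, v2, u3, v3} \<subseteq> g_mhalf" by (rule g_nat_bil_decomp[OF assms])
  then have b: "bil u1 v1 \<in> g_nat" "bil u2 v2 \<in> g_nat" "bil u3 v3 \<in> g_nat"
    by (simp_all add: bil_in_g_nat)
  have "\<phi> a = \<phi> (bil u1 v1) + \<phi> (bil u2 v2) + \<phi> (bil u3 v3)"
    unfolding d(1) using b by (simp add: phi_facts(1) in_psl22(2) g_nat_closed(1))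
  then have "J_mode (\<phi> a) (- n) y = J_mode (\<phi> (bil u1 v1)) (- n) y + J_mode (\<phi> (bil u2 v2))
    (- n) y + J_mode (\<phi> (bil u3 v3)) (- n) y"
    using b phi_g_nat by (simp add: J_mode_linear g_nat_closed)
  moreover have "J_mode a n x = J_mode (bil u1 v1) n x + J_mode (bil u2 v2) n x + J_mode (bil u3 v3) n x"
    using b by (simp add: d(1) J_mode_linear g_nat_closed)
  ultimately show ?thesis using bil d(2) by (simp add: herm_simps herm_diff)
qed

text \<open>A basis vector fixed by \<phi>, taken twice, expresses L-modes through anticommutators
  with real coefficients, so their adjoints follow from those of G.\<close>

lemma herm_L: "herm (L_mode n x) y = herm x (L_mode (- n) y)"
proof -
  obtain u where u: "u \<in> g_mhalf" "\<phi> u = u" "ang u u = 1" "bil u u = cmul 0 (nt 0 0 0)"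
  proof (rule that[of "b 0"])
    show "bil (b 0) (b 0) = cmul 0 (nt 0 0 0)" using b_mem[of 0]
      by (auto elim!: g_mhalf_cases simp: bil_mh cmul_nt)
  qed (simp_all add: b_mem b_fixed b_orthonormal)
  have eq: "mscl (- 2 * of_int k) (L_mode n w) = G_anticomm u n u 0 w
     + (if n = 0 then mscl (of_int k * (of_int k + 1) / 2) w else 0)" for n w
    unfolding G_anticomm_def G_G_anticommute[OF u(1,1)] u(3,4)
    using J_mode_linear(2)[OF nt_in_g_nat[of 0 0 0], of 0 n w] by (simp add: mult.commute)
  have sym: "G_anticomm u m u 0 w = G_anticomm u 0 u m w" for m w by (simp add: G_anticomm_def add.commute)
  let ?c = "- 2 * of_int k :: complex"
  have c: "?c \<noteq> 0" using k_le by simp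
  have "cnj ?c = ?c" by simp
  then have "?c * herm (L_mode n x) y = herm (mscl ?c (L_mode n x)) y" by (simp only: herm_simps)
  also have "\<dots> = herm x (mscl ?c (L_mode (- n) y))"
    unfolding eq using herm_anticomm[OF u(1,1), of n 0 x y] u(2) by (simp add: herm_simps herm_zero)
  also have "\<dots> = ?c * herm x (L_mode (- n) y)" by (simp only: herm_simps)
  finally show ?thesis using c mult_cancel_left by blast
qed

lemma unitary: "unitary_module \<phi>"
  unfolding unitary_module_def adjoint_wrt_def
  using herm_positive herm_G herm_J herm_L by blast

end

theorem mainTheorem11:
  fixes k :: int
    and scl :: "complex \<Rightarrow> 'v::ab_group_add \<Rightarrow> 'v" and part :: "bool \<Rightarrow> 'v set"
    and vac L :: 'v and nprod :: "int \<Rightarrow> 'v \<Rightarrow> 'v \<Rightarrow> 'v" and J G :: "mat4 \<Rightarrow> 'v"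
    and mscl :: "complex \<Rightarrow> 'm::ab_group_add \<Rightarrow> 'm" and mpart :: "bool \<Rightarrow> 'm set"
    and md :: "rat \<Rightarrow> 'v \<Rightarrow> 'm \<Rightarrow> 'm"
    and \<phi> :: "mat4 \<Rightarrow> mat4"
  assumes "k \<le> -2"
    and "almost_compact \<phi>" and "positive_on_g_mhalf \<phi>"
    and "ramond_W_module scl part vac nprod (of_int k) L J G mscl mpart md"
    and "ramond_W_module.is_LW L J G mscl mpart md (\<lambda>h. 0) (- (of_int k + 1) / 4)"
  shows "ramond_W_module.unitary_module L J G mscl md \<phi>"
proof -
  interpret A: adapted_involution \<phi>
    by unfold_locales (use assms in auto)
  obtain b where b: "(\<forall>i<4. b i \<in> g_mhalf \<and> \<phi> (b i) = b i)
    \<and> (\<forall>i<4. \<forall>j<4. ang (b i) (b j) = (if i = j then 1 else 0))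
    \<and> (\<forall>i<4. \<forall>j<4. \<forall>l<4. trip (b i) (b j) (b l)
        = (if i = j then 0 else cmul (of_int (qtriple i j l) / 2) (b (qadd (qadd i j) l))))"
    using A.ex_adapted_basis by blast
  interpret B: adapted_basis \<phi> k b
    by unfold_locales (use assms(1) b in auto)
  interpret W: ramond_W_module scl part vac nprod "of_int k" L J G mscl mpart md
    by (rule assms(4))
  obtain v where hv: "W.highest_weight_vector (\<lambda>h. 0) (- (of_int k + 1) / 4) v"
    and irr: "W.irreducible_module"
    using assms(5) unfolding W.is_LW_def by blast
  from hv obtain y p where "W.highest_weight_vector (\<lambda>h. 0) (- (of_int k + 1) / 4) y" "y \<in> mpart p"
    by (rule W.homogeneous_highest_weight_vector)
  then interpret R: ramond_ground_state scl part vac nprod k L J G mscl mpart md \<phi> b y p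
    by unfold_locales (use irr in auto)
  show ?thesis by (rule R.unitary)
qed

end
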